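(* Consider the plant $\dot x_1=f_1(t,x,u)$, $\dot x_2=f_2(t,x,u)+d(t)$, where each component of $d(t)$ is a trigonometric polynomial $d_i(t)=a_{i0}+\sum_{j=1}^{\rho_i}a_{ij}\sin(\omega_{ij}t+\phi_{ij})$, $i=1,\dots,n_2$, together with the dynamic compensators $$\dot\eta=M\eta+Nf_2(t,x,u)-MNx_2,$$ $$\dot{\hat x}_2=f_2(t,x,u)-\mathcal M(\hat\varrho)\theta+K(\hat x_2-x_2),$$ $$\dot\theta=\Lambda\mathcal M^\top(\hat\varrho)P(\hat x_2-x_2),$$ with $\hat\varrho:=\eta-Nx_2$. Let $\hat d:=-\mathcal M(\hat\varrho)\theta$. Then, for any Hurwitz $K\in\mathbb R^{n_2\times n_2}$ (with $P$ the symmetric positive definite matrix satisfying $K^\top P+PK=-I_{n_2}$), any symmetric positive definite $\Lambda\in\mathbb R^{\bar r\times\bar r}$, and any initial conditions $x(0),\eta(0),\hat x_2(0),\theta(0)$, $$\lim_{t\to\infty}(\hat x_2(t)-x_2(t))=0,\qquad \lim_{t\to\infty}(\hat d(t)-d(t))=0.$$ If, in addition, $\varrho_i(t)$ is persistently exciting for every $i=1,\dots,n_2$, then both of these convergences are exponential, and moreover $$\lim_{t\to\infty}(\theta(t)-\mathcal C(\Psi))=0$$ exponentially.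
   Context: Plant: $x_1\in\mathbb R^{n_1}$, $x_2\in\mathbb R^{n_2}$, $x=\operatorname{col}(x_1,x_2)\in\mathbb R^n$, $n=n_1+n_2$, input $u\in\mathbb R^m$, $f_1:\mathbb R\times\mathbb R^n\times\mathbb R^m\to\mathbb R^{n_1}$ and $f_2:\mathbb R\times\mathbb R^n\times\mathbb R^m\to\mathbb R^{n_2}$ given functions. The input is arbitrary, subject to the solutions existing on $[0,\infty)$. Disturbance: for each $i$, $\rho_i$ is a positive integer, $a_{i0},a_{ij},\phi_{ij}$ are real, and $\omega_{i1},\dots,\omega_{i\rho_i}$ are distinct positive numbers. For each $i$, $r_i$ is a positive integer and $\beta_{i1},\dots,\beta_{ir_i}$ are real numbers such that $$\frac{d^{r_i}d_i}{dt^{r_i}}=\beta_{i1}d_i+\beta_{i2}\frac{dd_i}{dt}+\cdots+\beta_{ir_i}\frac{d^{r_i-1}d_i}{dt^{r_i-1}}.$$ Let $\bar r=\sum_{i=1}^{n_2}r_i$, $\upsilon_i=\operatorname{col}(d_i,\dot d_i,\dots,d_i^{(r_i-1)})\in\mathbb R^{r_i}$, let $\Phi_i\in\mathbb R^{r_i\times r_i}$ be the companion matrix with ones on the superdiagonal, last row $(\beta_{i1},\dots,\beta_{ir_i})$ and zeros elsewhere, and $\Gamma_i=(1,0,\dots,0)\in\mathbb R^{1\times r_i}$; thus $\dot\upsilon_i=\Phi_i\upsilon_i$, $d_i=\Gamma_i\upsilon_i$. Design matrices: for each $i$, $M_i\in\mathbb R^{r_i\times r_i}$ is Hurwitz, $N_i\in\mathbb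 R^{r_i\times1}$, $(M_i,N_i)$ is controllable, and $\Phi_i$ and $M_i$ have no common eigenvalues. $T_i\in\mathbb R^{r_i\times r_i}$ is the unique (nonsingular) solution of $T_i\Phi_i-M_iT_i=N_i\Gamma_i$. Put $M=\operatorname{blkdiag}(M_1,\dots,M_{n_2})$, and similarly $N,T,\Phi,\Gamma$ block diagonal; $\upsilon=\operatorname{col}(\upsilon_1,\dots,\upsilon_{n_2})$; $\varrho=-T\upsilon$, i.e. $\varrho=\operatorname{col}(\varrho_1,\dots,\varrho_{n_2})$ with $\varrho_i=-T_i\upsilon_i$; $\Psi=\Gamma T^{-1}$, with diagonal blocks $\Psi_i=\Gamma_iT_i^{-1}$. Thus $d=-\Psi\varrho$. Notation: for $v=\operatorname{col}(v_1,\dots,v_{n_2})$ with $v_i\in\mathbb R^{r_i}$, $\mathcal M(v)=\operatorname{blkdiag}(v_1^\top,\dots,v_{n_2}^\top)\in\mathbb R^{n_2\times\bar r}$; $\mathcal C(\Psi)=\operatorname{col}(\Psi_1^\top,\dots,\Psi_{n_2}^\top)\in\mathbb R^{\bar r}$. States: $\eta\in\mathbb R^{\bar r}$, $\hat x_2\in\mathbb R^{n_2}$, $\theta\in\mathbb R^{\bar r}$. A function $W:[t_0,\infty)\to\mathbb R^{w_1\times w_2}$ is persistently exciting (PE) if there are $\alpha,T_0>0$ with $\int_t^{t+T_0}W(\tau)W^\top(\tau)\,d\tau\succeq\alpha I_{w_1}$ for all $t\ge t_0$. A quantity $e(t)$ converges to zero exponentially if $\|e(t)\|\le ce^{-\lambda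 t}$ for some $c,\lambda>0$ and all $t\ge0$. *)

theory Defs
  imports
    "HOL-Analysis.Analysis"
    "Jordan_Normal_Form.Spectral_Radius"
    "Jordan_Normal_Form.DL_Rank"
    "Jordan_Normal_Form.Gauss_Jordan_Elimination"
begin

(* The block sizes r i depend on i, so vectors and matrices are the dimension-carrying
   real vec and real mat of Jordan_Normal_Form; all vector and block indices start at 0. *)

unbundle no vec_syntax
unbundle no inner_syntax

(* The columns of the test matrix are those of B, A B, ..., A^(n-1) B. *)
definition controllable :: "real mat \<Rightarrow> real mat \<Rightarrow> bool" where
  "controllable A B \<longleftrightarrow>
     (let n = dim_row A in
      vec_space.rank n (mat_of_cols n (concat (map (\<lambda>k. cols (A ^\<^sub>m k * B)) [0..<n]))) = n)"

abbreviation complex_mat :: "real mat \<Rightarrow> complex mat" where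
  "complex_mat \<equiv> map_mat complex_of_real"

definition hurwitz :: "real mat \<Rightarrow> bool" where
  "hurwitz A \<longleftrightarrow> (\<forall>z \<in> spectrum (complex_mat A). Re z < 0)"

definition pos_semidef :: "nat \<Rightarrow> real mat \<Rightarrow> bool" where
  "pos_semidef n A \<longleftrightarrow>
     A \<in> carrier_mat n n \<and> A\<^sup>T = A \<and> (\<forall>v \<in> carrier_vec n. 0 \<le> v \<bullet> (A *\<^sub>v v))"

definition sym_pos_def :: "nat \<Rightarrow> real mat \<Rightarrow> bool" where
  "sym_pos_def n A \<longleftrightarrow>
     A \<in> carrier_mat n n \<and> A\<^sup>T = A \<and> (\<forall>v \<in> carrier_vec n. v \<noteq> 0\<^sub>v n \<longrightarrow> 0 < v \<bullet> (A *\<^sub>v v))"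

definition companion :: "nat \<Rightarrow> (nat \<Rightarrow> real) \<Rightarrow> real mat" where
  "companion r b =
     mat r r (\<lambda>(j, k). if Suc j = r then b k else if k = Suc j then 1 else 0)"

definition first_unit_row :: "nat \<Rightarrow> real mat" where
  "first_unit_row r = mat 1 r (\<lambda>(j, k). if k = 0 then 1 else 0)"

definition blkdiag :: "nat \<Rightarrow> (nat \<Rightarrow> real mat) \<Rightarrow> real mat" where
  "blkdiag n A = diag_block_mat (map A [0..<n])"

definition blkcol :: "nat \<Rightarrow> (nat \<Rightarrow> real vec) \<Rightarrow> real vec" where
  "blkcol n v = vec_of_list (concat (map (\<lambda>i. list_of_vec (v i)) [0..<n]))"

(* The component v_i of v = col(v_0, v_1, ...), where v_i has dimension r i. *)
definition block :: "(nat \<Rightarrow> nat) \<Rightarrow> nat \<Rightarrow> real vec \<Rightarrow> real vec" where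
  "block r i v = vec (r i) (\<lambda>k. v $ ((\<Sum>l<i. r l) + k))"

(* The operator written as a calligraphic M. *)
definition regressor :: "nat \<Rightarrow> (nat \<Rightarrow> nat) \<Rightarrow> real vec \<Rightarrow> real mat" where
  "regressor n r v = blkdiag n (\<lambda>i. mat_of_row (block r i v))"

(* The operator written as a calligraphic C; each block is a single row. *)
definition stacked_rows :: "nat \<Rightarrow> (nat \<Rightarrow> real mat) \<Rightarrow> real vec" where
  "stacked_rows n \<Psi> = blkcol n (\<lambda>i. row (\<Psi> i) 0)"

(* x is a classical solution of dx/dt = g(t) on [0, \<infinity>), one-sided at 0; for a differential
   equation, g is its right-hand side evaluated along the solution. *)
definition has_rate :: "nat \<Rightarrow> (real \<Rightarrow> real vec) \<Rightarrow> (real \<Rightarrow> real vec) \<Rightarrow> bool" where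
  "has_rate n x g \<longleftrightarrow>
     (\<forall>t\<ge>0. x t \<in> carrier_vec n \<and>
       (\<forall>i<n. ((\<lambda>s. x s $ i) has_real_derivative g t $ i) (at t within {0..})))"

definition gram_integral :: "nat \<Rightarrow> (real \<Rightarrow> real mat) \<Rightarrow> real \<Rightarrow> real \<Rightarrow> real mat" where
  "gram_integral w W a b =
     mat w w (\<lambda>(j, k). integral {a..b} (\<lambda>\<tau>. (W \<tau> * (W \<tau>)\<^sup>T) $$ (j, k)))"

(* The integrability clause is needed because integral returns 0 on non-integrable functions. *)
definition persistently_exciting ::
    "real \<Rightarrow> nat \<Rightarrow> nat \<Rightarrow> (real \<Rightarrow> real mat) \<Rightarrow> bool" where
  "persistently_exciting t0 w1 w2 W \<longleftrightarrow>
     (\<forall>t\<ge>t0. W t \<in> carrier_mat w1 w2) \<and>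
     (\<exists>\<alpha>>0. \<exists>T0>0. \<forall>t\<ge>t0.
        (\<forall>j<w1. \<forall>k<w1. (\<lambda>\<tau>. (W \<tau> * (W \<tau>)\<^sup>T) $$ (j, k)) integrable_on {t..t + T0}) \<and>
        pos_semidef w1 (gram_integral w1 W t (t + T0) - \<alpha> \<cdot>\<^sub>m 1\<^sub>m w1))"

definition eucl_norm :: "real vec \<Rightarrow> real" where
  "eucl_norm v = sqrt (v \<bullet> v)"

definition vanishes :: "(real \<Rightarrow> real vec) \<Rightarrow> bool" where
  "vanishes e \<longleftrightarrow> ((\<lambda>t. eucl_norm (e t)) \<longlongrightarrow> 0) at_top"

definition vanishes_exponentially :: "(real \<Rightarrow> real vec) \<Rightarrow> bool" where
  "vanishes_exponentially e \<longleftrightarrow>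
     (\<exists>c>0. \<exists>\<kappa>>0. \<forall>t\<ge>0. eucl_norm (e t) \<le> c * exp (- \<kappa> * t))"

end

theory Submission
  imports Defs
begin

text \<open>
  With \<open>e = xhat2 - x2\<close>, \<open>th = \<theta> - C(\<Psi>)\<close> and the observer error \<open>err = vrhohat - rho\<close>, which obeys
  \<open>err' = M err\<close> and hence decays exponentially, the closed loop reads
  \<open>e' = K e - W th - b\<close>, \<open>th' = \<Lambda> W\<^sup>T P e\<close>, where \<open>W\<close> is the regressor of \<open>vrhohat\<close> and \<open>b\<close> decays
  exponentially. Along it \<open>e \<bullet> P e + th \<bullet> \<Lambda>\<inverse> th\<close> has derivative \<open>- |e|\<^sup>2 - 2 P e \<bullet> b\<close>, so the states
  are bounded, and two arguments of Barbalat type give \<open>e \<longlongrightarrow> 0\<close> and \<open>e' \<longlongrightarrow> 0\<close>; the disturbance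
  estimation error is \<open>e' - K e\<close>. Under persistent excitation the Lyapunov function is made strict by
  adding a multiple of \<open>e \<bullet> R th\<close>, with \<open>R\<close> the regressor of \<open>rho\<close>, and subtracting \<open>th \<bullet> Q th\<close>,
  where \<open>Q(t)\<close> is the integral of \<open>(t + T - \<tau>) R(\<tau>)\<^sup>T R(\<tau>)\<close> over the excitation window.
\<close>

section \<open>Bounded and exponentially decaying functions\<close>

text \<open>The observer \<open>vrhohat = \<eta> - Nb x2\<close> is arranged so that
  \<open>f2\<close> cancels from its rate. It is driven by the disturbance alone and is therefore
  bounded, although the plant state and the input may be unbounded. The disturbance is linear in the
  fixed vector \<open>C(\<Psi>)\<close>, with regressor \<open>R\<close>, and
  \<open>b = (W - R) C(\<Psi>)\<close> is the price of using \<open>vrhohat\<close> in place of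
  \<open>rho\<close>. The Lyapunov derivative dissipates \<open>e\<close> but never
  \<open>th\<close>, so without excitation \<open>th\<close> is only shown to be bounded. Excitation
  is assumed of \<open>rho\<close>, not of \<open>vrhohat\<close>; hence the strict function is
  built from \<open>R\<close>, and \<open>W - R\<close>, which decays, joins the perturbation. Since
  \<open>R\<close> is block diagonal, \<open>|R v|^2\<close> is a sum over blocks, so exciting each
  block separately suffices; the stacked vector itself may fail to be exciting.\<close>

definition bdd_fn :: "(real \<Rightarrow> 'a::real_normed_vector) \<Rightarrow> bool" where
  "bdd_fn f \<longleftrightarrow> (\<exists>C. \<forall>t\<ge>0. norm (f t) \<le> C)"

definition exp_decay :: "(real \<Rightarrow> 'a::real_normed_vector) \<Rightarrow> bool" where
  "exp_decay f \<longleftrightarrow> (\<exists>C \<kappa>. \<kappa> > 0 \<and> (\<forall>t\<ge>0. norm (f t) \<le> C * exp (- \<kappa> * t)))"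

lemma bdd_fnI: "(\<And>t. t \<ge> 0 \<Longrightarrow> norm (f t) \<le> C) \<Longrightarrow> bdd_fn f"
  unfolding bdd_fn_def by blast

lemma bdd_fnE:
  assumes "bdd_fn f"
  obtains C where "C > 0" "\<And>t. t \<ge> 0 \<Longrightarrow> norm (f t) \<le> C"
proof -
  obtain C where C: "\<forall>t\<ge>0. norm (f t) \<le> C" using assms unfolding bdd_fn_def by blast
  show ?thesis by (rule that[of "max C 1"]) (use C in \<open>auto simp: le_max_iff_disj\<close>)
qed

lemma exp_decayI:
  "\<kappa> > 0 \<Longrightarrow> (\<And>t. t \<ge> 0 \<Longrightarrow> norm (f t) \<le> C * exp (- \<kappa> * t)) \<Longrightarrow> exp_decay f"
  unfolding exp_decay_def by blast

lemma exp_decayE: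
  assumes "exp_decay f"
  obtains C \<kappa> where "C > 0" "\<kappa> > 0" "\<And>t. t \<ge> 0 \<Longrightarrow> norm (f t) \<le> C * exp (- \<kappa> * t)"
proof -
  obtain C \<kappa> where C: "\<kappa> > 0" "\<forall>t\<ge>0. norm (f t) \<le> C * exp (- \<kappa> * t)"
    using assms unfolding exp_decay_def by blast
  have "norm (f t) \<le> max C 1 * exp (- \<kappa> * t)" if "t \<ge> 0" for t
  proof -
    have "C * exp (- \<kappa> * t) \<le> max C 1 * exp (- \<kappa> * t)" by (intro mult_right_mono) auto
    then show ?thesis using C(2) that by (meson order_trans)
  qed
  then show ?thesis using that[of "max C 1" \<kappa>] C(1) by auto
qed

text \<open>Vectors are known to have the right dimension only at nonnegative times, so index
  identities hold only there; this lemma and the next carry bounds across such identities.\<close>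

lemma bdd_fn_cong: "(\<And>t. t \<ge> 0 \<Longrightarrow> f t = g t) \<Longrightarrow> bdd_fn f \<longleftrightarrow> bdd_fn g"
  unfolding bdd_fn_def by auto

lemma exp_decay_cong: "(\<And>t. t \<ge> 0 \<Longrightarrow> f t = g t) \<Longrightarrow> exp_decay f \<longleftrightarrow> exp_decay g"
  unfolding exp_decay_def by auto

lemma exp_decay_mono:
  assumes "exp_decay g" "\<And>t. t \<ge> 0 \<Longrightarrow> norm (f t) \<le> norm (g t)"
  shows "exp_decay f"
proof -
  obtain C \<kappa> where C: "C > 0" "\<kappa> > 0" "\<And>t. t \<ge> 0 \<Longrightarrow> norm (g t) \<le> C * exp (- \<kappa> * t)"
    by (fact exp_decayE[OF assms(1)])
  show ?thesis by (rule exp_decayI[OF C(2) order_trans[OF assms(2) C(3)]])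
qed

lemma bdd_fn_mono:
  assumes "bdd_fn g" "\<And>t. t \<ge> 0 \<Longrightarrow> norm (f t) \<le> norm (g t)"
  shows "bdd_fn f"
proof -
  obtain C where C: "C > 0" "\<And>t. t \<ge> 0 \<Longrightarrow> norm (g t) \<le> C" by (fact bdd_fnE[OF assms(1)])
  show ?thesis by (rule bdd_fnI[OF order_trans[OF assms(2) C(2)]])
qed

lemma exp_decay_imp_bdd_fn:
  assumes "exp_decay f" shows "bdd_fn f"
proof -
  obtain C \<kappa> where C: "C > 0" "\<kappa> > 0" "\<And>t. t \<ge> 0 \<Longrightarrow> norm (f t) \<le> C * exp (- \<kappa> * t)"
    by (fact exp_decayE[OF assms])
  show ?thesis
  proof (rule bdd_fnI)
    fix t :: real assume t: "t \<ge> 0"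
    have "C * exp (- \<kappa> * t) \<le> C * 1" using C t by (intro mult_left_mono) auto
    then show "norm (f t) \<le> C" using C(3)[OF t] by simp
  qed
qed

lemma bdd_fn_const: "bdd_fn (\<lambda>t. c)"
  by (rule bdd_fnI[of _ "norm c"]) simp

lemma bdd_fn_add:
  assumes "bdd_fn f" "bdd_fn g" shows "bdd_fn (\<lambda>t. f t + g t)"
proof -
  obtain C where C: "C > 0" "\<And>t. t \<ge> 0 \<Longrightarrow> norm (f t) \<le> C" by (fact bdd_fnE[OF assms(1)])
  obtain D where D: "D > 0" "\<And>t. t \<ge> 0 \<Longrightarrow> norm (g t) \<le> D" by (fact bdd_fnE[OF assms(2)])
  show ?thesis
  proof (rule bdd_fnI)
    fix t :: real assume "t \<ge> 0"
    then show "norm (f t + g t) \<le> C + D" by (intro norm_triangle_mono C(2) D(2))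
  qed
qed

lemma bdd_fn_mult:
  fixes f g :: "real \<Rightarrow> 'a::real_normed_algebra"
  assumes "bdd_fn f" "bdd_fn g" shows "bdd_fn (\<lambda>t. f t * g t)"
proof -
  obtain C where C: "C > 0" "\<And>t. t \<ge> 0 \<Longrightarrow> norm (f t) \<le> C" by (fact bdd_fnE[OF assms(1)])
  obtain D where D: "D > 0" "\<And>t. t \<ge> 0 \<Longrightarrow> norm (g t) \<le> D" by (fact bdd_fnE[OF assms(2)])
  show ?thesis
  proof (rule bdd_fnI)
    fix t :: real assume t: "t \<ge> 0"
    show "norm (f t * g t) \<le> C * D"
      using norm_mult_ineq[of "f t" "g t"] mult_mono[OF C(2)[OF t] D(2)[OF t]] C(1) by simp
  qed
qed

lemma bdd_fn_sum:
  "finite A \<Longrightarrow> (\<And>i. i \<in> A \<Longrightarrow> bdd_fn (\<lambda>t. f t i)) \<Longrightarrow> bdd_fn (\<lambda>t. \<Sum>i\<in>A. f t i)"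
  by (induction A rule: finite_induct) (auto intro!: bdd_fn_const bdd_fn_add)

lemma exp_decay_zero: "exp_decay (\<lambda>t. 0)"
  by (rule exp_decayI[of 1 _ 0]) auto

lemma exp_decay_add:
  assumes "exp_decay f" "exp_decay g" shows "exp_decay (\<lambda>t. f t + g t)"
proof -
  obtain C \<kappa> where C: "C > 0" "\<kappa> > 0" "\<And>t. t \<ge> 0 \<Longrightarrow> norm (f t) \<le> C * exp (- \<kappa> * t)"
    by (fact exp_decayE[OF assms(1)])
  obtain D \<mu> where D: "D > 0" "\<mu> > 0" "\<And>t. t \<ge> 0 \<Longrightarrow> norm (g t) \<le> D * exp (- \<mu> * t)"
    by (fact exp_decayE[OF assms(2)])
  show ?thesis
  proof (rule exp_decayI[of "min \<kappa> \<mu>" _ "C + D"])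
    fix t :: real assume t: "t \<ge> 0"
    have "norm (f t) \<le> C * exp (- min \<kappa> \<mu> * t)" "norm (g t) \<le> D * exp (- min \<kappa> \<mu> * t)"
      using C D t by (auto intro!: order_trans[OF C(3)[OF t]] order_trans[OF D(3)[OF t]]
          mult_left_mono mult_right_mono)
    then show "norm (f t + g t) \<le> (C + D) * exp (- min \<kappa> \<mu> * t)"
      unfolding distrib_right by (rule norm_triangle_mono)
  qed (use C D in auto)
qed

lemma exp_decay_minus: "exp_decay f \<Longrightarrow> exp_decay (\<lambda>t. - f t)"
  unfolding exp_decay_def by simp

lemma exp_decay_diff: "exp_decay f \<Longrightarrow> exp_decay g \<Longrightarrow> exp_decay (\<lambda>t. f t - g t)"
  using exp_decay_add[of f "\<lambda>t. - g t"] exp_decay_minus[of g] by simp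

lemma exp_decay_mult_right:
  fixes f g :: "real \<Rightarrow> 'a::real_normed_algebra"
  assumes "bdd_fn f" "exp_decay g" shows "exp_decay (\<lambda>t. f t * g t)"
proof -
  obtain C where C: "C > 0" "\<And>t. t \<ge> 0 \<Longrightarrow> norm (f t) \<le> C" by (fact bdd_fnE[OF assms(1)])
  obtain D \<mu> where D: "D > 0" "\<mu> > 0" "\<And>t. t \<ge> 0 \<Longrightarrow> norm (g t) \<le> D * exp (- \<mu> * t)"
    by (fact exp_decayE[OF assms(2)])
  show ?thesis
  proof (rule exp_decayI[OF D(2)])
    fix t :: real assume t: "t \<ge> 0"
    show "norm (f t * g t) \<le> (C * D) * exp (- \<mu> * t)"
      using norm_mult_ineq[of "f t" "g t"] mult_mono[OF C(2)[OF t] D(3)[OF t]] C(1)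
      by (simp add: mult.assoc)
  qed
qed

lemma exp_decay_mult_left:
  fixes f g :: "real \<Rightarrow> 'a::{real_normed_algebra, comm_ring}"
  shows "exp_decay f \<Longrightarrow> bdd_fn g \<Longrightarrow> exp_decay (\<lambda>t. f t * g t)"
  using exp_decay_mult_right[of g f] by (simp add: mult.commute)

lemma exp_decay_sum:
  "finite A \<Longrightarrow> (\<And>i. i \<in> A \<Longrightarrow> exp_decay (\<lambda>t. f t i)) \<Longrightarrow> exp_decay (\<lambda>t. \<Sum>i\<in>A. f t i)"
  by (induction A rule: finite_induct) (auto intro!: exp_decay_zero exp_decay_add)

text \<open>Lyapunov estimates bound squared norms; taking the root keeps an exponential bound, at
  half the rate.\<close>

lemma exp_decay_norm_power2:
  assumes "exp_decay (\<lambda>t. (norm (f t))\<^sup>2)" shows "exp_decay f"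
proof -
  obtain C \<kappa> where C: "C > 0" "\<kappa> > 0" "\<And>t. t \<ge> 0 \<Longrightarrow> (norm (f t))\<^sup>2 \<le> C * exp (- \<kappa> * t)"
    using exp_decayE[OF assms] by auto
  show ?thesis
  proof (rule exp_decayI[of "\<kappa> / 2" _ "sqrt C"])
    fix t :: real assume t: "t \<ge> 0"
    have "norm (f t) \<le> sqrt (C * exp (- \<kappa> * t))" using C(3)[OF t] real_le_rsqrt by blast
    also have "\<dots> = sqrt C * exp (- (\<kappa> / 2) * t)"
      by (simp add: real_sqrt_mult exp_half_le2 real_sqrt_unique exp_double[symmetric])
    finally show "norm (f t) \<le> sqrt C * exp (- (\<kappa> / 2) * t)" .
  qed (use C in auto)
qed

lemma exp_decay_power2_norm:
  assumes "exp_decay f" shows "exp_decay (\<lambda>t. (norm (f t))\<^sup>2)"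
proof -
  have "exp_decay (\<lambda>t. norm (f t))" using assms unfolding exp_decay_def by simp
  then show ?thesis unfolding power2_eq_square
    using exp_decay_mult_right exp_decay_imp_bdd_fn by blast
qed

section \<open>Mean value, comparison and Barbalat estimates on the half line\<close>

lemma halfline_mvt:
  fixes f :: "real \<Rightarrow> real"
  assumes "\<And>t. t \<ge> 0 \<Longrightarrow> (f has_real_derivative f' t) (at t within {0..})"
    and "0 \<le> s" "s < t"
  obtains \<xi> where "s < \<xi>" "\<xi> < t" "f t - f s = (t - s) * f' \<xi>"
proof -
  have "\<exists>\<xi>\<in>{s<..<t}. f t - f s = (\<lambda>h. f' \<xi> * h) (t - s)"
  proof (rule mvt_simple[OF assms(3)])
    fix z assume "s \<le> z" "z \<le> t"
    then have "(f has_real_derivative f' z) (at z within {s..t})"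
      using assms by (intro DERIV_subset[OF assms(1)]) auto
    then show "(f has_derivative (\<lambda>h. f' z * h)) (at z within {s..t})"
      by (simp add: has_field_derivative_def)
  qed
  then show ?thesis using that by (auto simp: mult.commute)
qed

lemma halfline_decreasing:
  fixes f :: "real \<Rightarrow> real"
  assumes "\<And>t. t \<ge> 0 \<Longrightarrow> (f has_real_derivative f' t) (at t within {0..})"
    and "\<And>t. t \<ge> 0 \<Longrightarrow> f' t \<le> 0" and "0 \<le> s" "s \<le> t"
  shows "f t \<le> f s"
proof (cases "s = t")
  case False
  then have "s < t" using assms by simp
  obtain \<xi> where "s < \<xi>" "\<xi> < t" "f t - f s = (t - s) * f' \<xi>"
    by (rule halfline_mvt[of f f' s t]) (use assms \<open>s < t\<close> in auto)
  then show ?thesis using assms mult_nonneg_nonpos[of "t - s" "f' \<xi>"] by simp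
qed simp

lemma halfline_lipschitz:
  fixes f :: "real \<Rightarrow> real"
  assumes "\<And>t. t \<ge> 0 \<Longrightarrow> (f has_real_derivative f' t) (at t within {0..})"
    and "\<And>t. t \<ge> 0 \<Longrightarrow> \<bar>f' t\<bar> \<le> L" and "0 \<le> s" "0 \<le> t"
  shows "\<bar>f t - f s\<bar> \<le> L * \<bar>t - s\<bar>"
proof -
  have *: "\<bar>f t - f s\<bar> \<le> L * \<bar>t - s\<bar>" if st: "0 \<le> s" "s < t" for s t
  proof -
    obtain \<xi> where "s < \<xi>" "\<xi> < t" "f t - f s = (t - s) * f' \<xi>"
      by (rule halfline_mvt[of f f' s t]) (use assms st in auto)
    then show ?thesis using assms(2)[of \<xi>] st
      by (simp add: abs_mult mult.commute mult_right_mono)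
  qed
  show ?thesis
  proof (cases s t rule: linorder_cases)
    case greater
    then show ?thesis using *[of t s] assms(4) by (simp only: abs_minus_commute)
  qed (use *[of s t] assms(3) in auto)
qed

text \<open>Comparison with the supersolution \<open>B * exp (- k * t)\<close>: its derivative plus
  \<open>a\<close> times itself is \<open>(a - k) * B * exp (- k * t)\<close>, which dominates the
  input. The integrating factor \<open>exp (a * t)\<close> then makes the difference
  nonincreasing.\<close>

lemma exp_decay_of_diff_ineq:
  fixes v :: "real \<Rightarrow> real"
  assumes der: "\<And>t. t \<ge> 0 \<Longrightarrow> (v has_real_derivative v' t) (at t within {0..})"
    and nonneg: "\<And>t. t \<ge> 0 \<Longrightarrow> 0 \<le> v t"
    and a: "a > 0" and ineq: "\<And>t. t \<ge> 0 \<Longrightarrow> v' t \<le> - a * v t + g t" and g: "exp_decay g"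
  shows "exp_decay v"
proof -
  obtain c \<mu> where c: "c > 0" "\<mu> > 0" "\<And>t. t \<ge> 0 \<Longrightarrow> norm (g t) \<le> c * exp (- \<mu> * t)"
    by (fact exp_decayE[OF g])
  \<comment> \<open>At most \<open>\<mu>\<close>, so the bound on \<open>g\<close> still holds with
    rate \<open>k\<close>; strictly below \<open>a\<close>, so that \<open>a - k\<close> can be
    divided by. At equal rates a factor \<open>t\<close> would appear.\<close>
  define k where "k = min a \<mu> / 2"
  have k: "0 < k" "k < a" "k \<le> \<mu>" using a c by (auto simp: k_def)
  define B where "B = c / (a - k)"
  have B: "B > 0" "(a - k) * B = c" using k c by (auto simp: B_def)
  define z where "z = (\<lambda>t. (v t - B * exp (- k * t)) * exp (a * t))"
  define z' where "z' = (\<lambda>t. (v' t + B * k * exp (- k * t)) * exp (a * t)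
      + (v t - B * exp (- k * t)) * (a * exp (a * t)))"
  have z: "z t \<le> z 0" if "t \<ge> 0" for t
  proof (rule halfline_decreasing[where f = z and f' = z'])
    fix t :: real assume t: "t \<ge> 0"
    show "(z has_real_derivative z' t) (at t within {0..})"
      unfolding z_def z'_def by (auto intro!: derivative_eq_intros der[OF t])
    have "z' t = exp (a * t) * (v' t + a * v t - (a - k) * B * exp (- k * t))"
      unfolding z'_def by (simp add: algebra_simps)
    also have "(a - k) * B = c" by (rule B)
    finally have z': "z' t = exp (a * t) * (v' t + a * v t - c * exp (- k * t))" .
    have "c * exp (- \<mu> * t) \<le> c * exp (- k * t)"
      using c k t by (intro mult_left_mono) (auto intro: mult_right_mono)
    then have "v' t + a * v t - c * exp (- k * t) \<le> 0"
      using ineq[OF t] c(3)[OF t] by (simp add: abs_le_iff)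
    then show "z' t \<le> 0" unfolding z' by (intro mult_nonneg_nonpos) auto
  qed (use that in auto)
  show ?thesis
  proof (rule exp_decayI[OF k(1), of _ "B + v 0"])
    fix t :: real assume t: "t \<ge> 0"
    have "z 0 \<le> v 0" using B by (simp add: z_def)
    then have "(v t - B * exp (- k * t)) * exp (a * t) \<le> v 0" using z[OF t] by (simp add: z_def)
    then have "v t - B * exp (- k * t) \<le> v 0 * exp (- a * t)"
      by (simp add: exp_minus field_simps)
    also have "\<dots> \<le> v 0 * exp (- k * t)"
      using nonneg[of 0] k t by (intro mult_left_mono) (auto intro: mult_right_mono)
    finally show "norm (v t) \<le> (B + v 0) * exp (- k * t)"
      using nonneg[OF t] by (simp add: algebra_simps)
  qed
qed

text \<open>No integral of \<open>g\<close> is formed. If \<open>g\<close> reaches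
  \<open>\<epsilon>\<close> late, the bound \<open>L\<close> on its slope keeps it above
  \<open>\<epsilon> / 2\<close> for a time \<open>h = \<epsilon> / (2 * L)\<close>, during which
  \<open>v\<close> loses at least \<open>h * (\<epsilon> / 2)\<close> and falls below its
  infimum.\<close>

lemma barbalat_lyapunov:
  fixes v g :: "real \<Rightarrow> real"
  assumes v: "\<And>t. t \<ge> 0 \<Longrightarrow> (v has_real_derivative v' t) (at t within {0..})"
    and v0: "\<And>t. t \<ge> 0 \<Longrightarrow> 0 \<le> v t" and g0: "\<And>t. t \<ge> 0 \<Longrightarrow> 0 \<le> g t"
    and vg: "\<And>t. t \<ge> 0 \<Longrightarrow> v' t \<le> - g t"
    and g: "\<And>t. t \<ge> 0 \<Longrightarrow> (g has_real_derivative g' t) (at t within {0..})"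
    and L: "bdd_fn g'"
  shows "(g \<longlongrightarrow> 0) at_top"
proof -
  obtain L where L: "L > 0" "\<And>t. t \<ge> 0 \<Longrightarrow> \<bar>g' t\<bar> \<le> L" by (fact bdd_fnE[OF L, unfolded real_norm_def])
  have dec: "v t \<le> v s" if "0 \<le> s" "s \<le> t" for s t
    using halfline_decreasing[OF v _ that] vg g0 by (meson neg_le_0_iff_le order_trans)
  define l where "l = Inf (v ` {0..})"
  have bb: "bdd_below (v ` {0..})" using v0 by (intro bdd_belowI[of _ 0]) auto
  have lv: "l \<le> v t" if "t \<ge> 0" for t unfolding l_def using that bb by (intro cInf_lower) auto
  show ?thesis
  proof (rule tendstoI)
    fix \<epsilon> :: real assume \<epsilon>: "\<epsilon> > 0"
    define h where "h = \<epsilon> / (2 * L)"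
    have h: "h > 0" using \<epsilon> L by (simp add: h_def)
    \<comment> \<open>From a suitable time \<open>s\<close> on, \<open>v\<close> has less left to
      lose than one such window costs.\<close>
    have "\<exists>y\<in>v ` {0..}. y < l + h * (\<epsilon> / 2)"
      using cInf_lessD[of "v ` {0..}" "l + h * (\<epsilon> / 2)"] h \<epsilon> unfolding l_def by force
    then obtain s where s: "s \<ge> 0" "v s < l + h * (\<epsilon> / 2)" by auto
    have "dist (g t) 0 < \<epsilon>" if t: "t \<ge> s" for t
    proof (rule ccontr)
      assume "\<not> dist (g t) 0 < \<epsilon>"
      then have gt: "g t \<ge> \<epsilon>" using g0[of t] t s by simp
      obtain \<xi> where \<xi>: "t < \<xi>" "\<xi> < t + h" "v (t + h) - v t = h * v' \<xi>"
        using halfline_mvt[OF v, of t "t + h"] h s t by auto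
      have "\<bar>g \<xi> - g t\<bar> \<le> L * \<bar>\<xi> - t\<bar>"
        by (rule halfline_lipschitz[OF g L(2)]) (use s t \<xi> in auto)
      also have "\<dots> \<le> L * h" using \<xi> L by simp
      also have "\<dots> = \<epsilon> / 2" using L by (simp add: h_def)
      finally have "g \<xi> \<ge> \<epsilon> / 2" using gt by linarith
      then have "v' \<xi> \<le> - (\<epsilon> / 2)" using vg[of \<xi>] \<xi> s t by simp
      then have "h * v' \<xi> \<le> h * (- (\<epsilon> / 2))" using h by (intro mult_left_mono) auto
      then have "v (t + h) \<le> v t - h * (\<epsilon> / 2)" using \<xi> by simp
      moreover have "v t \<le> v s" using dec s t by simp
      moreover have "l \<le> v (t + h)" using lv s t h by simp
      ultimately show False using s by simp
    qed
    then show "\<forall>\<^sub>F t in at_top. dist (g t) 0 < \<epsilon>"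
      unfolding eventually_at_top_linorder by blast
  qed
qed

text \<open>Over a step \<open>h\<close> the difference quotient of \<open>f\<close> is a value of
  \<open>f'\<close>, and it is small because \<open>f\<close> is: two values below
  \<open>h * \<epsilon> / 8\<close> give less than \<open>\<epsilon> / 4\<close>. Within the step
  \<open>f'\<close> varies by at most \<open>L * h = \<epsilon> / 2\<close>.\<close>

lemma barbalat_derivative:
  fixes f f' :: "real \<Rightarrow> real"
  assumes f: "\<And>t. t \<ge> 0 \<Longrightarrow> (f has_real_derivative f' t) (at t within {0..})"
    and f': "\<And>t. t \<ge> 0 \<Longrightarrow> (f' has_real_derivative f'' t) (at t within {0..})"
    and L: "bdd_fn f''" and lim: "(f \<longlongrightarrow> 0) at_top"
  shows "(f' \<longlongrightarrow> 0) at_top"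
proof (rule tendstoI)
  obtain L where L: "L > 0" "\<And>t. t \<ge> 0 \<Longrightarrow> \<bar>f'' t\<bar> \<le> L" by (fact bdd_fnE[OF L, unfolded real_norm_def])
  fix \<epsilon> :: real assume \<epsilon>: "\<epsilon> > 0"
  define h where "h = \<epsilon> / (2 * L)"
  have h: "h > 0" using \<epsilon> L by (simp add: h_def)
  have "\<forall>\<^sub>F t in at_top. dist (f t) 0 < h * \<epsilon> / 8"
    using tendstoD[OF lim, of "h * \<epsilon> / 8"] h \<epsilon> by simp
  then obtain s where s: "\<And>t. t \<ge> s \<Longrightarrow> \<bar>f t\<bar> < h * \<epsilon> / 8"
    unfolding eventually_at_top_linorder by auto
  have "dist (f' t) 0 < \<epsilon>" if t: "t \<ge> max s 0" for t
  proof -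
    obtain \<xi> where \<xi>: "t < \<xi>" "\<xi> < t + h" "f (t + h) - f t = h * f' \<xi>"
      using halfline_mvt[OF f, of t "t + h"] h t by auto
    have "\<bar>f' \<xi> - f' t\<bar> \<le> L * \<bar>\<xi> - t\<bar>"
      by (rule halfline_lipschitz[OF f' L(2)]) (use t \<xi> in auto)
    also have "\<dots> \<le> L * h" using \<xi> L by simp
    also have "\<dots> = \<epsilon> / 2" using L by (simp add: h_def)
    finally have 1: "\<bar>f' \<xi> - f' t\<bar> \<le> \<epsilon> / 2" .
    have "h * \<bar>f' \<xi>\<bar> = \<bar>f (t + h) - f t\<bar>" using \<xi> h by (simp add: abs_mult)
    also have "\<dots> < h * (\<epsilon> / 4)" using s[of t] s[of "t + h"] t h abs_triangle_ineq4[of "f (t + h)" "f t"] by simp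
    finally have "\<bar>f' \<xi>\<bar> < \<epsilon> / 4" using h by simp
    then show ?thesis using 1 \<epsilon> unfolding dist_real_def by linarith
  qed
  then show "\<forall>\<^sub>F t in at_top. dist (f' t) 0 < \<epsilon>"
    unfolding eventually_at_top_linorder by blast
qed

section \<open>Vector and matrix functions\<close>

lemma has_rate_carrier: "has_rate n x g \<Longrightarrow> t \<ge> 0 \<Longrightarrow> x t \<in> carrier_vec n"
  unfolding has_rate_def by blast

lemma has_rate_index:
  "has_rate n x g \<Longrightarrow> t \<ge> 0 \<Longrightarrow> i < n \<Longrightarrow>
    ((\<lambda>s. x s $ i) has_real_derivative g t $ i) (at t within {0..})"
  unfolding has_rate_def by blast

lemma has_rateI:
  assumes "\<And>t. t \<ge> 0 \<Longrightarrow> x t \<in> carrier_vec n"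
    and "\<And>t i. t \<ge> 0 \<Longrightarrow> i < n \<Longrightarrow>
      ((\<lambda>s. x s $ i) has_real_derivative g t $ i) (at t within {0..})"
  shows "has_rate n x g"
  using assms unfolding has_rate_def by blast

lemma has_rate_cong:
  assumes "has_rate n x g" "\<And>t. t \<ge> 0 \<Longrightarrow> g t = g' t"
  shows "has_rate n x g'"
  using assms unfolding has_rate_def by simp

text \<open>Rewriting an entry of a sum or product needs the dimensions, hence nonnegative time; a
  derivative within \<open>{0..}\<close> depends on nothing else.\<close>

lemma halfline_derivative_transform:
  fixes f g :: "real \<Rightarrow> real"
  assumes "(f has_real_derivative D) (at t within {0..})" "t \<ge> 0" "\<And>s. s \<ge> 0 \<Longrightarrow> f s = g s"
  shows "(g has_real_derivative D) (at t within {0..})"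
  using assms by (intro has_field_derivative_transform_within[OF assms(1), of 1]) auto

text \<open>Differences and inner products of vectors take their dimension from the second operand,
  and \<open>has_rate\<close> does not constrain the dimension of the rate; this is why a carrier is
  asked of the second rate here and in the product rule below.\<close>

lemma has_rate_diff:
  assumes "has_rate n x x'" "has_rate n y y'" "\<And>t. t \<ge> 0 \<Longrightarrow> y' t \<in> carrier_vec n"
  shows "has_rate n (\<lambda>t. x t - y t) (\<lambda>t. x' t - y' t)"
proof (rule has_rateI)
  fix t :: real and i assume t: "t \<ge> 0" and i: "i < n"
  have "((\<lambda>s. x s $ i - y s $ i) has_real_derivative x' t $ i - y' t $ i) (at t within {0..})"
    by (intro derivative_intros has_rate_index[OF assms(1) t i] has_rate_index[OF assms(2) t i])
  moreover have "dim_vec (y s) = n" if "s \<ge> 0" for s using has_rate_carrier[OF assms(2) that] by auto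
  ultimately show "((\<lambda>s. (x s - y s) $ i) has_real_derivative (x' t - y' t) $ i) (at t within {0..})"
    using assms(3)[OF t] i t by (auto intro: halfline_derivative_transform)
qed (use assms has_rate_carrier in auto)

lemma scalar_prod_has_derivative:
  assumes x: "has_rate n x x'" and y: "has_rate n y y'" and y': "y' t \<in> carrier_vec n" and t: "t \<ge> 0"
  shows "((\<lambda>s. x s \<bullet> y s) has_real_derivative (x' t \<bullet> y t + x t \<bullet> y' t)) (at t within {0..})"
proof -
  have "((\<lambda>s. \<Sum>i=0..<n. x s $ i * y s $ i) has_real_derivative
      (\<Sum>i=0..<n. x' t $ i * y t $ i + y' t $ i * x t $ i)) (at t within {0..})"
    by (intro DERIV_sum DERIV_mult has_rate_index[OF x t] has_rate_index[OF y t]) auto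
  also have "(\<Sum>i=0..<n. x' t $ i * y t $ i + y' t $ i * x t $ i) = x' t \<bullet> y t + x t \<bullet> y' t"
    using has_rate_carrier[OF y t] y' by (simp add: scalar_prod_def sum.distrib mult.commute)
  finally show ?thesis
  proof (rule halfline_derivative_transform[OF _ t])
    show "(\<Sum>i=0..<n. x s $ i * y s $ i) = x s \<bullet> y s" if "s \<ge> 0" for s
      using has_rate_carrier[OF y that] by (simp add: scalar_prod_def)
  qed
qed

text \<open>In contrast to \<open>has_rate\<close>, the rate carries its dimensions, because the
  product rule applies \<open>W'\<close> to vectors.\<close>

definition has_mat_rate ::
    "nat \<Rightarrow> nat \<Rightarrow> (real \<Rightarrow> real mat) \<Rightarrow> (real \<Rightarrow> real mat) \<Rightarrow> bool" where
  "has_mat_rate nr nc W W' \<longleftrightarrow>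
     (\<forall>t\<ge>0. W t \<in> carrier_mat nr nc \<and> W' t \<in> carrier_mat nr nc \<and>
       (\<forall>i<nr. \<forall>j<nc.
         ((\<lambda>s. W s $$ (i, j)) has_real_derivative W' t $$ (i, j)) (at t within {0..})))"

lemma has_rate_mult_mat_vec:
  assumes W: "has_mat_rate nr nc W W'" and x: "has_rate nc x x'"
    and x': "\<And>t. t \<ge> 0 \<Longrightarrow> x' t \<in> carrier_vec nc"
  shows "has_rate nr (\<lambda>t. W t *\<^sub>v x t) (\<lambda>t. W' t *\<^sub>v x t + W t *\<^sub>v x' t)"
proof (rule has_rateI)
  fix t :: real and i assume t: "t \<ge> 0" and i: "i < nr"
  have car: "W s \<in> carrier_mat nr nc" "W' s \<in> carrier_mat nr nc" if "s \<ge> 0" for s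
    using W that unfolding has_mat_rate_def by auto
  have row: "has_rate nc (\<lambda>t. row (W t) i) (\<lambda>t. row (W' t) i)"
  proof (rule has_rateI)
    fix t :: real and j assume t: "t \<ge> 0" and j: "j < nc"
    have "((\<lambda>s. W s $$ (i, j)) has_real_derivative W' t $$ (i, j)) (at t within {0..})"
      using W t i j unfolding has_mat_rate_def by blast
    also have "W' t $$ (i, j) = row (W' t) i $ j" using car[OF t] i j by simp
    finally show "((\<lambda>s. row (W s) i $ j) has_real_derivative row (W' t) i $ j) (at t within {0..})"
    proof (rule halfline_derivative_transform[OF _ t])
      show "W s $$ (i, j) = row (W s) i $ j" if "s \<ge> 0" for s using car(1)[OF that] i j by simp
    qed
  qed (use car i in auto)
  have eq: "(W' t *\<^sub>v x t + W t *\<^sub>v x' t) $ i = row (W' t) i \<bullet> x t + row (W t) i \<bullet> x' t"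
    using car[OF t] i by simp
  have "((\<lambda>s. row (W s) i \<bullet> x s) has_real_derivative (W' t *\<^sub>v x t + W t *\<^sub>v x' t) $ i)
      (at t within {0..})"
    unfolding eq by (rule scalar_prod_has_derivative[OF row x x'[OF t] t])
  then show "((\<lambda>s. (W s *\<^sub>v x s) $ i) has_real_derivative (W' t *\<^sub>v x t + W t *\<^sub>v x' t) $ i)
      (at t within {0..})"
  proof (rule halfline_derivative_transform[OF _ t])
    show "row (W s) i \<bullet> x s = (W s *\<^sub>v x s) $ i" if "s \<ge> 0" for s using car(1)[OF that] i by simp
  qed
next
  fix t :: real assume t: "t \<ge> 0"
  then show "W t *\<^sub>v x t \<in> carrier_vec nr"
    using W has_rate_carrier[OF x t] unfolding has_mat_rate_def by (auto intro: mult_mat_vec_carrier)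
qed

lemma has_rate_const_mult_mat_vec:
  assumes A: "A \<in> carrier_mat nr nc" and x: "has_rate nc x x'"
    and x': "\<And>t. t \<ge> 0 \<Longrightarrow> x' t \<in> carrier_vec nc"
  shows "has_rate nr (\<lambda>t. A *\<^sub>v x t) (\<lambda>t. A *\<^sub>v x' t)"
proof (rule has_rate_cong[OF has_rate_mult_mat_vec[OF _ x x']])
  show "has_mat_rate nr nc (\<lambda>t. A) (\<lambda>t. 0\<^sub>m nr nc)"
    using A unfolding has_mat_rate_def by auto
  fix t :: real assume "t \<ge> 0"
  then show "0\<^sub>m nr nc *\<^sub>v x t + A *\<^sub>v x' t = A *\<^sub>v x' t"
    using A x'[of t] has_rate_carrier[OF x, of t] by (intro eq_vecI) auto
qed

section \<open>Euclidean norm and componentwise convergence\<close>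

lemma eucl_norm_L2_set: "eucl_norm v = L2_set (\<lambda>i. v $ i) {0..<dim_vec v}"
  unfolding eucl_norm_def L2_set_def scalar_prod_def by (simp add: power2_eq_square)

lemma eucl_norm_nonneg [simp]: "0 \<le> eucl_norm v"
  unfolding eucl_norm_L2_set by simp

lemma scalar_prod_self: "v \<bullet> v = (eucl_norm v)\<^sup>2"
  unfolding eucl_norm_def by (simp add: scalar_prod_def sum_nonneg)

lemma abs_scalar_prod_le:
  assumes "v \<in> carrier_vec n" "w \<in> carrier_vec n"
  shows "\<bar>v \<bullet> w\<bar> \<le> eucl_norm v * eucl_norm w"
proof -
  have "\<bar>v \<bullet> w\<bar> \<le> (\<Sum>i=0..<n. \<bar>v $ i\<bar> * \<bar>w $ i\<bar>)"
    using assms sum_abs[of "\<lambda>i. v $ i * w $ i" "{0..<n}"] by (auto simp: scalar_prod_def abs_mult)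
  then show ?thesis
    using L2_set_mult_ineq[of "\<lambda>i. v $ i" "\<lambda>i. w $ i" "{0..<n}"] assms
    by (auto simp: eucl_norm_L2_set)
qed

lemma abs_index_le_eucl_norm: "i < dim_vec v \<Longrightarrow> \<bar>v $ i\<bar> \<le> eucl_norm v"
  using member_le_L2_set[of "{0..<dim_vec v}" i "\<lambda>i. \<bar>v $ i\<bar>"]
  by (simp add: eucl_norm_L2_set L2_set_def)

lemma eucl_norm_le_sum: "eucl_norm v \<le> (\<Sum>i=0..<dim_vec v. \<bar>v $ i\<bar>)"
  unfolding eucl_norm_L2_set by (rule L2_set_le_sum_abs)

lemma eucl_norm_triangle:
  assumes "v \<in> carrier_vec n" "w \<in> carrier_vec n"
  shows "eucl_norm (v + w) \<le> eucl_norm v + eucl_norm w"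
  using L2_set_triangle_ineq[of "\<lambda>i. v $ i" "\<lambda>i. w $ i" "{0..<n}"] assms
  by (auto simp: eucl_norm_L2_set cong: L2_set_cong_simp)

lemma eucl_norm_minus: "eucl_norm (- v) = eucl_norm v"
  unfolding eucl_norm_def by simp

lemma eucl_norm_diff:
  assumes "v \<in> carrier_vec n" "w \<in> carrier_vec n"
  shows "eucl_norm (v - w) \<le> eucl_norm v + eucl_norm w"
proof -
  have "v - w = v + (- w)" using assms by (intro eq_vecI) auto
  then show ?thesis using eucl_norm_triangle[of v n "- w"] assms by (simp add: eucl_norm_minus)
qed

lemma bdd_fn_eucl_normI:
  assumes "\<And>t. t \<ge> 0 \<Longrightarrow> x t \<in> carrier_vec n" "\<And>i. i < n \<Longrightarrow> bdd_fn (\<lambda>t. x t $ i)"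
  shows "bdd_fn (\<lambda>t. eucl_norm (x t))"
proof (rule bdd_fn_mono)
  show "bdd_fn (\<lambda>t. \<Sum>i=0..<n. \<bar>x t $ i\<bar>)"
    using assms(2) by (intro bdd_fn_sum) (auto simp: bdd_fn_def)
  fix t :: real assume "t \<ge> 0"
  then show "norm (eucl_norm (x t)) \<le> norm (\<Sum>i=0..<n. \<bar>x t $ i\<bar>)"
    using eucl_norm_le_sum[of "x t"] assms(1)[of t] by auto
qed

lemma exp_decay_eucl_normI:
  assumes "\<And>t. t \<ge> 0 \<Longrightarrow> x t \<in> carrier_vec n" "\<And>i. i < n \<Longrightarrow> exp_decay (\<lambda>t. x t $ i)"
  shows "exp_decay (\<lambda>t. eucl_norm (x t))"
proof (rule exp_decay_mono)
  show "exp_decay (\<lambda>t. \<Sum>i=0..<n. \<bar>x t $ i\<bar>)"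
    using assms(2) by (intro exp_decay_sum) (auto simp: exp_decay_def)
  fix t :: real assume "t \<ge> 0"
  then show "norm (eucl_norm (x t)) \<le> norm (\<Sum>i=0..<n. \<bar>x t $ i\<bar>)"
    using eucl_norm_le_sum[of "x t"] assms(1)[of t] by auto
qed

lemma bdd_fn_index:
  assumes "bdd_fn (\<lambda>t. eucl_norm (x t))" "\<And>t. t \<ge> 0 \<Longrightarrow> x t \<in> carrier_vec n" "i < n"
  shows "bdd_fn (\<lambda>t. x t $ i)"
  using abs_index_le_eucl_norm assms(2,3) by (intro bdd_fn_mono[OF assms(1)]) force

lemma vanishesI:
  assumes "\<And>t. t \<ge> 0 \<Longrightarrow> x t \<in> carrier_vec n" "\<And>i. i < n \<Longrightarrow> ((\<lambda>t. x t $ i) \<longlongrightarrow> 0) at_top"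
  shows "vanishes x"
proof -
  have "((\<lambda>t. \<Sum>i=0..<n. \<bar>x t $ i\<bar>) \<longlongrightarrow> (\<Sum>i=0..<n. \<bar>0\<bar>)) at_top"
    using assms(2) by (intro tendsto_intros) auto
  then have lim: "((\<lambda>t. \<Sum>i=0..<n. \<bar>x t $ i\<bar>) \<longlongrightarrow> 0) at_top" by simp
  have "eucl_norm (x t) \<le> (\<Sum>i=0..<n. \<bar>x t $ i\<bar>)" if "t \<ge> 0" for t
    using eucl_norm_le_sum[of "x t"] assms(1)[OF that] by auto
  then have "\<forall>\<^sub>F t in at_top. eucl_norm (x t) \<le> (\<Sum>i=0..<n. \<bar>x t $ i\<bar>)"
    by (auto intro: eventually_mono[OF eventually_ge_at_top[of 0]])
  then show ?thesis
    unfolding vanishes_def using lim by (intro tendsto_sandwich[OF _ _ tendsto_const lim]) auto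
qed

lemma vanishes_exponentially_iff:
  "vanishes_exponentially x \<longleftrightarrow> exp_decay (\<lambda>t. eucl_norm (x t))"
proof
  assume "vanishes_exponentially x"
  then show "exp_decay (\<lambda>t. eucl_norm (x t))"
    unfolding vanishes_exponentially_def exp_decay_def by auto
next
  assume ed: "exp_decay (\<lambda>t. eucl_norm (x t))"
  obtain C \<kappa> where "C > 0" "\<kappa> > 0" "\<And>t. t \<ge> 0 \<Longrightarrow> norm (eucl_norm (x t)) \<le> C * exp (- \<kappa> * t)"
    by (fact exp_decayE[OF ed])
  then show "vanishes_exponentially x" unfolding vanishes_exponentially_def by auto
qed

section \<open>Bounded and decaying matrix functions\<close>

definition bdd_mat :: "nat \<Rightarrow> nat \<Rightarrow> (real \<Rightarrow> real mat) \<Rightarrow> bool" where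
  "bdd_mat nr nc W \<longleftrightarrow>
     (\<forall>t\<ge>0. W t \<in> carrier_mat nr nc) \<and> (\<forall>i<nr. \<forall>j<nc. bdd_fn (\<lambda>t. W t $$ (i, j)))"

definition exp_decay_mat :: "nat \<Rightarrow> nat \<Rightarrow> (real \<Rightarrow> real mat) \<Rightarrow> bool" where
  "exp_decay_mat nr nc W \<longleftrightarrow>
     (\<forall>t\<ge>0. W t \<in> carrier_mat nr nc) \<and> (\<forall>i<nr. \<forall>j<nc. exp_decay (\<lambda>t. W t $$ (i, j)))"

lemma bdd_mat_const: "A \<in> carrier_mat nr nc \<Longrightarrow> bdd_mat nr nc (\<lambda>t. A)"
  unfolding bdd_mat_def by (auto intro: bdd_fn_const)

lemma bdd_mat_transpose:
  assumes W: "bdd_mat nr nc W" shows "bdd_mat nc nr (\<lambda>t. (W t)\<^sup>T)"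
proof -
  have "bdd_fn (\<lambda>t. (W t)\<^sup>T $$ (i, j))" if "i < nc" "j < nr" for i j
  proof (rule bdd_fn_cong[THEN iffD1])
    show "bdd_fn (\<lambda>t. W t $$ (j, i))" using W that unfolding bdd_mat_def by blast
    show "W t $$ (j, i) = (W t)\<^sup>T $$ (i, j)" if "t \<ge> 0" for t
    proof -
      have "W t \<in> carrier_mat nr nc" using W that unfolding bdd_mat_def by blast
      then show ?thesis using \<open>i < nc\<close> \<open>j < nr\<close> by simp
    qed
  qed
  then show ?thesis using W unfolding bdd_mat_def by auto
qed

lemma bdd_mat_mult:
  assumes "bdd_mat nr n A" "bdd_mat n nc B"
  shows "bdd_mat nr nc (\<lambda>t. A t * B t)"
proof -
  have "bdd_fn (\<lambda>t. (A t * B t) $$ (i, j))" if "i < nr" "j < nc" for i j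
  proof -
    have "bdd_fn (\<lambda>t. \<Sum>k=0..<n. A t $$ (i, k) * B t $$ (k, j))"
      using assms that unfolding bdd_mat_def by (intro bdd_fn_sum bdd_fn_mult) auto
    moreover have "(\<Sum>k=0..<n. A t $$ (i, k) * B t $$ (k, j)) = (A t * B t) $$ (i, j)" if "t \<ge> 0" for t
    proof -
      have "A t \<in> carrier_mat nr n" "B t \<in> carrier_mat n nc" using assms that unfolding bdd_mat_def by auto
      then show ?thesis using \<open>i < nr\<close> \<open>j < nc\<close> by (auto simp: scalar_prod_def)
    qed
    ultimately show ?thesis by (rule bdd_fn_cong[THEN iffD1, rotated])
  qed
  then show ?thesis using assms unfolding bdd_mat_def by auto
qed

text \<open>The sum of the absolute values of all entries dominates the operator norm and is bounded
  in time, so one constant serves every \<open>t\<close>. Constant matrices are covered through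
  \<open>bdd_mat_const\<close>.\<close>

lemma bdd_mat_operator_bound:
  assumes "bdd_mat nr nc W"
  obtains C where "C > 0"
    "\<And>t (v :: real vec). t \<ge> 0 \<Longrightarrow> v \<in> carrier_vec nc \<Longrightarrow> eucl_norm (W t *\<^sub>v v) \<le> C * eucl_norm v"
proof -
  have b: "bdd_fn (\<lambda>t. \<Sum>i=0..<nr. \<Sum>j=0..<nc. \<bar>W t $$ (i, j)\<bar>)"
    using assms unfolding bdd_mat_def by (intro bdd_fn_sum) (auto simp: bdd_fn_def)
  obtain C where C: "C > 0"
    "\<And>t. t \<ge> 0 \<Longrightarrow> norm (\<Sum>i=0..<nr. \<Sum>j=0..<nc. \<bar>W t $$ (i, j)\<bar>) \<le> C"
    by (fact bdd_fnE[OF b])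
  show ?thesis
  proof (rule that[OF C(1)])
    fix t :: real and v :: "real vec" assume t: "t \<ge> 0" and v: "v \<in> carrier_vec nc"
    have W: "W t \<in> carrier_mat nr nc" using assms t unfolding bdd_mat_def by blast
    have "eucl_norm (W t *\<^sub>v v) \<le> (\<Sum>i=0..<nr. \<bar>(W t *\<^sub>v v) $ i\<bar>)"
      using eucl_norm_le_sum[of "W t *\<^sub>v v"] W by simp
    also have "\<dots> \<le> (\<Sum>i=0..<nr. \<Sum>j=0..<nc. \<bar>W t $$ (i, j)\<bar> * eucl_norm v)"
    proof (rule sum_mono)
      fix i assume i: "i \<in> {0..<nr}"
      have "\<bar>(W t *\<^sub>v v) $ i\<bar> = \<bar>\<Sum>j=0..<nc. W t $$ (i, j) * v $ j\<bar>"
        using W v i by (simp add: scalar_prod_def)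
      also have "\<dots> \<le> (\<Sum>j=0..<nc. \<bar>W t $$ (i, j) * v $ j\<bar>)" by (rule sum_abs)
      also have "\<dots> \<le> (\<Sum>j=0..<nc. \<bar>W t $$ (i, j)\<bar> * eucl_norm v)"
        using abs_index_le_eucl_norm v by (intro sum_mono) (auto simp: abs_mult intro!: mult_left_mono)
      finally show "\<bar>(W t *\<^sub>v v) $ i\<bar> \<le> (\<Sum>j=0..<nc. \<bar>W t $$ (i, j)\<bar> * eucl_norm v)" .
    qed
    also have "\<dots> = (\<Sum>i=0..<nr. \<Sum>j=0..<nc. \<bar>W t $$ (i, j)\<bar>) * eucl_norm v"
      by (simp add: sum_distrib_right)
    also have "\<dots> \<le> C * eucl_norm v"
      using C(2)[OF t] by (intro mult_right_mono) auto
    finally show "eucl_norm (W t *\<^sub>v v) \<le> C * eucl_norm v" .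
  qed
qed

lemma bdd_fn_mult_mat_vec:
  assumes W: "bdd_mat nr nc W" and x: "bdd_fn (\<lambda>t. eucl_norm (x t))"
    and car: "\<And>t. t \<ge> 0 \<Longrightarrow> x t \<in> carrier_vec nc"
  shows "bdd_fn (\<lambda>t. eucl_norm (W t *\<^sub>v x t))"
proof -
  obtain C where C: "C > 0"
    "\<And>t (v :: real vec). t \<ge> 0 \<Longrightarrow> v \<in> carrier_vec nc \<Longrightarrow> eucl_norm (W t *\<^sub>v v) \<le> C * eucl_norm v"
    by (fact bdd_mat_operator_bound[OF W])
  have "bdd_fn (\<lambda>t. C * eucl_norm (x t))" using x by (intro bdd_fn_mult bdd_fn_const)
  then show ?thesis by (rule bdd_fn_mono) (use C car in simp)
qed

lemma exp_decay_bdd_mult_mat_vec: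
  assumes W: "bdd_mat nr nc W" and x: "exp_decay (\<lambda>t. eucl_norm (x t))"
    and car: "\<And>t. t \<ge> 0 \<Longrightarrow> x t \<in> carrier_vec nc"
  shows "exp_decay (\<lambda>t. eucl_norm (W t *\<^sub>v x t))"
proof -
  obtain C where C: "C > 0"
    "\<And>t (v :: real vec). t \<ge> 0 \<Longrightarrow> v \<in> carrier_vec nc \<Longrightarrow> eucl_norm (W t *\<^sub>v v) \<le> C * eucl_norm v"
    by (fact bdd_mat_operator_bound[OF W])
  have "exp_decay (\<lambda>t. C * eucl_norm (x t))" using x by (intro exp_decay_mult_right bdd_fn_const)
  then show ?thesis by (rule exp_decay_mono) (use C car in simp)
qed

text \<open>Here the matrix decays and the vector is merely bounded: the situation of a regressor
  mismatch acting on a parameter that need not converge.\<close>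

lemma exp_decay_mult_mat_vec:
  assumes W: "exp_decay_mat nr nc W" and x: "bdd_fn (\<lambda>t. eucl_norm (x t))"
    and car: "\<And>t. t \<ge> 0 \<Longrightarrow> x t \<in> carrier_vec nc"
  shows "exp_decay (\<lambda>t. eucl_norm (W t *\<^sub>v x t))"
proof (rule exp_decay_eucl_normI)
  show "W t *\<^sub>v x t \<in> carrier_vec nr" if "t \<ge> 0" for t
    using W car[OF that] that unfolding exp_decay_mat_def by (auto intro: mult_mat_vec_carrier)
  fix i assume i: "i < nr"
  have "exp_decay (\<lambda>t. \<Sum>j=0..<nc. W t $$ (i, j) * x t $ j)"
    using W i bdd_fn_index[OF x car] unfolding exp_decay_mat_def
    by (intro exp_decay_sum exp_decay_mult_left) auto
  moreover have "(\<Sum>j=0..<nc. W t $$ (i, j) * x t $ j) = (W t *\<^sub>v x t) $ i" if t: "t \<ge> 0" for t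
  proof -
    have "W t \<in> carrier_mat nr nc" using W t unfolding exp_decay_mat_def by auto
    then show ?thesis using car[OF t] i by (simp add: scalar_prod_def)
  qed
  ultimately show "exp_decay (\<lambda>t. (W t *\<^sub>v x t) $ i)"
    by (rule exp_decay_cong[THEN iffD1, rotated])
qed

lemma exp_decay_eucl_norm_add:
  assumes "exp_decay (\<lambda>t. eucl_norm (x t))" "exp_decay (\<lambda>t. eucl_norm (y t))"
    and "\<And>t. t \<ge> 0 \<Longrightarrow> x t \<in> carrier_vec n" "\<And>t. t \<ge> 0 \<Longrightarrow> y t \<in> carrier_vec n"
  shows "exp_decay (\<lambda>t. eucl_norm (x t + y t))"
  by (rule exp_decay_mono[OF exp_decay_add[OF assms(1,2)]]) (use assms eucl_norm_triangle[of _ n] in simp)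

lemma bdd_fn_eucl_norm_diff:
  assumes "bdd_fn (\<lambda>t. eucl_norm (x t))" "bdd_fn (\<lambda>t. eucl_norm (y t))"
    and "\<And>t. t \<ge> 0 \<Longrightarrow> x t \<in> carrier_vec n" "\<And>t. t \<ge> 0 \<Longrightarrow> y t \<in> carrier_vec n"
  shows "bdd_fn (\<lambda>t. eucl_norm (x t - y t))"
  by (rule bdd_fn_mono[OF bdd_fn_add[OF assms(1,2)]]) (use assms eucl_norm_diff[of _ n] in simp)

lemma bdd_fn_eucl_norm_add:
  assumes "bdd_fn (\<lambda>t. eucl_norm (x t))" "bdd_fn (\<lambda>t. eucl_norm (y t))"
    and "\<And>t. t \<ge> 0 \<Longrightarrow> x t \<in> carrier_vec n" "\<And>t. t \<ge> 0 \<Longrightarrow> y t \<in> carrier_vec n"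
  shows "bdd_fn (\<lambda>t. eucl_norm (x t + y t))"
  by (rule bdd_fn_mono[OF bdd_fn_add[OF assms(1,2)]]) (use assms eucl_norm_triangle[of _ n] in simp)

lemma exp_decay_scalar_prod:
  assumes "exp_decay (\<lambda>t. eucl_norm (x t))" "bdd_fn (\<lambda>t. eucl_norm (y t))"
    and "\<And>t. t \<ge> 0 \<Longrightarrow> x t \<in> carrier_vec n" "\<And>t. t \<ge> 0 \<Longrightarrow> y t \<in> carrier_vec n"
  shows "exp_decay (\<lambda>t. x t \<bullet> y t)"
  by (rule exp_decay_mono[OF exp_decay_mult_left[OF assms(1,2)]])
    (use assms abs_scalar_prod_le[of _ n] in \<open>simp add: abs_mult\<close>)

section \<open>Symmetric positive definite matrices\<close>

lemma sym_pos_def_carrier: "sym_pos_def n A \<Longrightarrow> A \<in> carrier_mat n n"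
  unfolding sym_pos_def_def by simp

lemma sym_mat_swap:
  assumes "A \<in> carrier_mat n n" "A\<^sup>T = A" "v \<in> carrier_vec n" "w \<in> carrier_vec n"
  shows "v \<bullet> (A *\<^sub>v w) = (A *\<^sub>v v) \<bullet> (w :: real vec)"
  using transpose_vec_mult_scalar[OF assms(1) assms(4) assms(3)] assms by simp

text \<open>A kernel vector would annihilate the form, so the determinant is nonzero; the form of
  the inverse at \<open>v\<close> is the form of \<open>A\<close> at
  \<open>B *\<^sub>v v\<close>.\<close>

lemma sym_pos_def_inverse:
  assumes A: "sym_pos_def n A"
  obtains B where "A * B = 1\<^sub>m n" "B * A = 1\<^sub>m n" "sym_pos_def n B"
proof -
  have car: "A \<in> carrier_mat n n" and sym: "A\<^sup>T = A" using A unfolding sym_pos_def_def by auto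
  have "det A \<noteq> 0"
  proof
    assume "det A = 0"
    then obtain v where v: "v \<in> carrier_vec n" "v \<noteq> 0\<^sub>v n" "A *\<^sub>v v = 0\<^sub>v n"
      using det_0_iff_vec_prod_zero[OF car] by blast
    then have "v \<bullet> (A *\<^sub>v v) = 0" by simp
    then show False using A v unfolding sym_pos_def_def by auto
  qed
  then obtain B where B: "B \<in> carrier_mat n n" "A * B = 1\<^sub>m n" "B * A = 1\<^sub>m n"
    using det_non_zero_imp_unit[OF car, of UNIV] unfolding Units_def by (auto simp: ring_mat_simps)
  have symB: "B\<^sup>T = B"
  proof -
    have "B\<^sup>T * A = 1\<^sub>m n" using transpose_mult[OF car B(1)] B(2) sym by simp
    then have "B\<^sup>T * (A * B) = B" using assoc_mult_mat[of "B\<^sup>T" n n A n B n] B car by simp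
    then show ?thesis using B by simp
  qed
  have "0 < v \<bullet> (B *\<^sub>v v)" if v: "v \<in> carrier_vec n" "v \<noteq> 0\<^sub>v n" for v
  proof -
    define w where "w = B *\<^sub>v v"
    have w: "w \<in> carrier_vec n" using B v by (simp add: w_def)
    have Aw: "A *\<^sub>v w = v"
      using assoc_mult_mat_vec[OF car B(1) v(1)] B v by (simp add: w_def)
    then have "w \<noteq> 0\<^sub>v n" using v car by auto
    then have "0 < w \<bullet> (A *\<^sub>v w)" using A w unfolding sym_pos_def_def by blast
    then show ?thesis using Aw comm_scalar_prod[OF w v(1)] by (simp add: w_def)
  qed
  then have "sym_pos_def n B" using B symB unfolding sym_pos_def_def by blast
  then show ?thesis using that B by blast
qed

lemma quadratic_form_upper:
  fixes A :: "real mat"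
  assumes A: "A \<in> carrier_mat n n"
  obtains C where "C > 0" "\<And>v :: real vec. v \<in> carrier_vec n \<Longrightarrow> v \<bullet> (A *\<^sub>v v) \<le> C * (v \<bullet> v)"
proof -
  obtain C where C: "C > 0" "\<And>t (v :: real vec). (t::real) \<ge> 0 \<Longrightarrow> v \<in> carrier_vec n \<Longrightarrow> eucl_norm (A *\<^sub>v v) \<le> C * eucl_norm v"
    by (fact bdd_mat_operator_bound[OF bdd_mat_const[OF A]])
  show ?thesis
  proof (rule that[OF C(1)])
    fix v :: "real vec" assume v: "v \<in> carrier_vec n"
    have "v \<bullet> (A *\<^sub>v v) \<le> eucl_norm v * eucl_norm (A *\<^sub>v v)"
      using abs_scalar_prod_le[of v n "A *\<^sub>v v"] A v by auto
    also have "\<dots> \<le> eucl_norm v * (C * eucl_norm v)"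
      using C(2)[of 0] v by (intro mult_left_mono) auto
    finally show "v \<bullet> (A *\<^sub>v v) \<le> C * (v \<bullet> v)"
      by (simp add: scalar_prod_self power2_eq_square algebra_simps)
  qed
qed

text \<open>The nonnegativity of the form of \<open>A\<close> at \<open>v - s A\<inverse> v\<close> for a suitable \<open>s\<close> bounds
  the form from below by the operator norm of the inverse, without a compactness argument.\<close>

lemma sym_pos_def_lower:
  assumes A: "sym_pos_def n A"
  obtains c where "c > 0" "\<And>v :: real vec. v \<in> carrier_vec n \<Longrightarrow> c * (v \<bullet> v) \<le> v \<bullet> (A *\<^sub>v v)"
proof -
  have car: "A \<in> carrier_mat n n" and sym: "A\<^sup>T = A" using A unfolding sym_pos_def_def by auto
  obtain B where B: "A * B = 1\<^sub>m n" "B * A = 1\<^sub>m n" "sym_pos_def n B"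
    by (fact sym_pos_def_inverse[OF A])
  have Bcar: "B \<in> carrier_mat n n" using B(3) by (rule sym_pos_def_carrier)
  obtain C where C: "C > 0" "\<And>v :: real vec. v \<in> carrier_vec n \<Longrightarrow> v \<bullet> (B *\<^sub>v v) \<le> C * (v \<bullet> v)"
    by (fact quadratic_form_upper[OF Bcar])
  show ?thesis
  proof (rule that[of "1 / C"])
    fix v :: "real vec" assume v: "v \<in> carrier_vec n"
    define w where "w = B *\<^sub>v v"
    have w: "w \<in> carrier_vec n" using Bcar v by (simp add: w_def)
    have Aw: "A *\<^sub>v w = v"
      using assoc_mult_mat_vec[OF car Bcar v] B v by (simp add: w_def)
    \<comment> \<open>After expansion the form of \<open>A\<close> at \<open>v\<close> is at least
      \<open>(2 * s - C * s^2)\<close> times \<open>v \<bullet> v\<close>; this \<open>s\<close>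
      maximizes the factor, with maximum \<open>1 / C\<close>.\<close>
    define s where "s = 1 / C"
    have nonneg: "0 \<le> z \<bullet> (A *\<^sub>v z)" if "z \<in> carrier_vec n" for z
    proof (cases "z = 0\<^sub>v n")
      case False
      then show ?thesis using A that unfolding sym_pos_def_def by force
    qed (use car in simp)
    have z: "v - s \<cdot>\<^sub>v w \<in> carrier_vec n" using v w by simp
    have "A *\<^sub>v (v - s \<cdot>\<^sub>v w) = A *\<^sub>v v - s \<cdot>\<^sub>v v"
      using mult_minus_distrib_mat_vec[OF car v, of "s \<cdot>\<^sub>v w"] mult_mat_vec[OF car w] w Aw by simp
    then have "(v - s \<cdot>\<^sub>v w) \<bullet> (A *\<^sub>v (v - s \<cdot>\<^sub>v w)) =
        v \<bullet> (A *\<^sub>v v) - s * (v \<bullet> v) - s * (w \<bullet> (A *\<^sub>v v)) + s * s * (w \<bullet> v)"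
      using car v w
      by (simp add: minus_scalar_prod_distrib[of _ n] scalar_prod_minus_distrib[of _ n] algebra_simps)
    also have "w \<bullet> (A *\<^sub>v v) = v \<bullet> v"
      using sym_mat_swap[OF car sym w v] Aw by simp
    finally have "2 * s * (v \<bullet> v) - s * s * (w \<bullet> v) \<le> v \<bullet> (A *\<^sub>v v)"
      using nonneg[OF z] by simp
    moreover have "w \<bullet> v \<le> C * (v \<bullet> v)" using C(2)[OF v] comm_scalar_prod[OF w v] by (simp add: w_def)
    then have "s * s * (w \<bullet> v) \<le> s * s * (C * (v \<bullet> v))" by (intro mult_left_mono) auto
    moreover have "s * s * (C * (v \<bullet> v)) = s * (v \<bullet> v)" using C(1) by (simp add: s_def)
    ultimately show "1 / C * (v \<bullet> v) \<le> v \<bullet> (A *\<^sub>v v)" by (simp add: s_def)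
  qed (use C in simp)
qed

lemma bdd_fn_scalar_prod:
  assumes "bdd_fn (\<lambda>t. eucl_norm (x t))" "bdd_fn (\<lambda>t. eucl_norm (y t))"
    and "\<And>t. t \<ge> 0 \<Longrightarrow> x t \<in> carrier_vec n" "\<And>t. t \<ge> 0 \<Longrightarrow> y t \<in> carrier_vec n"
  shows "bdd_fn (\<lambda>t. x t \<bullet> y t)"
  by (rule bdd_fn_mono[OF bdd_fn_mult[OF assms(1,2)]])
    (use assms abs_scalar_prod_le[of _ n] in \<open>simp add: abs_mult\<close>)

lemma bdd_mat_carrier: "bdd_mat nr nc W \<Longrightarrow> t \<ge> 0 \<Longrightarrow> W t \<in> carrier_mat nr nc"
  unfolding bdd_mat_def by blast

section \<open>The adaptive error system\<close>

text \<open>The closed loop in error coordinates, detached from the plant: \<open>\<theta>\<close>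
  stands for the parameter error, \<open>W\<close> for any bounded regressor and \<open>b\<close>
  for an exogenous decaying term. Excitation and the rate of \<open>W\<close> enter only in the
  lemmas that use them.\<close>

locale adaptive_error =
  fixes n q :: nat and K P \<Lambda> :: "real mat" and e \<theta> b :: "real \<Rightarrow> real vec"
    and W :: "real \<Rightarrow> real mat"
  assumes K_carrier: "K \<in> carrier_mat n n"
    and P_spd: "sym_pos_def n P"
    and lyapunov_eq: "K\<^sup>T * P + P * K = - 1\<^sub>m n"
    and \<Lambda>_spd: "sym_pos_def q \<Lambda>"
    and W_bdd: "bdd_mat n q W"
    and b_carrier: "\<And>t. t \<ge> 0 \<Longrightarrow> b t \<in> carrier_vec n"
    and b_decay: "exp_decay (\<lambda>t. eucl_norm (b t))"
    and e_rate: "has_rate n e (\<lambda>t. K *\<^sub>v e t - W t *\<^sub>v \<theta> t - b t)"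
    and \<theta>_rate: "has_rate q \<theta> (\<lambda>t. (\<Lambda> * (W t)\<^sup>T * P) *\<^sub>v e t)"
begin

abbreviation "e' t \<equiv> K *\<^sub>v e t - W t *\<^sub>v \<theta> t - b t"
abbreviation "\<theta>' t \<equiv> (\<Lambda> * (W t)\<^sup>T * P) *\<^sub>v e t"

lemma P_carrier: "P \<in> carrier_mat n n" and P_sym: "P\<^sup>T = P"
  using P_spd unfolding sym_pos_def_def by auto

lemma \<Lambda>_carrier: "\<Lambda> \<in> carrier_mat q q"
  using \<Lambda>_spd unfolding sym_pos_def_def by auto

lemma W_carrier: "t \<ge> 0 \<Longrightarrow> W t \<in> carrier_mat n q"
  by (rule bdd_mat_carrier[OF W_bdd])

lemma e_carrier: "t \<ge> 0 \<Longrightarrow> e t \<in> carrier_vec n"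
  by (rule has_rate_carrier[OF e_rate])

lemma \<theta>_carrier: "t \<ge> 0 \<Longrightarrow> \<theta> t \<in> carrier_vec q"
  by (rule has_rate_carrier[OF \<theta>_rate])

lemma W\<theta>_carrier: "t \<ge> 0 \<Longrightarrow> W t *\<^sub>v \<theta> t \<in> carrier_vec n"
  using W_carrier \<theta>_carrier by (rule mult_mat_vec_carrier)

lemma Ke_carrier: "t \<ge> 0 \<Longrightarrow> K *\<^sub>v e t \<in> carrier_vec n"
  using K_carrier e_carrier by (rule mult_mat_vec_carrier)

lemma Pe_carrier: "t \<ge> 0 \<Longrightarrow> P *\<^sub>v e t \<in> carrier_vec n"
  using P_carrier e_carrier by (rule mult_mat_vec_carrier)

lemma e'_carrier: "t \<ge> 0 \<Longrightarrow> e' t \<in> carrier_vec n"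
  using W\<theta>_carrier Ke_carrier b_carrier by simp

lemma gain_carrier: "t \<ge> 0 \<Longrightarrow> \<Lambda> * (W t)\<^sup>T * P \<in> carrier_mat q n"
  using W_carrier[of t] \<Lambda>_carrier P_carrier by simp

lemma \<theta>'_carrier: "t \<ge> 0 \<Longrightarrow> \<theta>' t \<in> carrier_vec q"
  using gain_carrier e_carrier by (rule mult_mat_vec_carrier)

lemma \<theta>'_eq: "t \<ge> 0 \<Longrightarrow> \<theta>' t = \<Lambda> *\<^sub>v ((W t)\<^sup>T *\<^sub>v (P *\<^sub>v e t))"
  using W_carrier[of t] \<Lambda>_carrier P_carrier e_carrier[of t]
  by (simp add: assoc_mult_mat_vec[of _ q n _ n] assoc_mult_mat_vec[of _ q q _ n])

lemma gain_bdd: "bdd_mat q n (\<lambda>t. \<Lambda> * (W t)\<^sup>T * P)"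
  by (intro bdd_mat_mult[of q n] bdd_mat_mult[of q q] bdd_mat_const bdd_mat_transpose W_bdd \<Lambda>_carrier P_carrier)

section \<open>Lyapunov function and boundedness of the error states\<close>

lemma lyapunov_form:
  assumes "v \<in> carrier_vec n"
  shows "2 * ((P *\<^sub>v v) \<bullet> (K *\<^sub>v v)) = - (v \<bullet> v)"
proof -
  have Pv: "P *\<^sub>v v \<in> carrier_vec n" and Kv: "K *\<^sub>v v \<in> carrier_vec n"
    using P_carrier K_carrier assms by auto
  have "- (v \<bullet> v) = v \<bullet> ((K\<^sup>T * P + P * K) *\<^sub>v v)"
    unfolding lyapunov_eq using assms by (simp add: uminus_mult_mat_vec)
  also have "(K\<^sup>T * P + P * K) *\<^sub>v v = K\<^sup>T *\<^sub>v (P *\<^sub>v v) + P *\<^sub>v (K *\<^sub>v v)"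
    using K_carrier P_carrier assms
    by (simp add: add_mult_distrib_mat_vec[of _ n n] assoc_mult_mat_vec[of _ n n _ n])
  also have "v \<bullet> \<dots> = v \<bullet> (K\<^sup>T *\<^sub>v (P *\<^sub>v v)) + v \<bullet> (P *\<^sub>v (K *\<^sub>v v))"
    using K_carrier P_carrier assms by (intro scalar_prod_add_distrib[of _ n]) auto
  also have "v \<bullet> (K\<^sup>T *\<^sub>v (P *\<^sub>v v)) = (P *\<^sub>v v) \<bullet> (K *\<^sub>v v)"
    using transpose_vec_mult_scalar[OF K_carrier assms Pv] K_carrier assms Pv
    by (subst comm_scalar_prod[of _ n]) auto
  also have "v \<bullet> (P *\<^sub>v (K *\<^sub>v v)) = (P *\<^sub>v v) \<bullet> (K *\<^sub>v v)"
    by (rule sym_mat_swap[OF P_carrier P_sym assms Kv])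
  finally show ?thesis by simp
qed

text \<open>The update law is designed for this: with \<open>B\<close> the inverse of
  \<open>\<Lambda>\<close>, \<open>B *\<^sub>v \<theta>' t\<close> is the transposed regressor
  applied to \<open>P *\<^sub>v e t\<close>, so the parameter part contributes
  \<open>2 * ((P *\<^sub>v e t) \<bullet> (W t *\<^sub>v \<theta> t))\<close>, the cross term of the
  state part with the opposite sign. Two-sided quadratic bounds are exported because the strict
  function is compared with \<open>V\<close> from both sides.\<close>

lemma lyapunov_function:
  obtains lo hi V where "lo > 0" "hi > 0"
    "\<And>t. t \<ge> 0 \<Longrightarrow> (V has_real_derivative - (e t \<bullet> e t) - 2 * ((P *\<^sub>v e t) \<bullet> b t)) (at t within {0..})"
    "\<And>t. t \<ge> 0 \<Longrightarrow> lo * (e t \<bullet> e t + \<theta> t \<bullet> \<theta> t) \<le> V t"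
    "\<And>t. t \<ge> 0 \<Longrightarrow> V t \<le> hi * (e t \<bullet> e t + \<theta> t \<bullet> \<theta> t)"
proof -
  obtain B where B: "\<Lambda> * B = 1\<^sub>m q" "B * \<Lambda> = 1\<^sub>m q" "sym_pos_def q B"
    by (fact sym_pos_def_inverse[OF \<Lambda>_spd])
  have Bcar: "B \<in> carrier_mat q q" and Bsym: "B\<^sup>T = B" using B(3) unfolding sym_pos_def_def by auto
  define V where "V = (\<lambda>t. e t \<bullet> (P *\<^sub>v e t) + \<theta> t \<bullet> (B *\<^sub>v \<theta> t))"
  have der: "(V has_real_derivative - (e t \<bullet> e t) - 2 * ((P *\<^sub>v e t) \<bullet> b t)) (at t within {0..})"
    if t: "t \<ge> 0" for t
  proof -
    note car = e_carrier[OF t] \<theta>_carrier[OF t] e'_carrier[OF t] \<theta>'_carrier[OF t] W_carrier[OF t]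
      W\<theta>_carrier[OF t] Ke_carrier[OF t] Pe_carrier[OF t] b_carrier[OF t]
    have "((\<lambda>t. e t \<bullet> (P *\<^sub>v e t)) has_real_derivative e' t \<bullet> (P *\<^sub>v e t) + e t \<bullet> (P *\<^sub>v e' t))
        (at t within {0..})"
      by (rule scalar_prod_has_derivative[OF e_rate has_rate_const_mult_mat_vec[OF P_carrier e_rate] _ t])
        (use P_carrier e'_carrier t in auto)
    moreover have "((\<lambda>t. \<theta> t \<bullet> (B *\<^sub>v \<theta> t)) has_real_derivative
        \<theta>' t \<bullet> (B *\<^sub>v \<theta> t) + \<theta> t \<bullet> (B *\<^sub>v \<theta>' t)) (at t within {0..})"
      by (rule scalar_prod_has_derivative[OF \<theta>_rate has_rate_const_mult_mat_vec[OF Bcar \<theta>_rate] _ t])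
        (use Bcar \<theta>'_carrier t in auto)
    ultimately have "(V has_real_derivative
        (e' t \<bullet> (P *\<^sub>v e t) + e t \<bullet> (P *\<^sub>v e' t)) + (\<theta>' t \<bullet> (B *\<^sub>v \<theta> t) + \<theta> t \<bullet> (B *\<^sub>v \<theta>' t)))
        (at t within {0..})"
      unfolding V_def by (rule DERIV_add)
    also have "e' t \<bullet> (P *\<^sub>v e t) = (P *\<^sub>v e t) \<bullet> e' t" by (rule comm_scalar_prod[OF car(3) car(8)])
    also have "e t \<bullet> (P *\<^sub>v e' t) = (P *\<^sub>v e t) \<bullet> e' t" by (rule sym_mat_swap[OF P_carrier P_sym car(1) car(3)])
    also have "(P *\<^sub>v e t) \<bullet> e' t = (P *\<^sub>v e t) \<bullet> (K *\<^sub>v e t) - (P *\<^sub>v e t) \<bullet> (W t *\<^sub>v \<theta> t) - (P *\<^sub>v e t) \<bullet> b t"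
      using car by (simp add: scalar_prod_minus_distrib[of _ n])
    also have B\<theta>': "B *\<^sub>v \<theta>' t = (W t)\<^sup>T *\<^sub>v (P *\<^sub>v e t)"
    proof -
      have "B *\<^sub>v \<theta>' t = (B * \<Lambda>) *\<^sub>v ((W t)\<^sup>T *\<^sub>v (P *\<^sub>v e t))"
        unfolding \<theta>'_eq[OF t] using Bcar \<Lambda>_carrier car by (intro assoc_mult_mat_vec[symmetric]) auto
      then show ?thesis using B car by simp
    qed
    also have "\<theta>' t \<bullet> (B *\<^sub>v \<theta> t) = \<theta> t \<bullet> ((W t)\<^sup>T *\<^sub>v (P *\<^sub>v e t))"
      using sym_mat_swap[OF Bcar Bsym car(4) car(2)] B\<theta>' car
      by (simp add: comm_scalar_prod[of _ q "\<theta> t"])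
    also have "\<theta> t \<bullet> ((W t)\<^sup>T *\<^sub>v (P *\<^sub>v e t)) = (P *\<^sub>v e t) \<bullet> (W t *\<^sub>v \<theta> t)"
      using transpose_vec_mult_scalar[OF car(5) car(2) car(8)] car
      by (subst comm_scalar_prod[of _ q]) auto
    finally show ?thesis
      using lyapunov_form[OF car(1)] by (simp add: algebra_simps)
  qed
  obtain c1 where c1: "c1 > 0" "\<And>v. v \<in> carrier_vec n \<Longrightarrow> c1 * (v \<bullet> v) \<le> v \<bullet> (P *\<^sub>v v)"
    by (fact sym_pos_def_lower[OF P_spd])
  obtain c2 where c2: "c2 > 0" "\<And>v. v \<in> carrier_vec q \<Longrightarrow> c2 * (v \<bullet> v) \<le> v \<bullet> (B *\<^sub>v v)"
    by (fact sym_pos_def_lower[OF B(3)])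
  obtain d1 where d1: "d1 > 0" "\<And>v. v \<in> carrier_vec n \<Longrightarrow> v \<bullet> (P *\<^sub>v v) \<le> d1 * (v \<bullet> v)"
    by (fact quadratic_form_upper[OF P_carrier])
  obtain d2 where d2: "d2 > 0" "\<And>v. v \<in> carrier_vec q \<Longrightarrow> v \<bullet> (B *\<^sub>v v) \<le> d2 * (v \<bullet> v)"
    by (fact quadratic_form_upper[OF Bcar])
  have sq: "0 \<le> v \<bullet> v" for v :: "real vec" by (simp add: scalar_prod_self)
  show ?thesis
  proof (rule that[of "min c1 c2" "max d1 d2" V])
    fix t :: real assume t: "t \<ge> 0"
    have "min c1 c2 * (e t \<bullet> e t) \<le> e t \<bullet> (P *\<^sub>v e t)"
      by (rule order_trans[OF mult_right_mono[OF min.cobounded1 sq] c1(2)[OF e_carrier[OF t]]])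
    moreover have "min c1 c2 * (\<theta> t \<bullet> \<theta> t) \<le> \<theta> t \<bullet> (B *\<^sub>v \<theta> t)"
      by (rule order_trans[OF mult_right_mono[OF min.cobounded2 sq] c2(2)[OF \<theta>_carrier[OF t]]])
    ultimately show "min c1 c2 * (e t \<bullet> e t + \<theta> t \<bullet> \<theta> t) \<le> V t"
      by (simp add: V_def distrib_left)
    have "e t \<bullet> (P *\<^sub>v e t) \<le> max d1 d2 * (e t \<bullet> e t)"
      by (rule order_trans[OF d1(2)[OF e_carrier[OF t]] mult_right_mono[OF max.cobounded1 sq]])
    moreover have "\<theta> t \<bullet> (B *\<^sub>v \<theta> t) \<le> max d1 d2 * (\<theta> t \<bullet> \<theta> t)"
      by (rule order_trans[OF d2(2)[OF \<theta>_carrier[OF t]] mult_right_mono[OF max.cobounded2 sq]])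
    ultimately show "V t \<le> max d1 d2 * (e t \<bullet> e t + \<theta> t \<bullet> \<theta> t)"
      by (simp add: V_def distrib_left)
    show "(V has_real_derivative - (e t \<bullet> e t) - 2 * ((P *\<^sub>v e t) \<bullet> b t)) (at t within {0..})"
      by (rule der[OF t])
  qed (use c1(1) c2(1) d1(1) in auto)
qed

text \<open>The perturbation \<open>b\<close> only adds a decaying exponential to the derivative of the Lyapunov
  function; its integral is absorbed into the function.\<close>

lemma perturbed_lyapunov_function:
  obtains lo V V' where "lo > 0"
    "\<And>t. t \<ge> 0 \<Longrightarrow> (V has_real_derivative V' t) (at t within {0..})"
    "\<And>t. t \<ge> 0 \<Longrightarrow> V' t \<le> - ((e t \<bullet> e t) / 2)"
    "\<And>t. t \<ge> 0 \<Longrightarrow> lo * (e t \<bullet> e t + \<theta> t \<bullet> \<theta> t) \<le> V t"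
proof -
  obtain lo hi V where V: "lo > 0" "hi > 0"
    "\<And>t. t \<ge> 0 \<Longrightarrow> (V has_real_derivative - (e t \<bullet> e t) - 2 * ((P *\<^sub>v e t) \<bullet> b t)) (at t within {0..})"
    "\<And>t. t \<ge> 0 \<Longrightarrow> lo * (e t \<bullet> e t + \<theta> t \<bullet> \<theta> t) \<le> V t"
    "\<And>t. t \<ge> 0 \<Longrightarrow> V t \<le> hi * (e t \<bullet> e t + \<theta> t \<bullet> \<theta> t)"
    by (fact lyapunov_function)
  obtain C where C: "C > 0" "\<And>t (v :: real vec). (t::real) \<ge> 0 \<Longrightarrow> v \<in> carrier_vec n \<Longrightarrow> eucl_norm (P *\<^sub>v v) \<le> C * eucl_norm v"
    by (fact bdd_mat_operator_bound[OF bdd_mat_const[OF P_carrier]])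
  have nb: "exp_decay (\<lambda>t. (norm (eucl_norm (b t)))\<^sup>2)" by (rule exp_decay_power2_norm[OF b_decay])
  obtain D \<mu> where D: "D > 0" "\<mu> > 0"
    "\<And>t. t \<ge> 0 \<Longrightarrow> norm ((norm (eucl_norm (b t)))\<^sup>2) \<le> D * exp (- \<mu> * t)"
    by (fact exp_decayE[OF nb])
  \<comment> \<open>Dividing by \<open>\<mu>\<close> makes the derivative of the added term exactly
    \<open>- 2 * C^2 * D * exp (- \<mu> * t)\<close>, the remainder of the completed square
    below.\<close>
  define V2 where "V2 = (\<lambda>t. V t + 2 * C\<^sup>2 * D / \<mu> * exp (- \<mu> * t))"
  define V2' where "V2' = (\<lambda>t. - (e t \<bullet> e t) - 2 * ((P *\<^sub>v e t) \<bullet> b t) - 2 * C\<^sup>2 * D * exp (- \<mu> * t))"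
  show ?thesis
  proof (rule that[of lo V2 V2'])
    fix t :: real assume t: "t \<ge> 0"
    have "((\<lambda>t. 2 * C\<^sup>2 * D / \<mu> * exp (- \<mu> * t)) has_real_derivative - (2 * C\<^sup>2 * D * exp (- \<mu> * t)))
        (at t within {0..})"
      using D(2) by (auto intro!: derivative_eq_intros)
    from DERIV_add[OF V(3)[OF t] this] show "(V2 has_real_derivative V2' t) (at t within {0..})"
      unfolding V2_def V2'_def by simp
    have "- 2 * ((P *\<^sub>v e t) \<bullet> b t) \<le> 2 * (eucl_norm (P *\<^sub>v e t) * eucl_norm (b t))"
      using abs_le_D2[OF abs_scalar_prod_le[OF Pe_carrier[OF t] b_carrier[OF t]]] by linarith
    also have "\<dots> \<le> 2 * ((C * eucl_norm (e t)) * eucl_norm (b t))"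
      using C(2)[OF t e_carrier[OF t]] by (intro mult_left_mono mult_right_mono) auto
    \<comment> \<open>Young's inequality weighted so that exactly half of the dissipation
      \<open>|e|^2\<close> is spent on the perturbation.\<close>
    also have "\<dots> = (eucl_norm (e t))\<^sup>2 / 2 + 2 * C\<^sup>2 * (eucl_norm (b t))\<^sup>2
        - (eucl_norm (e t) - 2 * C * eucl_norm (b t))\<^sup>2 / 2"
      by (simp add: power2_eq_square field_simps)
    also have "\<dots> \<le> (eucl_norm (e t))\<^sup>2 / 2 + 2 * C\<^sup>2 * (eucl_norm (b t))\<^sup>2" by simp
    also have "2 * C\<^sup>2 * (eucl_norm (b t))\<^sup>2 \<le> 2 * C\<^sup>2 * (D * exp (- \<mu> * t))"
      using D(3)[OF t] by (intro mult_left_mono) auto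
    finally show "V2' t \<le> - ((e t \<bullet> e t) / 2)"
      by (simp add: V2'_def scalar_prod_self)
    show "lo * (e t \<bullet> e t + \<theta> t \<bullet> \<theta> t) \<le> V2 t"
      using V(4)[OF t] C(1) D(1,2) unfolding V2_def by (intro add_increasing2) auto
  qed (fact V(1))
qed

text \<open>The only control of \<open>\<theta>\<close> available without excitation: nothing damps
  it, but the nonincreasing Lyapunov function still dominates its square.\<close>

lemma bdd_states: "bdd_fn (\<lambda>t. eucl_norm (e t))" "bdd_fn (\<lambda>t. eucl_norm (\<theta> t))"
proof -
  obtain lo V V' where V: "lo > 0"
    "\<And>t. t \<ge> 0 \<Longrightarrow> (V has_real_derivative V' t) (at t within {0..})"
    "\<And>t. t \<ge> 0 \<Longrightarrow> V' t \<le> - ((e t \<bullet> e t) / 2)"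
    "\<And>t. t \<ge> 0 \<Longrightarrow> lo * (e t \<bullet> e t + \<theta> t \<bullet> \<theta> t) \<le> V t"
    by (fact perturbed_lyapunov_function)
  have le: "(eucl_norm (e t))\<^sup>2 + (eucl_norm (\<theta> t))\<^sup>2 \<le> V 0 / lo" if t: "t \<ge> 0" for t
  proof -
    have "V t \<le> V 0"
    proof (rule halfline_decreasing[where f = V and f' = V'])
      show "V' t \<le> 0" if "t \<ge> 0" for t
        using V(3)[OF that] zero_le_power2[of "eucl_norm (e t)"] unfolding scalar_prod_self by linarith
    qed (use V(2) t in auto)
    then show ?thesis using V(4)[OF t] V(1) by (simp add: scalar_prod_self pos_le_divide_eq mult.commute)
  qed
  show "bdd_fn (\<lambda>t. eucl_norm (e t))"
  proof (rule bdd_fnI)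
    fix t :: real assume t: "t \<ge> 0"
    have "(eucl_norm (e t))\<^sup>2 \<le> V 0 / lo"
      using le[OF t] zero_le_power2[of "eucl_norm (\<theta> t)"] by linarith
    then show "norm (eucl_norm (e t)) \<le> sqrt (V 0 / lo)" by (simp add: real_le_rsqrt)
  qed
  show "bdd_fn (\<lambda>t. eucl_norm (\<theta> t))"
  proof (rule bdd_fnI)
    fix t :: real assume t: "t \<ge> 0"
    have "(eucl_norm (\<theta> t))\<^sup>2 \<le> V 0 / lo"
      using le[OF t] zero_le_power2[of "eucl_norm (e t)"] by linarith
    then show "norm (eucl_norm (\<theta> t)) \<le> sqrt (V 0 / lo)" by (simp add: real_le_rsqrt)
  qed
qed

lemma bdd_rates: "bdd_fn (\<lambda>t. eucl_norm (e' t))" "bdd_fn (\<lambda>t. eucl_norm (\<theta>' t))"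
proof -
  have Ke: "bdd_fn (\<lambda>t. eucl_norm (K *\<^sub>v e t))"
    by (rule bdd_fn_mult_mat_vec[OF bdd_mat_const[OF K_carrier] bdd_states(1) e_carrier])
  have W\<theta>: "bdd_fn (\<lambda>t. eucl_norm (W t *\<^sub>v \<theta> t))"
    by (rule bdd_fn_mult_mat_vec[OF W_bdd bdd_states(2) \<theta>_carrier])
  have "bdd_fn (\<lambda>t. eucl_norm (K *\<^sub>v e t - W t *\<^sub>v \<theta> t))"
    by (rule bdd_fn_eucl_norm_diff[OF Ke W\<theta> Ke_carrier W\<theta>_carrier])
  then show "bdd_fn (\<lambda>t. eucl_norm (e' t))"
    by (rule bdd_fn_eucl_norm_diff[OF _ exp_decay_imp_bdd_fn[OF b_decay] minus_carrier_vec b_carrier])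
      (fact Ke_carrier W\<theta>_carrier)+
  show "bdd_fn (\<lambda>t. eucl_norm (\<theta>' t))"
    by (rule bdd_fn_mult_mat_vec[OF gain_bdd bdd_states(1) e_carrier])
qed

section \<open>Asymptotic convergence without excitation\<close>

lemma vanishes_e: "vanishes e"
proof -
  obtain lo V V' where V: "lo > 0"
    "\<And>t. t \<ge> 0 \<Longrightarrow> (V has_real_derivative V' t) (at t within {0..})"
    "\<And>t. t \<ge> 0 \<Longrightarrow> V' t \<le> - ((e t \<bullet> e t) / 2)"
    "\<And>t. t \<ge> 0 \<Longrightarrow> lo * (e t \<bullet> e t + \<theta> t \<bullet> \<theta> t) \<le> V t"
    by (fact perturbed_lyapunov_function)
  \<comment> \<open>The dissipation itself is fed to the Barbalat argument; its derivative is
    bounded because the states and their rates are.\<close>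
  have "((\<lambda>t. (e t \<bullet> e t) / 2) \<longlongrightarrow> 0) at_top"
  proof (rule barbalat_lyapunov[where v = V and v' = V' and g' = "\<lambda>t. (e' t \<bullet> e t + e t \<bullet> e' t) / 2"])
    show "0 \<le> V t" if "t \<ge> 0" for t
    proof -
      have "0 \<le> lo * (e t \<bullet> e t + \<theta> t \<bullet> \<theta> t)" using V(1) by (simp add: scalar_prod_self)
      then show ?thesis using V(4)[OF that] by linarith
    qed
    show "((\<lambda>t. e t \<bullet> e t / 2) has_real_derivative (e' t \<bullet> e t + e t \<bullet> e' t) / 2) (at t within {0..})"
      if "t \<ge> 0" for t
      by (intro DERIV_cdivide scalar_prod_has_derivative[OF e_rate e_rate e'_carrier[OF that] that])
    have "bdd_fn (\<lambda>t. e' t \<bullet> e t)" "bdd_fn (\<lambda>t. e t \<bullet> e' t)"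
      by (rule bdd_fn_scalar_prod[OF bdd_rates(1) bdd_states(1) e'_carrier e_carrier],
          assumption, assumption,
          rule bdd_fn_scalar_prod[OF bdd_states(1) bdd_rates(1) e_carrier e'_carrier])
    then have "bdd_fn (\<lambda>t. (1 / 2) * (e' t \<bullet> e t + e t \<bullet> e' t))"
      by (intro bdd_fn_mult bdd_fn_add bdd_fn_const)
    then show "bdd_fn (\<lambda>t. (e' t \<bullet> e t + e t \<bullet> e' t) / 2)" by simp
    show "V' t \<le> - (e t \<bullet> e t / 2)" if "t \<ge> 0" for t by (rule V(3)[OF that])
  qed (fact V(2), simp add: scalar_prod_self)
  then have "((\<lambda>t. sqrt (2 * (e t \<bullet> e t / 2))) \<longlongrightarrow> sqrt (2 * 0)) at_top"
    by (intro tendsto_intros)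
  then show ?thesis unfolding vanishes_def eucl_norm_def by simp
qed

text \<open>The output error equals \<open>e' - K e\<close>, so it vanishes once \<open>e'\<close>
  does, whether or not \<open>\<theta>\<close> converges. The second Barbalat argument needs
  \<open>e''\<close> bounded, and differentiating the error equation once more is what brings in the
  rates of \<open>W\<close> and \<open>b\<close>.\<close>

lemma vanishes_output:
  assumes W': "has_mat_rate n q W W'" "bdd_mat n q W'"
    and b': "has_rate n b b'" "bdd_fn (\<lambda>t. eucl_norm (b' t))" "\<And>t. t \<ge> 0 \<Longrightarrow> b' t \<in> carrier_vec n"
  shows "vanishes (\<lambda>t. - (W t *\<^sub>v \<theta> t) - b t)"
proof -
  define e'' where "e'' = (\<lambda>t. K *\<^sub>v e' t - (W' t *\<^sub>v \<theta> t + W t *\<^sub>v \<theta>' t) - b' t)"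
  have car1: "W' t *\<^sub>v \<theta> t \<in> carrier_vec n" if "t \<ge> 0" for t
    by (rule mult_mat_vec_carrier[OF bdd_mat_carrier[OF W'(2) that] \<theta>_carrier[OF that]])
  have car2: "W t *\<^sub>v \<theta>' t \<in> carrier_vec n" if "t \<ge> 0" for t
    by (rule mult_mat_vec_carrier[OF W_carrier[OF that] \<theta>'_carrier[OF that]])
  have car3: "K *\<^sub>v e' t \<in> carrier_vec n" if "t \<ge> 0" for t
    by (rule mult_mat_vec_carrier[OF K_carrier e'_carrier[OF that]])
  have car12: "W' t *\<^sub>v \<theta> t + W t *\<^sub>v \<theta>' t \<in> carrier_vec n" if "t \<ge> 0" for t
    by (rule add_carrier_vec[OF car1[OF that] car2[OF that]])
  have rate: "has_rate n e' e''"
    unfolding e''_def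
    by (rule has_rate_diff[OF has_rate_diff[OF has_rate_const_mult_mat_vec[OF K_carrier e_rate e'_carrier]
          has_rate_mult_mat_vec[OF W'(1) \<theta>_rate \<theta>'_carrier] car12] b'(1) b'(3)])
  have bdd: "bdd_fn (\<lambda>t. eucl_norm (e'' t))"
    unfolding e''_def
  proof (rule bdd_fn_eucl_norm_diff[OF bdd_fn_eucl_norm_diff[OF _ bdd_fn_eucl_norm_add] b'(2)])
    show "bdd_fn (\<lambda>t. eucl_norm (K *\<^sub>v e' t))"
      by (rule bdd_fn_mult_mat_vec[OF bdd_mat_const[OF K_carrier] bdd_rates(1) e'_carrier])
    show "bdd_fn (\<lambda>t. eucl_norm (W' t *\<^sub>v \<theta> t))"
      by (rule bdd_fn_mult_mat_vec[OF W'(2) bdd_states(2) \<theta>_carrier])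
    show "bdd_fn (\<lambda>t. eucl_norm (W t *\<^sub>v \<theta>' t))"
      by (rule bdd_fn_mult_mat_vec[OF W_bdd bdd_rates(2) \<theta>'_carrier])
    show "K *\<^sub>v e' t - (W' t *\<^sub>v \<theta> t + W t *\<^sub>v \<theta>' t) \<in> carrier_vec n" if "t \<ge> 0" for t
      by (rule minus_carrier_vec[OF car3[OF that] car12[OF that]])
  qed (fact car1 car2 car3 car12 b'(3))+
  have e''_car: "e'' t \<in> carrier_vec n" if "t \<ge> 0" for t
    unfolding e''_def
    by (rule minus_carrier_vec[OF minus_carrier_vec[OF car3[OF that] car12[OF that]] b'(3)[OF that]])
  have e_lim: "((\<lambda>t. e t $ i) \<longlongrightarrow> 0) at_top" if i: "i < n" for i
  proof (rule tendsto_rabs_zero_cancel, rule tendsto_sandwich[OF _ _ tendsto_const])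
    show "((\<lambda>t. eucl_norm (e t)) \<longlongrightarrow> 0) at_top" using vanishes_e unfolding vanishes_def .
    have "\<bar>e t $ i\<bar> \<le> eucl_norm (e t)" if "t \<ge> 0" for t
      using abs_index_le_eucl_norm[of i "e t"] e_carrier[OF that] i by simp
    then show "\<forall>\<^sub>F t in at_top. \<bar>e t $ i\<bar> \<le> eucl_norm (e t)"
      by (auto intro: eventually_mono[OF eventually_ge_at_top[of 0]])
  qed simp
  have e'_lim: "((\<lambda>t. e' t $ i) \<longlongrightarrow> 0) at_top" if i: "i < n" for i
  proof (rule barbalat_derivative[where f = "\<lambda>t. e t $ i" and f'' = "\<lambda>t. e'' t $ i"])
    show "((\<lambda>t. e t $ i) has_real_derivative e' t $ i) (at t within {0..})" if "t \<ge> 0" for t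
      by (rule has_rate_index[OF e_rate that i])
    show "((\<lambda>t. e' t $ i) has_real_derivative e'' t $ i) (at t within {0..})" if "t \<ge> 0" for t
      by (rule has_rate_index[OF rate that i])
    show "bdd_fn (\<lambda>t. e'' t $ i)" by (rule bdd_fn_index[OF bdd e''_car i])
    show "((\<lambda>t. e t $ i) \<longlongrightarrow> 0) at_top" by (rule e_lim[OF i])
  qed
  show ?thesis
  proof (rule vanishesI[where n = n])
    show "- (W t *\<^sub>v \<theta> t) - b t \<in> carrier_vec n" if "t \<ge> 0" for t
      using W\<theta>_carrier[OF that] b_carrier[OF that] by simp
    fix i assume i: "i < n"
    have "((\<lambda>t. e' t $ i - (\<Sum>j=0..<n. K $$ (i, j) * e t $ j)) \<longlongrightarrow> 0 - (\<Sum>j=0..<n. K $$ (i, j) * 0)) at_top"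
      by (intro tendsto_intros e'_lim[OF i] e_lim) auto
    then have lim: "((\<lambda>t. e' t $ i - (\<Sum>j=0..<n. K $$ (i, j) * e t $ j)) \<longlongrightarrow> 0) at_top" by simp
    have "e' t $ i - (\<Sum>j=0..<n. K $$ (i, j) * e t $ j) = (- (W t *\<^sub>v \<theta> t) - b t) $ i" if t: "t \<ge> 0" for t
    proof -
      have "(K *\<^sub>v e t) $ i = (\<Sum>j=0..<n. K $$ (i, j) * e t $ j)"
        using K_carrier e_carrier[OF t] i by (simp add: scalar_prod_def)
      then show ?thesis
        using carrier_vecD[OF W\<theta>_carrier[OF t]] carrier_vecD[OF b_carrier[OF t]] i
        by (simp del: index_mult_mat_vec)
    qed
    then have "\<forall>\<^sub>F t in at_top. e' t $ i - (\<Sum>j=0..<n. K $$ (i, j) * e t $ j) = (- (W t *\<^sub>v \<theta> t) - b t) $ i"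
      by (auto intro: eventually_mono[OF eventually_ge_at_top[of 0]])
    then show "((\<lambda>t. (- (W t *\<^sub>v \<theta> t) - b t) $ i) \<longlongrightarrow> 0) at_top"
      using lim by (rule Lim_transform_eventually[rotated])
  qed
qed

end

section \<open>Persistent excitation and a strict Lyapunov function\<close>

lemma halfline_integral_derivative:
  fixes F :: "real \<Rightarrow> real"
  assumes F: "continuous_on {0..} F" and t: "t \<ge> 0"
  shows "((\<lambda>s. integral {0..s} F) has_real_derivative F t) (at t within {0..})"
proof -
  have "((\<lambda>s. integral {0..s} F) has_real_derivative F t) (at t within {0..t + 1})"
    by (rule integral_has_real_derivative[OF continuous_on_subset[OF F]]) (use t in auto)
  also have "at t within {0..t + 1} = at t within {0..}"
    by (rule at_within_nhd[of t "{..<t + 1}"]) (use t in auto)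
  finally show ?thesis .
qed

text \<open>The shifted point is interior to the half line even at \<open>t = 0\<close>, so the
  one-sided derivative there is two-sided.\<close>

lemma halfline_shift_derivative:
  fixes f :: "real \<Rightarrow> real"
  assumes f: "(f has_real_derivative D) (at (t + T) within {0..})" and "t \<ge> 0" "T > 0"
  shows "((\<lambda>s. f (s + T)) has_real_derivative D) (at t within {0..})"
proof -
  have "at (t + T) within {0..} = at (t + T)"
    by (rule at_within_interior) (use assms in auto)
  then have "((\<lambda>s. f (s + T)) has_real_derivative D) (at t)" using f by (simp add: DERIV_shift)
  then show ?thesis by (rule has_field_derivative_at_within)
qed

text \<open>The witness is \<open>\<integral>\<close> over \<open>[t, t + T]\<close> of \<open>(t + T - \<tau>) F \<tau>\<close>, expressed through iterated
  primitives of \<open>F\<close>; unlike the sliding integral of \<open>F\<close>, its derivative contains \<open>F\<close> itself.\<close>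

lemma window_primitive:
  fixes F :: "real \<Rightarrow> real"
  assumes F: "continuous_on {0..} F" "bdd_fn F" and T: "T > 0"
  obtains Q where "bdd_fn Q"
    "\<And>t. t \<ge> 0 \<Longrightarrow> (Q has_real_derivative integral {t..t + T} F - T * F t) (at t within {0..})"
proof -
  define H where "H = (\<lambda>s. integral {0..s} F)"
  have H: "(H has_real_derivative F t) (at t within {0..})" if "t \<ge> 0" for t
    unfolding H_def by (rule halfline_integral_derivative[OF F(1) that])
  have contH: "continuous_on {0..} H"
    by (rule DERIV_continuous_on[where D = F]) (use H in auto)
  define J where "J = (\<lambda>s. integral {0..s} H)"
  have J: "(J has_real_derivative H t) (at t within {0..})" if "t \<ge> 0" for t
    unfolding J_def by (rule halfline_integral_derivative[OF contH that])
  \<comment> \<open>Integration by parts: the weight \<open>t + T - \<tau>\<close> vanishes at the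
    right end of the window and equals \<open>T\<close> at the left end, leaving the integral of
    \<open>H\<close> minus \<open>T * H t\<close>.\<close>
  define Q where "Q = (\<lambda>t. J (t + T) - J t - T * H t)"
  obtain B where B: "B > 0" "\<And>t. t \<ge> 0 \<Longrightarrow> \<bar>F t\<bar> \<le> B"
    by (fact bdd_fnE[OF F(2), unfolded real_norm_def])
  show ?thesis
  proof (rule that[of Q])
    show "bdd_fn Q"
    proof (rule bdd_fnI)
      fix t :: real assume t: "t \<ge> 0"
      \<comment> \<open>\<open>H\<close> and \<open>J\<close> may grow without bound; only the
        increment of \<open>H\<close> inside one window is bounded, and the mean value theorem
        reduces \<open>Q\<close> to it.\<close>
      obtain \<xi> where \<xi>: "t < \<xi>" "\<xi> < t + T" "J (t + T) - J t = (t + T - t) * H \<xi>"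
        by (rule halfline_mvt[of J H t "t + T"]) (use J t T in auto)
      have "Q t = T * (H \<xi> - H t)" using \<xi>(3) by (simp add: Q_def right_diff_distrib)
      also have "norm \<dots> = T * \<bar>H \<xi> - H t\<bar>" using T by (simp add: abs_mult)
      also have "\<bar>H \<xi> - H t\<bar> \<le> B * \<bar>\<xi> - t\<bar>"
        by (rule halfline_lipschitz[where f' = F]) (use H B t \<xi> in auto)
      also have "B * \<bar>\<xi> - t\<bar> \<le> B * T" using \<xi> B(1) by simp
      finally show "norm (Q t) \<le> T * (B * T)" using T by simp
    qed
    fix t :: real assume t: "t \<ge> 0"
    have int: "F integrable_on {0..t + T}"
      by (rule integrable_continuous_interval[OF continuous_on_subset[OF F(1)]]) auto
    have "H t + integral {t..t + T} F = H (t + T)"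
      unfolding H_def
      by (rule Henstock_Kurzweil_Integration.integral_combine[OF _ _ int]) (use t T in auto)
    then have eq: "H (t + T) - H t - T * F t = integral {t..t + T} F - T * F t" by simp
    have J1: "((\<lambda>s. J (s + T)) has_real_derivative H (t + T)) (at t within {0..})"
      by (rule halfline_shift_derivative[OF J]) (use t T in auto)
    show "(Q has_real_derivative integral {t..t + T} F - T * F t) (at t within {0..})"
      unfolding Q_def eq[symmetric] by (intro DERIV_diff J1 J[OF t] DERIV_cmult H[OF t])
  qed
qed

section \<open>Gram matrices over a sliding window\<close>

lemma gram_form:
  fixes R :: "real mat"
  assumes "R \<in> carrier_mat n q" "v \<in> carrier_vec q"
  shows "(R *\<^sub>v v) \<bullet> (R *\<^sub>v v) =
    (\<Sum>j=0..<q. \<Sum>k=0..<q. v $ j * v $ k * (\<Sum>i=0..<n. R $$ (i, j) * R $$ (i, k)))"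
proof -
  have "(R *\<^sub>v v) \<bullet> (R *\<^sub>v v) =
      (\<Sum>i=0..<n. (\<Sum>j=0..<q. R $$ (i, j) * v $ j) * (\<Sum>k=0..<q. R $$ (i, k) * v $ k))"
    using assms by (simp add: scalar_prod_def)
  also have "\<dots> = (\<Sum>i=0..<n. \<Sum>j=0..<q. \<Sum>k=0..<q. v $ j * v $ k * (R $$ (i, j) * R $$ (i, k)))"
    by (simp add: sum_product ac_simps)
  also have "\<dots> = (\<Sum>j=0..<q. \<Sum>i=0..<n. \<Sum>k=0..<q. v $ j * v $ k * (R $$ (i, j) * R $$ (i, k)))"
    by (rule sum.swap)
  also have "\<dots> = (\<Sum>j=0..<q. \<Sum>k=0..<q. \<Sum>i=0..<n. v $ j * v $ k * (R $$ (i, j) * R $$ (i, k)))"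
    by (intro sum.cong refl sum.swap)
  finally show ?thesis by (simp add: sum_distrib_left)
qed

lemma quadratic_form_sum:
  fixes A :: "real mat"
  assumes "A \<in> carrier_mat q q" "v \<in> carrier_vec q"
  shows "v \<bullet> (A *\<^sub>v v) = (\<Sum>j=0..<q. \<Sum>k=0..<q. v $ j * v $ k * A $$ (j, k))"
  using assms by (simp add: scalar_prod_def sum_distrib_left ac_simps)

lemma has_mat_rate_carrier:
  "has_mat_rate nr nc W W' \<Longrightarrow> t \<ge> 0 \<Longrightarrow> W t \<in> carrier_mat nr nc"
  unfolding has_mat_rate_def by blast

lemma has_mat_rate_continuous_on:
  assumes "has_mat_rate nr nc W W'" "i < nr" "j < nc"
  shows "continuous_on {0..} (\<lambda>t. W t $$ (i, j))"
  by (rule DERIV_continuous_on[where D = "\<lambda>t. W' t $$ (i, j)"])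
    (use assms in \<open>simp add: has_mat_rate_def\<close>)

text \<open>The scalar window primitive is taken for each entry of the Gram matrix of
  \<open>R\<close>. The vector \<open>v\<close> is constant under the integral but arbitrary at
  every \<open>t\<close>, so the identity may later be applied to the state at time
  \<open>t\<close>, frozen over the window.\<close>

lemma gram_window:
  assumes R: "has_mat_rate n q R R'" "bdd_mat n q R" and T: "T > 0"
  obtains Q Q' where "has_mat_rate q q Q Q'" "bdd_mat q q Q"
    "\<And>t v. t \<ge> 0 \<Longrightarrow> v \<in> carrier_vec q \<Longrightarrow> v \<bullet> (Q' t *\<^sub>v v) =
       integral {t..t + T} (\<lambda>\<tau>. (R \<tau> *\<^sub>v v) \<bullet> (R \<tau> *\<^sub>v v)) - T * ((R t *\<^sub>v v) \<bullet> (R t *\<^sub>v v))"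
proof -
  define F where "F = (\<lambda>j k \<tau>. \<Sum>i=0..<n. R \<tau> $$ (i, j) * R \<tau> $$ (i, k))"
  have contF: "continuous_on {0..} (F j k)" if "j < q" "k < q" for j k
    unfolding F_def using that
    by (intro continuous_intros has_mat_rate_continuous_on[OF R(1)]) auto
  have bddF: "bdd_fn (F j k)" if "j < q" "k < q" for j k
    unfolding F_def using that R(2) by (intro bdd_fn_sum bdd_fn_mult) (auto simp: bdd_mat_def)
  have "\<exists>Q. bdd_fn Q \<and> (\<forall>t\<ge>0. (Q has_real_derivative integral {t..t + T} (F j k) - T * F j k t)
      (at t within {0..}))" if "j < q" "k < q" for j k
    by (rule window_primitive[OF contF[OF that] bddF[OF that] T]) blast
  then obtain Qf where Qf: "\<And>j k. j < q \<Longrightarrow> k < q \<Longrightarrow> bdd_fn (Qf j k)"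
    "\<And>j k t. j < q \<Longrightarrow> k < q \<Longrightarrow> t \<ge> 0 \<Longrightarrow>
      (Qf j k has_real_derivative integral {t..t + T} (F j k) - T * F j k t) (at t within {0..})"
    by metis
  define Q where "Q = (\<lambda>t. mat q q (\<lambda>(j, k). Qf j k t))"
  define Q' where "Q' = (\<lambda>t. mat q q (\<lambda>(j, k). integral {t..t + T} (F j k) - T * F j k t))"
  show ?thesis
  proof (rule that[of Q Q'])
    show "has_mat_rate q q Q Q'" unfolding has_mat_rate_def Q_def Q'_def using Qf(2) by simp
    show "bdd_mat q q Q" unfolding bdd_mat_def Q_def using Qf(1) by simp
    fix t :: real and v :: "real vec" assume t: "t \<ge> 0" and v: "v \<in> carrier_vec q"
    have int: "F j k integrable_on {t..t + T}" if "j < q" "k < q" for j k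
      by (rule integrable_continuous_interval[OF continuous_on_subset[OF contF[OF that]]]) (use t in auto)
    have "integral {t..t + T} (\<lambda>\<tau>. (R \<tau> *\<^sub>v v) \<bullet> (R \<tau> *\<^sub>v v)) =
        integral {t..t + T} (\<lambda>\<tau>. \<Sum>j=0..<q. \<Sum>k=0..<q. v $ j * v $ k * F j k \<tau>)"
    proof (rule integral_cong)
      fix \<tau> assume "\<tau> \<in> {t..t + T}"
      then have "R \<tau> \<in> carrier_mat n q" using t by (intro has_mat_rate_carrier[OF R(1)]) auto
      then show "(R \<tau> *\<^sub>v v) \<bullet> (R \<tau> *\<^sub>v v) = (\<Sum>j=0..<q. \<Sum>k=0..<q. v $ j * v $ k * F j k \<tau>)"
        unfolding F_def by (rule gram_form[OF _ v])
    qed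
    also have "\<dots> = (\<Sum>j=0..<q. \<Sum>k=0..<q. v $ j * v $ k * integral {t..t + T} (F j k))"
      using int
      by (subst integral_sum, simp, fastforce intro!: integrable_sum integrable_on_mult_right)
        (intro sum.cong refl, subst integral_sum, auto intro!: integrable_on_mult_right sum.cong)
    finally have I: "integral {t..t + T} (\<lambda>\<tau>. (R \<tau> *\<^sub>v v) \<bullet> (R \<tau> *\<^sub>v v)) =
        (\<Sum>j=0..<q. \<Sum>k=0..<q. v $ j * v $ k * integral {t..t + T} (F j k))" .
    have "(R t *\<^sub>v v) \<bullet> (R t *\<^sub>v v) = (\<Sum>j=0..<q. \<Sum>k=0..<q. v $ j * v $ k * F j k t)"
      unfolding F_def by (rule gram_form[OF has_mat_rate_carrier[OF R(1) t] v])
    moreover have "v \<bullet> (Q' t *\<^sub>v v) = (\<Sum>j=0..<q. \<Sum>k=0..<q. v $ j * v $ k * Q' t $$ (j, k))"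
      by (rule quadratic_form_sum[OF _ v]) (simp add: Q'_def)
    ultimately show "v \<bullet> (Q' t *\<^sub>v v) =
        integral {t..t + T} (\<lambda>\<tau>. (R \<tau> *\<^sub>v v) \<bullet> (R \<tau> *\<^sub>v v)) - T * ((R t *\<^sub>v v) \<bullet> (R t *\<^sub>v v))"
      unfolding I by (simp add: Q'_def sum_distrib_left right_diff_distrib sum_subtractf ac_simps)
  qed
qed

lemma abs_bilinear_le:
  fixes x y :: "real vec"
  assumes "x \<in> carrier_vec n" "y \<in> carrier_vec n" "eucl_norm x \<le> a * eucl_norm v"
    "eucl_norm y \<le> c * eucl_norm w" "a \<ge> 0"
  shows "\<bar>x \<bullet> y\<bar> \<le> a * c * (eucl_norm v * eucl_norm w)"
proof -
  have "\<bar>x \<bullet> y\<bar> \<le> eucl_norm x * eucl_norm y" by (rule abs_scalar_prod_le[OF assms(1,2)])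
  also have "\<dots> \<le> (a * eucl_norm v) * (c * eucl_norm w)"
    using assms by (intro mult_mono) auto
  finally show ?thesis by (simp add: ac_simps)
qed

section \<open>Exponential convergence under excitation\<close>

context adaptive_error
begin

text \<open>Strict Lyapunov function: a large multiple of the Lyapunov function of the nominal error
  system, the cross term \<open>T e \<bullet> R \<theta>\<close>, whose derivative contributes \<open>- T |R \<theta>|\<^sup>2\<close>, and
  \<open>- \<theta> \<bullet> Q \<theta>\<close>, which trades this for the window integral controlled by persistent excitation.\<close>

lemma exponential_decay:
  assumes R: "has_mat_rate n q R R'" "bdd_mat n q R" "bdd_mat n q R'"
    and WR: "exp_decay_mat n q (\<lambda>t. W t - R t)"
    and \<alpha>: "\<alpha> > 0" and T: "T > 0"
    and pe: "\<And>t v. t \<ge> 0 \<Longrightarrow> v \<in> carrier_vec q \<Longrightarrow>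
      \<alpha> * (v \<bullet> v) \<le> integral {t..t + T} (\<lambda>\<tau>. (R \<tau> *\<^sub>v v) \<bullet> (R \<tau> *\<^sub>v v))"
  shows "exp_decay (\<lambda>t. eucl_norm (e t))" "exp_decay (\<lambda>t. eucl_norm (\<theta> t))"
proof -
  note Rcar = bdd_mat_carrier[OF R(2)] and R'car = bdd_mat_carrier[OF R(3)]
  obtain Q Q' where Q: "has_mat_rate q q Q Q'" "bdd_mat q q Q"
    "\<And>t v. t \<ge> 0 \<Longrightarrow> v \<in> carrier_vec q \<Longrightarrow> v \<bullet> (Q' t *\<^sub>v v) =
       integral {t..t + T} (\<lambda>\<tau>. (R \<tau> *\<^sub>v v) \<bullet> (R \<tau> *\<^sub>v v)) - T * ((R t *\<^sub>v v) \<bullet> (R t *\<^sub>v v))"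
    by (fact gram_window[OF R(1,2) T])
  note Qcar = bdd_mat_carrier[OF Q(2)]
  have Q'car: "Q' t \<in> carrier_mat q q" if "t \<ge> 0" for t
    using Q(1) that unfolding has_mat_rate_def by blast
  \<comment> \<open>The error equation is rewritten with \<open>R\<close>, for which excitation is
    assumed. The mismatch is decaying times bounded, since \<open>\<theta>\<close> is already known
    to be bounded, so it can be counted as perturbation.\<close>
  define b2 where "b2 = (\<lambda>t. (W t - R t) *\<^sub>v \<theta> t + b t)"
  have WRcar: "(W t - R t) *\<^sub>v \<theta> t \<in> carrier_vec n" if "t \<ge> 0" for t
    by (rule mult_mat_vec_carrier[OF minus_carrier_mat[OF Rcar[OF that]] \<theta>_carrier[OF that]])
  have b2car: "b2 t \<in> carrier_vec n" if "t \<ge> 0" for t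
    unfolding b2_def by (rule add_carrier_vec[OF WRcar[OF that] b_carrier[OF that]])
  have b2: "exp_decay (\<lambda>t. eucl_norm (b2 t))"
    unfolding b2_def
    by (rule exp_decay_eucl_norm_add[OF exp_decay_mult_mat_vec[OF WR bdd_states(2) \<theta>_carrier] b_decay WRcar b_carrier])
  have R\<theta>car: "R t *\<^sub>v \<theta> t \<in> carrier_vec n" if "t \<ge> 0" for t
    by (rule mult_mat_vec_carrier[OF Rcar[OF that] \<theta>_carrier[OF that]])
  have e'_eq: "e' t = K *\<^sub>v e t - R t *\<^sub>v \<theta> t - b2 t" if t: "t \<ge> 0" for t
  proof -
    have "(W t - R t) *\<^sub>v \<theta> t = W t *\<^sub>v \<theta> t - R t *\<^sub>v \<theta> t"
      by (rule minus_mult_distrib_mat_vec[OF W_carrier[OF t] Rcar[OF t] \<theta>_carrier[OF t]])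
    then show ?thesis
      using carrier_vecD[OF W\<theta>_carrier[OF t]] carrier_vecD[OF R\<theta>car[OF t]] carrier_vecD[OF b_carrier[OF t]]
        carrier_vecD[OF Ke_carrier[OF t]]
      unfolding b2_def by (intro eq_vecI) (simp_all del: index_mult_mat_vec dim_mult_mat_vec)
  qed
  obtain lo hi V where V: "lo > 0" "hi > 0"
    "\<And>t. t \<ge> 0 \<Longrightarrow> (V has_real_derivative - (e t \<bullet> e t) - 2 * ((P *\<^sub>v e t) \<bullet> b t)) (at t within {0..})"
    "\<And>t. t \<ge> 0 \<Longrightarrow> lo * (e t \<bullet> e t + \<theta> t \<bullet> \<theta> t) \<le> V t"
    "\<And>t. t \<ge> 0 \<Longrightarrow> V t \<le> hi * (e t \<bullet> e t + \<theta> t \<bullet> \<theta> t)"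
    by (fact lyapunov_function)
  obtain CK where CK: "CK > 0" "\<And>t (v :: real vec). (t::real) \<ge> 0 \<Longrightarrow> v \<in> carrier_vec n \<Longrightarrow> eucl_norm (K *\<^sub>v v) \<le> CK * eucl_norm v"
    by (fact bdd_mat_operator_bound[OF bdd_mat_const[OF K_carrier]])
  obtain CR where CR: "CR > 0" "\<And>t (v :: real vec). t \<ge> 0 \<Longrightarrow> v \<in> carrier_vec q \<Longrightarrow> eucl_norm (R t *\<^sub>v v) \<le> CR * eucl_norm v"
    by (fact bdd_mat_operator_bound[OF R(2)])
  obtain CR' where CR': "CR' > 0" "\<And>t (v :: real vec). t \<ge> 0 \<Longrightarrow> v \<in> carrier_vec q \<Longrightarrow> eucl_norm (R' t *\<^sub>v v) \<le> CR' * eucl_norm v"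
    by (fact bdd_mat_operator_bound[OF R(3)])
  obtain CQ where CQ: "CQ > 0" "\<And>t (v :: real vec). t \<ge> 0 \<Longrightarrow> v \<in> carrier_vec q \<Longrightarrow> eucl_norm (Q t *\<^sub>v v) \<le> CQ * eucl_norm v"
    by (fact bdd_mat_operator_bound[OF Q(2)])
  obtain CD where CD: "CD > 0" "\<And>t (v :: real vec). t \<ge> 0 \<Longrightarrow> v \<in> carrier_vec n \<Longrightarrow> eucl_norm ((\<Lambda> * (W t)\<^sup>T * P) *\<^sub>v v) \<le> CD * eucl_norm v"
    by (fact bdd_mat_operator_bound[OF gain_bdd])
  \<comment> \<open>With \<open>x = |e|\<close> and \<open>y = |\<theta>|\<close>: \<open>c1\<close>
    collects the coefficients of \<open>x * y\<close> in the derivative and \<open>c2\<close> that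
    of \<open>x^2\<close> from the cross term; \<open>m\<close> bounds the indefinite part of the
    function itself.\<close>
  define c1 where "c1 = T * (CK * CR + CR') + 2 * (CD * CQ)"
  define c2 where "c2 = T * (CR * CD)"
  define m where "m = T * CR + CQ"
  have pos: "c1 > 0" "c2 > 0" "m > 0"
    using T CK CR CR' CQ CD by (auto simp: c1_def c2_def m_def intro!: add_pos_pos mult_pos_pos)
  \<comment> \<open>The first entry pays for \<open>c2\<close> and for the square completed against
    \<open>c1 * (x * y)\<close>, and leaves \<open>\<alpha> / 2\<close> over; the second makes the
    positive part exceed the indefinite part by one unit of \<open>x^2 + y^2\<close>.\<close>
  define L where "L = max (\<alpha> / 2 + c1\<^sup>2 / (2 * \<alpha>) + c2) ((m + 1) / lo)"
  have L: "L \<ge> \<alpha> / 2 + c1\<^sup>2 / (2 * \<alpha>) + c2" "L * lo \<ge> m + 1" "L > 0"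
  proof -
    show L1: "L \<ge> \<alpha> / 2 + c1\<^sup>2 / (2 * \<alpha>) + c2" by (simp add: L_def)
    have "L \<ge> (m + 1) / lo" by (simp add: L_def)
    then show "L * lo \<ge> m + 1" using V(1) by (simp add: pos_divide_le_eq)
    have "0 < \<alpha> / 2 + c1\<^sup>2 / (2 * \<alpha>) + c2" using \<alpha> pos by (intro add_pos_pos) auto
    then show "L > 0" using L1 by linarith
  qed
  define U where "U = (\<lambda>t. L * V t + T * (e t \<bullet> (R t *\<^sub>v \<theta> t)) - \<theta> t \<bullet> (Q t *\<^sub>v \<theta> t))"
  define U' where "U' = (\<lambda>t. L * (- (e t \<bullet> e t) - 2 * ((P *\<^sub>v e t) \<bullet> b t))
      + T * (e' t \<bullet> (R t *\<^sub>v \<theta> t) + e t \<bullet> (R' t *\<^sub>v \<theta> t + R t *\<^sub>v \<theta>' t))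
      - (\<theta>' t \<bullet> (Q t *\<^sub>v \<theta> t) + \<theta> t \<bullet> (Q' t *\<^sub>v \<theta> t + Q t *\<^sub>v \<theta>' t)))"
  \<comment> \<open>All terms of the derivative containing \<open>b\<close> or \<open>b2\<close>:
    each is a decaying factor times a bounded one, so they need no sign.\<close>
  define g where "g = (\<lambda>t. - 2 * L * ((P *\<^sub>v e t) \<bullet> b t) - T * (b2 t \<bullet> (R t *\<^sub>v \<theta> t)))"
  define s where "s = (\<lambda>t. (eucl_norm (e t))\<^sup>2 + (eucl_norm (\<theta> t))\<^sup>2)"
  have R'\<theta>car: "R' t *\<^sub>v \<theta> t \<in> carrier_vec n" if "t \<ge> 0" for t
    by (rule mult_mat_vec_carrier[OF R'car[OF that] \<theta>_carrier[OF that]])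
  have R\<theta>'car: "R t *\<^sub>v \<theta>' t \<in> carrier_vec n" if "t \<ge> 0" for t
    by (rule mult_mat_vec_carrier[OF Rcar[OF that] \<theta>'_carrier[OF that]])
  have Q\<theta>car: "Q t *\<^sub>v \<theta> t \<in> carrier_vec q" if "t \<ge> 0" for t
    by (rule mult_mat_vec_carrier[OF Qcar[OF that] \<theta>_carrier[OF that]])
  have Q'\<theta>car: "Q' t *\<^sub>v \<theta> t \<in> carrier_vec q" if "t \<ge> 0" for t
    by (rule mult_mat_vec_carrier[OF Q'car[OF that] \<theta>_carrier[OF that]])
  have Q\<theta>'car: "Q t *\<^sub>v \<theta>' t \<in> carrier_vec q" if "t \<ge> 0" for t
    by (rule mult_mat_vec_carrier[OF Qcar[OF that] \<theta>'_carrier[OF that]])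
  have U_der: "(U has_real_derivative U' t) (at t within {0..})" if t: "t \<ge> 0" for t
    unfolding U_def U'_def
    by (intro DERIV_diff DERIV_add DERIV_cmult V(3)[OF t]
        scalar_prod_has_derivative[OF e_rate has_rate_mult_mat_vec[OF R(1) \<theta>_rate \<theta>'_carrier] _ t]
        scalar_prod_has_derivative[OF \<theta>_rate has_rate_mult_mat_vec[OF Q(1) \<theta>_rate \<theta>'_carrier] _ t]
        add_carrier_vec R'\<theta>car R\<theta>'car Q'\<theta>car Q\<theta>'car t)
  have g: "exp_decay g"
  proof -
    have Pe: "bdd_fn (\<lambda>t. eucl_norm (P *\<^sub>v e t))"
      by (rule bdd_fn_mult_mat_vec[OF bdd_mat_const[OF P_carrier] bdd_states(1) e_carrier])
    have R\<theta>: "bdd_fn (\<lambda>t. eucl_norm (R t *\<^sub>v \<theta> t))"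
      by (rule bdd_fn_mult_mat_vec[OF R(2) bdd_states(2) \<theta>_carrier])
    have "exp_decay (\<lambda>t. b t \<bullet> (P *\<^sub>v e t))"
      by (rule exp_decay_scalar_prod[OF b_decay Pe b_carrier Pe_carrier])
    then have 1: "exp_decay (\<lambda>t. (P *\<^sub>v e t) \<bullet> b t)"
      by (rule exp_decay_cong[THEN iffD1, rotated]) (rule comm_scalar_prod[OF b_carrier Pe_carrier])
    have 2: "exp_decay (\<lambda>t. b2 t \<bullet> (R t *\<^sub>v \<theta> t))"
      by (rule exp_decay_scalar_prod[OF b2 R\<theta> b2car R\<theta>car])
    show ?thesis unfolding g_def by (intro exp_decay_diff exp_decay_mult_right bdd_fn_const 1 2)
  qed
  have bounds: "s t \<le> U t" "U t \<le> (L * hi + m) * s t" "U' t \<le> - (\<alpha> / 2) * s t + g t" if t: "t \<ge> 0" for t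
  proof -
    define x y where "x = eucl_norm (e t)" and "y = eucl_norm (\<theta> t)"
    have xy: "x \<ge> 0" "y \<ge> 0" by (auto simp: x_def y_def)
    have ee: "e t \<bullet> e t = x\<^sup>2" "\<theta> t \<bullet> \<theta> t = y\<^sup>2" by (simp_all add: x_def y_def scalar_prod_self)
    note ec = e_carrier[OF t] and \<theta>c = \<theta>_carrier[OF t]
    have nK: "eucl_norm (K *\<^sub>v e t) \<le> CK * x" unfolding x_def by (rule CK(2)[OF t ec])
    have nR: "eucl_norm (R t *\<^sub>v \<theta> t) \<le> CR * y" unfolding y_def by (rule CR(2)[OF t \<theta>c])
    have nR': "eucl_norm (R' t *\<^sub>v \<theta> t) \<le> CR' * y" unfolding y_def by (rule CR'(2)[OF t \<theta>c])
    have nQ: "eucl_norm (Q t *\<^sub>v \<theta> t) \<le> CQ * y" unfolding y_def by (rule CQ(2)[OF t \<theta>c])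
    have nD: "eucl_norm (\<theta>' t) \<le> CD * x" unfolding x_def by (rule CD(2)[OF t ec])
    have nRD: "eucl_norm (R t *\<^sub>v \<theta>' t) \<le> (CR * CD) * x"
      using order_trans[OF CR(2)[OF t \<theta>'_carrier[OF t]] mult_left_mono[OF nD less_imp_le[OF CR(1)]]]
      by (simp only: mult.assoc)
    have nQD: "eucl_norm (Q t *\<^sub>v \<theta>' t) \<le> (CQ * CD) * x"
      using order_trans[OF CQ(2)[OF t \<theta>'_carrier[OF t]] mult_left_mono[OF nD less_imp_le[OF CQ(1)]]]
      by (simp only: mult.assoc)
    have t1: "\<bar>(K *\<^sub>v e t) \<bullet> (R t *\<^sub>v \<theta> t)\<bar> \<le> CK * CR * (x * y)"
      unfolding x_def y_def
      by (rule abs_bilinear_le[OF Ke_carrier[OF t] R\<theta>car[OF t] nK[unfolded x_def] nR[unfolded y_def]])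
        (use CK in simp)
    have t2: "\<bar>e t \<bullet> (R' t *\<^sub>v \<theta> t)\<bar> \<le> 1 * CR' * (x * y)"
      unfolding x_def y_def
      by (rule abs_bilinear_le[OF ec R'\<theta>car[OF t] _ nR'[unfolded y_def]]) auto
    have t3: "\<bar>e t \<bullet> (R t *\<^sub>v \<theta>' t)\<bar> \<le> 1 * (CR * CD) * (x * x)"
      unfolding x_def
      by (rule abs_bilinear_le[OF ec R\<theta>'car[OF t] _ nRD[unfolded x_def]]) auto
    have t4: "\<bar>\<theta>' t \<bullet> (Q t *\<^sub>v \<theta> t)\<bar> \<le> CD * CQ * (x * y)"
      unfolding x_def y_def
      by (rule abs_bilinear_le[OF \<theta>'_carrier[OF t] Q\<theta>car[OF t] nD[unfolded x_def] nQ[unfolded y_def]])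
        (use CD in simp)
    have t5: "\<bar>\<theta> t \<bullet> (Q t *\<^sub>v \<theta>' t)\<bar> \<le> 1 * (CQ * CD) * (y * x)"
      unfolding x_def y_def
      by (rule abs_bilinear_le[OF \<theta>c Q\<theta>'car[OF t] _ nQD[unfolded x_def]]) auto
    have t6: "\<bar>e t \<bullet> (R t *\<^sub>v \<theta> t)\<bar> \<le> 1 * CR * (x * y)"
      unfolding x_def y_def
      by (rule abs_bilinear_le[OF ec R\<theta>car[OF t] _ nR[unfolded y_def]]) auto
    have t7: "\<bar>\<theta> t \<bullet> (Q t *\<^sub>v \<theta> t)\<bar> \<le> 1 * CQ * (y * y)"
      unfolding y_def
      by (rule abs_bilinear_le[OF \<theta>c Q\<theta>car[OF t] _ nQ[unfolded y_def]]) auto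
    have pe_t: "\<alpha> * y\<^sup>2 \<le> \<theta> t \<bullet> (Q' t *\<^sub>v \<theta> t) + T * ((R t *\<^sub>v \<theta> t) \<bullet> (R t *\<^sub>v \<theta> t))"
      unfolding Q(3)[OF t \<theta>c] using pe[OF t \<theta>c] by (simp add: ee)
    have e1: "e' t \<bullet> (R t *\<^sub>v \<theta> t) = (K *\<^sub>v e t) \<bullet> (R t *\<^sub>v \<theta> t) - (R t *\<^sub>v \<theta> t) \<bullet> (R t *\<^sub>v \<theta> t) - b2 t \<bullet> (R t *\<^sub>v \<theta> t)"
      unfolding e'_eq[OF t]
      using Ke_carrier[OF t] R\<theta>car[OF t] b2car[OF t] by (simp add: minus_scalar_prod_distrib[of _ n])
    have e2: "e t \<bullet> (R' t *\<^sub>v \<theta> t + R t *\<^sub>v \<theta>' t) = e t \<bullet> (R' t *\<^sub>v \<theta> t) + e t \<bullet> (R t *\<^sub>v \<theta>' t)"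
      by (rule scalar_prod_add_distrib[OF ec R'\<theta>car[OF t] R\<theta>'car[OF t]])
    have e3: "\<theta> t \<bullet> (Q' t *\<^sub>v \<theta> t + Q t *\<^sub>v \<theta>' t) = \<theta> t \<bullet> (Q' t *\<^sub>v \<theta> t) + \<theta> t \<bullet> (Q t *\<^sub>v \<theta>' t)"
      by (rule scalar_prod_add_distrib[OF \<theta>c Q'\<theta>car[OF t] Q\<theta>'car[OF t]])
    have s_t: "s t = x\<^sup>2 + y\<^sup>2" by (simp add: s_def x_def y_def)
    have xy2: "x * y \<le> x\<^sup>2 + y\<^sup>2"
      using zero_le_power2[of "x - y"] mult_nonneg_nonneg[OF xy] by (simp add: power2_diff)
    have cross: "\<bar>T * (e t \<bullet> (R t *\<^sub>v \<theta> t)) - \<theta> t \<bullet> (Q t *\<^sub>v \<theta> t)\<bar> \<le> m * s t"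
    proof -
      have "\<bar>T * (e t \<bullet> (R t *\<^sub>v \<theta> t)) - \<theta> t \<bullet> (Q t *\<^sub>v \<theta> t)\<bar>
          \<le> T * \<bar>e t \<bullet> (R t *\<^sub>v \<theta> t)\<bar> + \<bar>\<theta> t \<bullet> (Q t *\<^sub>v \<theta> t)\<bar>"
        using abs_triangle_ineq4[of "T * (e t \<bullet> (R t *\<^sub>v \<theta> t))"] T by (simp only: abs_mult) simp
      also have "\<dots> \<le> T * (CR * (x * y)) + CQ * (y * y)"
        using t6 t7 T by (intro add_mono mult_left_mono) auto
      also have "\<dots> \<le> T * (CR * (x\<^sup>2 + y\<^sup>2)) + CQ * (x\<^sup>2 + y\<^sup>2)"
        using xy2 T CR(1) CQ(1) by (intro add_mono mult_left_mono) (auto simp: power2_eq_square)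
      finally show ?thesis by (simp add: s_t m_def algebra_simps)
    qed
    have "L * (lo * s t) \<le> L * V t"
      using V(4)[OF t] L(3) by (intro mult_left_mono) (auto simp: s_t ee)
    moreover have "(m + 1) * s t \<le> (L * lo) * s t"
      using L(2) by (intro mult_right_mono) (auto simp: s_t)
    ultimately show "s t \<le> U t"
      using abs_le_D2[OF cross] unfolding U_def by (simp add: algebra_simps)
    have "L * V t \<le> L * (hi * s t)"
      using V(5)[OF t] L(3) by (intro mult_left_mono) (auto simp: s_t ee)
    then show "U t \<le> (L * hi + m) * s t"
      using abs_le_D1[OF cross] unfolding U_def by (simp add: algebra_simps)
    \<comment> \<open>The term \<open>- T |R \<theta>|^2\<close> from the cross term is grouped with
      the derivative of \<open>Q\<close>; together they form minus the window integral, which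
      excitation bounds.\<close>
    have "U' t = - L * x\<^sup>2 + g t + T * ((K *\<^sub>v e t) \<bullet> (R t *\<^sub>v \<theta> t) + e t \<bullet> (R' t *\<^sub>v \<theta> t) + e t \<bullet> (R t *\<^sub>v \<theta>' t))
        - \<theta>' t \<bullet> (Q t *\<^sub>v \<theta> t) - \<theta> t \<bullet> (Q t *\<^sub>v \<theta>' t)
        - (\<theta> t \<bullet> (Q' t *\<^sub>v \<theta> t) + T * ((R t *\<^sub>v \<theta> t) \<bullet> (R t *\<^sub>v \<theta> t)))"
      unfolding U'_def g_def e1 e2 e3 ee by (simp add: algebra_simps)
    also have "\<dots> \<le> - L * x\<^sup>2 + g t + T * (CK * CR * (x * y) + CR' * (x * y) + (CR * CD) * (x * x))
        + CD * CQ * (x * y) + (CQ * CD) * (y * x) - \<alpha> * y\<^sup>2"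
    proof -
      have "T * ((K *\<^sub>v e t) \<bullet> (R t *\<^sub>v \<theta> t) + e t \<bullet> (R' t *\<^sub>v \<theta> t) + e t \<bullet> (R t *\<^sub>v \<theta>' t))
          \<le> T * (CK * CR * (x * y) + CR' * (x * y) + (CR * CD) * (x * x))"
        using abs_le_D1[OF t1] abs_le_D1[OF t2] abs_le_D1[OF t3] T
        by (intro mult_left_mono add_mono) auto
      then show ?thesis using abs_le_D2[OF t4] abs_le_D2[OF t5] pe_t by linarith
    qed
    also have "\<dots> = - L * x\<^sup>2 + g t + c1 * (x * y) + c2 * x\<^sup>2 - \<alpha> * y\<^sup>2"
      by (simp add: c1_def c2_def power2_eq_square algebra_simps)
    also have "c1 * (x * y) = (c1\<^sup>2 / (2 * \<alpha>)) * x\<^sup>2 + (\<alpha> / 2) * y\<^sup>2 - (c1 * x - \<alpha> * y)\<^sup>2 / (2 * \<alpha>)"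
      using \<alpha> by (simp add: power2_eq_square field_simps)
    also have "- L * x\<^sup>2 + g t + ((c1\<^sup>2 / (2 * \<alpha>)) * x\<^sup>2 + (\<alpha> / 2) * y\<^sup>2 - (c1 * x - \<alpha> * y)\<^sup>2 / (2 * \<alpha>)) + c2 * x\<^sup>2 - \<alpha> * y\<^sup>2
        \<le> - (\<alpha> / 2 + c1\<^sup>2 / (2 * \<alpha>) + c2) * x\<^sup>2 + g t + ((c1\<^sup>2 / (2 * \<alpha>)) * x\<^sup>2 + (\<alpha> / 2) * y\<^sup>2) + c2 * x\<^sup>2 - \<alpha> * y\<^sup>2"
    proof -
      have "(\<alpha> / 2 + c1\<^sup>2 / (2 * \<alpha>) + c2) * x\<^sup>2 \<le> L * x\<^sup>2" using L(1) by (intro mult_right_mono) auto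
      moreover have "0 \<le> (c1 * x - \<alpha> * y)\<^sup>2 / (2 * \<alpha>)" using \<alpha> by simp
      ultimately show ?thesis by linarith
    qed
    also have "\<dots> = - (\<alpha> / 2) * s t + g t" by (simp add: s_t algebra_simps)
    finally show "U' t \<le> - (\<alpha> / 2) * s t + g t" .
  qed
  have Lhm: "L * hi + m > 0" using L(3) V(2) pos by (intro add_pos_pos mult_pos_pos)
  have sU: "exp_decay U"
  proof (rule exp_decay_of_diff_ineq[OF U_der _ _ _ g])
    show "0 < \<alpha> / 2 / (L * hi + m)" using \<alpha> Lhm by simp
    fix t :: real assume t: "t \<ge> 0"
    have "0 \<le> s t" by (simp add: s_def)
    then show "0 \<le> U t" using bounds(1)[OF t] by linarith
    have "(\<alpha> / 2 / (L * hi + m)) * U t \<le> (\<alpha> / 2 / (L * hi + m)) * ((L * hi + m) * s t)"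
      using bounds(2)[OF t] \<alpha> Lhm by (intro mult_left_mono) auto
    also have "\<dots> = (\<alpha> / 2) * s t" using less_imp_neq[OF Lhm] by (metis nonzero_eq_divide_eq mult.assoc)
    finally show "U' t \<le> - (\<alpha> / 2 / (L * hi + m)) * U t + g t"
      using bounds(3)[OF t] unfolding minus_mult_left[symmetric] by linarith
  qed
  have le: "(eucl_norm (e t))\<^sup>2 \<le> \<bar>U t\<bar>" "(eucl_norm (\<theta> t))\<^sup>2 \<le> \<bar>U t\<bar>" if "t \<ge> 0" for t
    using bounds(1)[OF that] zero_le_power2[of "eucl_norm (e t)"] zero_le_power2[of "eucl_norm (\<theta> t)"]
    unfolding s_def by linarith+
  show "exp_decay (\<lambda>t. eucl_norm (e t))"
    by (rule exp_decay_norm_power2, rule exp_decay_mono[OF sU]) (simp add: le)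
  show "exp_decay (\<lambda>t. eucl_norm (\<theta> t))"
    by (rule exp_decay_norm_power2, rule exp_decay_mono[OF sU]) (simp add: le)
qed

end

section \<open>Hurwitz matrices and trigonometric polynomials\<close>

text \<open>\<open>|z|^2\<close> has derivative
  \<open>2 * Re c * |z|^2 + 2 * Re (cnj z * g)\<close>. Half of the dissipation absorbs the product
  by Young's inequality, leaving rate \<open>a = - Re c\<close> and an input
  \<open>|g|^2 / a\<close>. Real and imaginary parts are differentiated separately so that the real
  half-line estimates apply.\<close>

lemma complex_scalar_decay:
  fixes z z' g :: "real \<Rightarrow> complex"
  assumes re: "\<And>t. t \<ge> 0 \<Longrightarrow> ((\<lambda>s. Re (z s)) has_real_derivative Re (z' t)) (at t within {0..})"
    and im: "\<And>t. t \<ge> 0 \<Longrightarrow> ((\<lambda>s. Im (z s)) has_real_derivative Im (z' t)) (at t within {0..})"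
    and z': "\<And>t. t \<ge> 0 \<Longrightarrow> z' t = c * z t + g t"
    and c: "Re c < 0" and g: "exp_decay g"
  shows "exp_decay z"
proof (rule exp_decay_norm_power2)
  define a where "a = - Re c"
  have a: "a > 0" using c by (simp add: a_def)
  define v' where "v' = (\<lambda>t. 2 * (Re (z t) * Re (z' t) + Im (z t) * Im (z' t)))"
  have "exp_decay (\<lambda>t. (Re (z t))\<^sup>2 + (Im (z t))\<^sup>2)"
  proof (rule exp_decay_of_diff_ineq[OF _ _ a])
    show "exp_decay (\<lambda>t. (1 / a) * (norm (g t))\<^sup>2)"
      by (intro exp_decay_mult_right bdd_fn_const exp_decay_power2_norm g)
    fix t :: real assume t: "t \<ge> 0"
    show "((\<lambda>t. (Re (z t))\<^sup>2 + (Im (z t))\<^sup>2) has_real_derivative v' t) (at t within {0..})"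
      unfolding v'_def
      by (rule derivative_eq_intros re[OF t] im[OF t] refl)+ (simp add: algebra_simps)
    have "v' t = - 2 * a * ((Re (z t))\<^sup>2 + (Im (z t))\<^sup>2) + 2 * Re (cnj (z t) * g t)"
      unfolding v'_def z'[OF t] a_def by (simp add: power2_eq_square algebra_simps)
    also have "Re (cnj (z t) * g t) \<le> norm (z t) * norm (g t)"
      using complex_Re_le_cmod[of "cnj (z t) * g t"] by (simp add: norm_mult)
    also have "norm (z t) * norm (g t) = (a / 2) * (norm (z t))\<^sup>2 + (1 / (2 * a)) * (norm (g t))\<^sup>2
        - (a * norm (z t) - norm (g t))\<^sup>2 / (2 * a)"
      using a by (simp add: power2_eq_square field_simps)
    also have "(norm (z t))\<^sup>2 = (Re (z t))\<^sup>2 + (Im (z t))\<^sup>2" by (rule cmod_power2)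
    finally have "v' t \<le> - a * ((Re (z t))\<^sup>2 + (Im (z t))\<^sup>2) + (1 / a) * (norm (g t))\<^sup>2
        - (a * norm (z t) - norm (g t))\<^sup>2 / a"
      by (simp add: algebra_simps)
    moreover have "0 \<le> (a * norm (z t) - norm (g t))\<^sup>2 / a" using a by simp
    ultimately show "v' t \<le> - a * ((Re (z t))\<^sup>2 + (Im (z t))\<^sup>2) + (1 / a) * (norm (g t))\<^sup>2"
      by linarith
  qed simp
  then show "exp_decay (\<lambda>t. (norm (z t))\<^sup>2)" unfolding cmod_power2 .
qed

text \<open>In coordinates that triangularize \<open>A\<close> over the complex numbers, the components decay
  one after the other, starting with the last one.\<close>

lemma hurwitz_exp_decay:
  assumes A: "A \<in> carrier_mat n n" and hw: "hurwitz A" and x: "has_rate n x (\<lambda>t. A *\<^sub>v x t)"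
    and i: "i < n"
  shows "exp_decay (\<lambda>t. x t $ i)"
proof -
  let ?A = "complex_mat A"
  have cA: "?A \<in> carrier_mat n n" using A by simp
  obtain es where es: "char_poly ?A = (\<Prod>a\<leftarrow>es. [:- a, 1:])"
    using char_poly_factorized[OF cA] by blast
  obtain B P Q where BPQ: "schur_decomposition ?A es = (B, P, Q)"
    by (cases "schur_decomposition ?A es") auto
  have sd: "similar_mat_wit ?A B P Q" "upper_triangular B" "diag_mat B = es"
    using schur_decomposition[OF cA es BPQ] by auto
  note sim = similar_mat_witD2[OF cA sd(1)]
  note B = sim(5) and P = sim(6) and Q = sim(7)
  \<comment> \<open>The diagonal of the Schur form lists the roots of the characteristic polynomial,
    that is, the spectrum.\<close>
  have neg: "Re (B $$ (j, j)) < 0" if j: "j < n" for j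
  proof -
    have "B $$ (j, j) \<in> set es" using sd(3) B j unfolding diag_mat_def by auto
    then have "poly (char_poly ?A) (B $$ (j, j)) = 0"
      unfolding es by (simp add: poly_prod_list prod_list_zero_iff image_iff o_def)
    then have "B $$ (j, j) \<in> spectrum ?A" unfolding spectrum_root_char_poly[OF cA] by simp
    then show ?thesis using hw unfolding hurwitz_def by blast
  qed
  define X where "X = (\<lambda>t. map_vec complex_of_real (x t))"
  define y where "y = (\<lambda>t. Q *\<^sub>v X t)"
  have xcar: "x t \<in> carrier_vec n" if "t \<ge> 0" for t by (rule has_rate_carrier[OF x that])
  have Xcar: "X t \<in> carrier_vec n" if "t \<ge> 0" for t using xcar[OF that] by (simp add: X_def)
  have ycar: "y t \<in> carrier_vec n" if "t \<ge> 0" for t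
    unfolding y_def by (rule mult_mat_vec_carrier[OF Q Xcar[OF that]])
  have AX: "?A *\<^sub>v X t = map_vec complex_of_real (A *\<^sub>v x t)" if "t \<ge> 0" for t
    unfolding X_def by (rule of_real_hom.mult_mat_vec_hom[OF A xcar[OF that], symmetric])
  have By: "B *\<^sub>v y t = Q *\<^sub>v (?A *\<^sub>v X t)" if t: "t \<ge> 0" for t
  proof -
    have "Q * ?A = B * Q"
    proof -
      have "Q * ?A = Q * (P * (B * Q))" using sim(3) B P Q by (simp add: assoc_mult_mat[of _ n n _ n _ n])
      also have "\<dots> = (Q * P) * (B * Q)" using B P Q by (simp add: assoc_mult_mat[of _ n n _ n _ n])
      finally show ?thesis using sim(2) B Q by simp
    qed
    then have "(B * Q) *\<^sub>v X t = (Q * ?A) *\<^sub>v X t" by simp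
    then show ?thesis
      unfolding y_def assoc_mult_mat_vec[OF B Q Xcar[OF t]] assoc_mult_mat_vec[OF Q cA Xcar[OF t]] .
  qed
  have y_idx: "y t $ j = (\<Sum>k=0..<n. Q $$ (j, k) * complex_of_real (x t $ k))" if "t \<ge> 0" "j < n" for t j
    using xcar[OF that(1)] Q that by (simp add: y_def X_def scalar_prod_def)
  have By_idx: "(B *\<^sub>v y t) $ j = (\<Sum>k=0..<n. Q $$ (j, k) * complex_of_real ((A *\<^sub>v x t) $ k))"
    if "t \<ge> 0" "j < n" for t j
    unfolding By[OF that(1)] AX[OF that(1)]
    using A Q that xcar[OF that(1)] by (simp add: scalar_prod_def)
  \<comment> \<open>\<open>Q\<close> is constant and \<open>x\<close> is real, so the real and
    imaginary parts of \<open>y\<close> are real linear combinations of the components of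
    \<open>x\<close>.\<close>
  have y_re: "((\<lambda>s. Re (y s $ j)) has_real_derivative Re ((B *\<^sub>v y t) $ j)) (at t within {0..})"
    and y_im: "((\<lambda>s. Im (y s $ j)) has_real_derivative Im ((B *\<^sub>v y t) $ j)) (at t within {0..})"
    if t: "t \<ge> 0" and j: "j < n" for t j
  proof -
    have eqRe: "(\<Sum>k=0..<n. Re (Q $$ (j, k)) * x s $ k) = Re (y s $ j)" if "s \<ge> 0" for s
      unfolding y_idx[OF that j] by (simp add: Re_sum)
    have derRe: "((\<lambda>s. \<Sum>k=0..<n. Re (Q $$ (j, k)) * x s $ k) has_real_derivative
        (\<Sum>k=0..<n. Re (Q $$ (j, k)) * (A *\<^sub>v x t) $ k)) (at t within {0..})"
      by (intro DERIV_sum DERIV_cmult has_rate_index[OF x t]) auto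
    have "Re ((B *\<^sub>v y t) $ j) = (\<Sum>k=0..<n. Re (Q $$ (j, k)) * (A *\<^sub>v x t) $ k)"
      unfolding By_idx[OF t j] by (simp add: Re_sum del: index_mult_mat_vec)
    then show "((\<lambda>s. Re (y s $ j)) has_real_derivative Re ((B *\<^sub>v y t) $ j)) (at t within {0..})"
      using halfline_derivative_transform[OF derRe t eqRe] by simp
    have eqIm: "(\<Sum>k=0..<n. Im (Q $$ (j, k)) * x s $ k) = Im (y s $ j)" if "s \<ge> 0" for s
      unfolding y_idx[OF that j] by (simp add: Im_sum)
    have derIm: "((\<lambda>s. \<Sum>k=0..<n. Im (Q $$ (j, k)) * x s $ k) has_real_derivative
        (\<Sum>k=0..<n. Im (Q $$ (j, k)) * (A *\<^sub>v x t) $ k)) (at t within {0..})"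
      by (intro DERIV_sum DERIV_cmult has_rate_index[OF x t]) auto
    have "Im ((B *\<^sub>v y t) $ j) = (\<Sum>k=0..<n. Im (Q $$ (j, k)) * (A *\<^sub>v x t) $ k)"
      unfolding By_idx[OF t j] by (simp add: Im_sum del: index_mult_mat_vec)
    then show "((\<lambda>s. Im (y s $ j)) has_real_derivative Im ((B *\<^sub>v y t) $ j)) (at t within {0..})"
      using halfline_derivative_transform[OF derIm t eqIm] by simp
  qed
  have y_decay: "exp_decay (\<lambda>t. y t $ j)" if "j < n" for j
    using that
  proof (induction "n - j" arbitrary: j rule: less_induct)
    case less
    \<comment> \<open>By triangularity row \<open>j\<close> involves only components with index at
      least \<open>j\<close>; the later ones decay by induction and act as input to a scalar
      equation.\<close>
    have g: "exp_decay (\<lambda>t. \<Sum>k=Suc j..<n. B $$ (j, k) * y t $ k)"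
      using less by (intro exp_decay_sum exp_decay_mult_right bdd_fn_const) auto
    show ?case
    proof (rule complex_scalar_decay[OF y_re y_im _ neg g])
      fix t :: real assume t: "t \<ge> 0"
      have "(B *\<^sub>v y t) $ j = (\<Sum>k=0..<n. B $$ (j, k) * y t $ k)"
        using B ycar[OF t] less.prems by (simp add: scalar_prod_def)
      also have "\<dots> = (\<Sum>k=j..<n. B $$ (j, k) * y t $ k)"
        using sd(2) B less.prems by (intro sum.mono_neutral_right) (auto simp: upper_triangular_def)
      also have "\<dots> = B $$ (j, j) * y t $ j + (\<Sum>k=Suc j..<n. B $$ (j, k) * y t $ k)"
        using less.prems by (simp add: sum.atLeast_Suc_lessThan)
      finally show "(B *\<^sub>v y t) $ j = B $$ (j, j) * y t $ j + (\<Sum>k=Suc j..<n. B $$ (j, k) * y t $ k)" .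
    qed (use less.prems in auto)
  qed
  \<comment> \<open>Return to the original coordinates: \<open>P *\<^sub>v y t\<close> is the
    complexified state.\<close>
  have "exp_decay (\<lambda>t. \<Sum>k=0..<n. P $$ (i, k) * y t $ k)"
    by (intro exp_decay_sum exp_decay_mult_right bdd_fn_const y_decay) auto
  then show ?thesis
  proof (rule exp_decay_mono)
    fix t :: real assume t: "t \<ge> 0"
    have "P *\<^sub>v y t = (P * Q) *\<^sub>v X t"
      unfolding y_def by (rule assoc_mult_mat_vec[OF P Q Xcar[OF t], symmetric])
    then have "P *\<^sub>v y t = X t" using sim(1) Xcar[OF t] by simp
    then have "complex_of_real (x t $ i) = (P *\<^sub>v y t) $ i" using xcar[OF t] i by (simp add: X_def)
    also have "\<dots> = (\<Sum>k=0..<n. P $$ (i, k) * y t $ k)"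
      using P ycar[OF t] i by (simp add: scalar_prod_def)
    finally show "norm (x t $ i) \<le> norm (\<Sum>k=0..<n. P $$ (i, k) * y t $ k)"
      by (metis norm_of_real order_refl real_norm_def)
  qed
qed

section \<open>Derivatives of trigonometric polynomials\<close>

lemma trig_polynomial_has_derivative:
  fixes a \<omega> \<phi> :: "nat \<Rightarrow> real"
  shows "((\<lambda>t. c + (\<Sum>j\<in>J. a j * \<omega> j ^ k * sin (\<omega> j * t + \<phi> j + real k * (pi / 2)))) has_real_derivative
    (\<Sum>j\<in>J. a j * \<omega> j ^ Suc k * sin (\<omega> j * t + \<phi> j + real (Suc k) * (pi / 2)))) (at t)"
proof -
  have "((\<lambda>t. c + (\<Sum>j\<in>J. a j * \<omega> j ^ k * sin (\<omega> j * t + \<phi> j + real k * (pi / 2))))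
      has_real_derivative 0 + (\<Sum>j\<in>J. a j * \<omega> j ^ k * (cos (\<omega> j * t + \<phi> j + real k * (pi / 2)) * \<omega> j))) (at t)"
    by (intro DERIV_add DERIV_const DERIV_sum DERIV_cmult) (auto intro!: derivative_eq_intros)
  moreover have "cos (\<omega> j * t + \<phi> j + real k * (pi / 2)) = sin (\<omega> j * t + \<phi> j + real (Suc k) * (pi / 2))" for j
  proof -
    have "\<omega> j * t + \<phi> j + real (Suc k) * (pi / 2) = (\<omega> j * t + \<phi> j + real k * (pi / 2)) + pi / 2"
      by (simp add: algebra_simps)
    then show ?thesis by (simp only: sin_add) simp
  qed
  ultimately show ?thesis by (simp add: ac_simps)
qed

text \<open>Each differentiation multiplies by the frequency and advances the phase by
  \<open>pi / 2\<close>, so one closed form covers every order and boundedness is immediate. Only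
  order 0 retains the constant.\<close>

lemma iterated_deriv_trig_polynomial:
  fixes a \<omega> \<phi> :: "nat \<Rightarrow> real"
  shows "(deriv ^^ k) (\<lambda>t. a0 + (\<Sum>j\<in>J. a j * sin (\<omega> j * t + \<phi> j))) =
    (\<lambda>t. (if k = 0 then a0 else 0) + (\<Sum>j\<in>J. a j * \<omega> j ^ k * sin (\<omega> j * t + \<phi> j + real k * (pi / 2))))"
proof (induction k)
  case (Suc k)
  then show ?case using DERIV_imp_deriv[OF trig_polynomial_has_derivative] by auto
qed simp

lemma trig_polynomial_derivatives:
  fixes a \<omega> \<phi> :: "nat \<Rightarrow> real"
  assumes f: "f = (\<lambda>t. a0 + (\<Sum>j\<in>J. a j * sin (\<omega> j * t + \<phi> j)))" and J: "finite J"
  shows "((deriv ^^ k) f has_real_derivative (deriv ^^ Suc k) f t) (at t within S)"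
    and "bdd_fn ((deriv ^^ k) f)"
proof -
  have "((deriv ^^ k) f has_real_derivative (deriv ^^ Suc k) f t) (at t)"
    using trig_polynomial_has_derivative[of "if k = 0 then a0 else 0" a \<omega> k \<phi> J t]
    unfolding f iterated_deriv_trig_polynomial by simp
  then show "((deriv ^^ k) f has_real_derivative (deriv ^^ Suc k) f t) (at t within S)"
    by (rule has_field_derivative_at_within)
  have "bdd_fn (\<lambda>t. sin (\<omega> j * t + \<phi> j + real k * (pi / 2)))" for j
    by (rule bdd_fnI[where C = 1]) simp
  then show "bdd_fn ((deriv ^^ k) f)"
    unfolding f iterated_deriv_trig_polynomial
    by (intro bdd_fn_add bdd_fn_sum bdd_fn_mult bdd_fn_const J)
qed

section \<open>Block structure\<close>

text \<open>Splitting off the last block, not the first, leaves the offsets of all earlier blocks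
  unchanged, so inductions on \<open>n\<close> agree with \<open>block\<close>.\<close>

lemma blkdiag_Suc:
  "blkdiag (Suc n) A = four_block_mat (blkdiag n A) (0\<^sub>m (dim_row (blkdiag n A)) (dim_col (A n)))
     (0\<^sub>m (dim_row (A n)) (dim_col (blkdiag n A))) (A n)"
  unfolding blkdiag_def by (simp add: diag_block_mat_last Let_def)

lemma blkdiag_carrier:
  assumes "\<And>i. i < n \<Longrightarrow> A i \<in> carrier_mat (r i) (c i)"
  shows "blkdiag n A \<in> carrier_mat (\<Sum>i<n. r i) (\<Sum>i<n. c i)"
  using assms
proof (induction n)
  case 0
  show ?case by (simp add: blkdiag_def)
next
  case (Suc n)
  have "blkdiag n A \<in> carrier_mat (\<Sum>i<n. r i) (\<Sum>i<n. c i)" "A n \<in> carrier_mat (r n) (c n)"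
    by (rule Suc.IH, rule Suc.prems, simp) (rule Suc.prems, simp)
  then show ?case unfolding blkdiag_Suc sum.lessThan_Suc by (rule four_block_carrier_mat)
qed

lemma blkcol_Suc: "blkcol (Suc n) v = blkcol n v @\<^sub>v v n"
proof -
  have "list_of_vec (blkcol (Suc n) v) = list_of_vec (blkcol n v @\<^sub>v v n)"
    unfolding blkcol_def by (simp add: list_vec)
  from arg_cong[OF this, of vec_of_list] show ?thesis by (simp only: vec_list)
qed

lemma blkcol_carrier:
  assumes "\<And>i. i < n \<Longrightarrow> v i \<in> carrier_vec (r i)"
  shows "blkcol n v \<in> carrier_vec (\<Sum>i<n. r i)"
  using assms
proof (induction n)
  case 0
  show ?case by (rule carrier_vecI) (simp add: blkcol_def)
next
  case (Suc n)
  have "blkcol n v \<in> carrier_vec (\<Sum>i<n. r i)" "v n \<in> carrier_vec (r n)"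
    by (rule Suc.IH, rule Suc.prems, simp) (rule Suc.prems, simp)
  then show ?case unfolding blkcol_Suc sum.lessThan_Suc by (rule append_carrier_vec)
qed

lemma block_carrier [simp]: "block r i v \<in> carrier_vec (r i)"
  unfolding block_def by simp

lemma dim_block [simp]: "dim_vec (block r i v) = r i"
  unfolding block_def by simp

lemma block_index: "k < r i \<Longrightarrow> block r i v $ k = v $ ((\<Sum>l<i. r l) + k)"
  unfolding block_def by simp

lemma block_offset_less:
  fixes r :: "nat \<Rightarrow> nat"
  assumes "i < n" "k < r i"
  shows "(\<Sum>l<i. r l) + k < (\<Sum>l<n. r l)"
proof -
  have "(\<Sum>l<i. r l) + k < (\<Sum>l<Suc i. r l)" using assms by simp
  also have "\<dots> \<le> (\<Sum>l<n. r l)" using assms by (intro sum_mono2) auto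
  finally show ?thesis .
qed

lemma block_index_exists:
  fixes r :: "nat \<Rightarrow> nat"
  assumes "j < (\<Sum>l<n. r l)"
  obtains i k where "i < n" "k < r i" "j = (\<Sum>l<i. r l) + k"
  using assms
proof (induction n arbitrary: thesis)
  case (Suc n)
  show ?case
  proof (cases "j < (\<Sum>l<n. r l)")
    case True
    show ?thesis
    proof (rule Suc.IH[OF _ True])
      fix i k assume "i < n" "k < r i" "j = (\<Sum>l<i. r l) + k"
      then show thesis using Suc.prems(1)[of i k] by simp
    qed
  next
    case False
    then show ?thesis using Suc.prems by (intro Suc.prems(1)[of n "j - (\<Sum>l<n. r l)"]) auto
  qed
qed simp

lemma sum_blocks:
  fixes r :: "nat \<Rightarrow> nat" and f :: "nat \<Rightarrow> 'a::comm_monoid_add"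
  shows "(\<Sum>j=0..<(\<Sum>l<n. r l). f j) = (\<Sum>i<n. \<Sum>k=0..<r i. f ((\<Sum>l<i. r l) + k))"
proof (induction n)
  case (Suc n)
  have "(\<Sum>j=0..<(\<Sum>l<Suc n. r l). f j) =
      (\<Sum>j=0..<(\<Sum>l<n. r l). f j) + (\<Sum>j=(\<Sum>l<n. r l)..<(\<Sum>l<n. r l) + r n. f j)"
    by (simp add: sum.atLeastLessThan_concat)
  also have "(\<Sum>j=(\<Sum>l<n. r l)..<(\<Sum>l<n. r l) + r n. f j) = (\<Sum>k=0..<r n. f ((\<Sum>l<n. r l) + k))"
    using sum.shift_bounds_nat_ivl[of f 0 "\<Sum>l<n. r l" "r n"] by (simp add: add.commute)
  finally show ?case using Suc by simp
qed simp

lemma scalar_prod_blocks: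
  fixes v w :: "real vec"
  assumes "w \<in> carrier_vec (\<Sum>i<n. r i)"
  shows "v \<bullet> w = (\<Sum>i<n. block r i v \<bullet> block r i w)"
  using assms by (simp add: scalar_prod_def sum_blocks block_index)

lemma block_append_less:
  assumes "v \<in> carrier_vec (\<Sum>l<n. r l)" "i < n"
  shows "block r i (v @\<^sub>v w) = block r i v"
  using assms block_offset_less[of i n _ r] by (intro eq_vecI) (simp_all add: block_index trans_less_add1)

lemma block_append_last:
  assumes "v \<in> carrier_vec (\<Sum>l<n. r l)" "w \<in> carrier_vec (r n)"
  shows "block r n (v @\<^sub>v w) = w"
  using assms by (intro eq_vecI) (simp_all add: block_index)

lemma block_blkcol:
  assumes "\<And>i. i < n \<Longrightarrow> v i \<in> carrier_vec (r i)" "i < n"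
  shows "block r i (blkcol n v) = v i"
  using assms
proof (induction n)
  case (Suc n)
  have car: "blkcol n v \<in> carrier_vec (\<Sum>i<n. r i)" using Suc.prems by (intro blkcol_carrier) auto
  show ?case
  proof (cases "i = n")
    case True
    then show ?thesis unfolding blkcol_Suc using block_append_last[OF car] Suc.prems by simp
  next
    case False
    then show ?thesis unfolding blkcol_Suc using block_append_less[OF car] Suc by simp
  qed
qed simp

text \<open>Everything known about block diagonal matrices acting on vectors is read off here, one
  block at a time. The vector is generalized because the induction applies the hypothesis to its
  leading part.\<close>

lemma block_blkdiag_mult_vec:
  assumes "\<And>i. i < n \<Longrightarrow> A i \<in> carrier_mat (r i) (c i)" "v \<in> carrier_vec (\<Sum>i<n. c i)" "i < n"
  shows "block r i (blkdiag n A *\<^sub>v v) = A i *\<^sub>v block c i v"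
  using assms
proof (induction n arbitrary: v)
  case (Suc n)
  let ?D = "blkdiag n A"
  have D: "?D \<in> carrier_mat (\<Sum>i<n. r i) (\<Sum>i<n. c i)" using Suc.prems by (intro blkdiag_carrier) auto
  have An: "A n \<in> carrier_mat (r n) (c n)" using Suc.prems by simp
  define a b where "a = vec_first v (\<Sum>i<n. c i)" and "b = vec_last v (c n)"
  have a: "a \<in> carrier_vec (\<Sum>i<n. c i)" and b: "b \<in> carrier_vec (c n)" by (simp_all add: a_def b_def)
  have v: "v = a @\<^sub>v b" using Suc.prems(2) by (simp add: a_def b_def)
  have eq: "blkdiag (Suc n) A *\<^sub>v (a @\<^sub>v b) = (?D *\<^sub>v a) @\<^sub>v (A n *\<^sub>v b)"
    unfolding blkdiag_Suc using D An a b
    by (subst four_block_mat_mult_vec[OF D _ _ An a b]) auto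
  have Da: "?D *\<^sub>v a \<in> carrier_vec (\<Sum>i<n. r i)" by (rule mult_mat_vec_carrier[OF D a])
  have Ab: "A n *\<^sub>v b \<in> carrier_vec (r n)" by (rule mult_mat_vec_carrier[OF An b])
  show ?case
  proof (cases "i = n")
    case True
    then show ?thesis unfolding v eq using block_append_last[OF Da Ab] block_append_last[OF a b] by simp
  next
    case False
    then have i: "i < n" using Suc.prems by simp
    then show ?thesis
      unfolding v eq block_append_less[OF Da i] block_append_less[OF a i]
      using Suc.IH[OF _ a i] Suc.prems(1) by simp
  qed
qed simp

lemma block_diff:
  assumes "w \<in> carrier_vec (\<Sum>l<n. r l)" "i < n"
  shows "block r i (v - w) = block r i v - block r i w"
  using assms block_offset_less[of i n _ r] by (intro eq_vecI) (simp_all add: block_index)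

lemma has_rate_block:
  assumes "has_rate (\<Sum>l<n. r l) x x'" "i < n"
  shows "has_rate (r i) (\<lambda>t. block r i (x t)) (\<lambda>t. block r i (x' t))"
  using assms block_offset_less[of i n _ r] unfolding has_rate_def by (simp add: block_index)

lemma has_rate_blocksI:
  assumes "\<And>t. t \<ge> 0 \<Longrightarrow> x t \<in> carrier_vec (\<Sum>l<n. r l)"
    and "\<And>i. i < n \<Longrightarrow> has_rate (r i) (\<lambda>t. block r i (x t)) (\<lambda>t. block r i (x' t))"
  shows "has_rate (\<Sum>l<n. r l) x x'"
proof (rule has_rateI[OF assms(1)])
  fix t :: real and j assume t: "t \<ge> 0" and "j < (\<Sum>l<n. r l)"
  then obtain i k where ik: "i < n" "k < r i" "j = (\<Sum>l<i. r l) + k" by (elim block_index_exists)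
  show "((\<lambda>s. x s $ j) has_real_derivative x' t $ j) (at t within {0..})"
    using has_rate_index[OF assms(2)[OF ik(1)] t ik(2)] by (simp add: block_index[where r = r, OF ik(2)] ik(3))
qed

section \<open>Regressor matrices\<close>

lemma regressor_carrier: "regressor n r v \<in> carrier_mat n (\<Sum>i<n. r i)"
proof -
  have "regressor n r v \<in> carrier_mat (\<Sum>i<n. 1) (\<Sum>i<n. r i)"
    unfolding regressor_def by (rule blkdiag_carrier) auto
  then show ?thesis by simp
qed

lemma regressor_mult_vec:
  assumes w: "w \<in> carrier_vec (\<Sum>l<n. r l)" and i: "i < n"
  shows "(regressor n r v *\<^sub>v w) $ i = block r i v \<bullet> block r i w"
proof -
  \<comment> \<open>The blocks of a regressor are single rows, so its output is viewed as a stack of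
    blocks of size one.\<close>
  have "(regressor n r v *\<^sub>v w) $ i = block (\<lambda>_. 1) i (regressor n r v *\<^sub>v w) $ 0"
    by (simp add: block_index)
  also have "block (\<lambda>_. 1) i (regressor n r v *\<^sub>v w) = mat_of_row (block r i v) *\<^sub>v block r i w"
    unfolding regressor_def by (rule block_blkdiag_mult_vec[OF _ w i]) auto
  also have "\<dots> $ 0 = block r i v \<bullet> block r i w" by simp
  finally show ?thesis .
qed

text \<open>Applying the matrix to a unit vector avoids indexing nested block matrices. As each
  entry is a coordinate of \<open>v\<close> or zero, linearity, boundedness, decay and rates pass
  from \<open>v\<close> to the regressor entrywise.\<close>

lemma regressor_index:
  assumes "i < n" "j < (\<Sum>l<n. r l)"
  shows "regressor n r v $$ (i, j) = (if (\<Sum>l<i. r l) \<le> j \<and> j < (\<Sum>l<Suc i. r l) then v $ j else 0)"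
proof -
  let ?o = "\<Sum>l<i. r l"
  let ?u = "unit_vec (\<Sum>l<n. r l) j :: real vec"
  have "regressor n r v $$ (i, j) = (regressor n r v *\<^sub>v ?u) $ i"
    using regressor_carrier[of n r v] assms by (simp add: carrier_matD)
  also have "\<dots> = (\<Sum>k=0..<r i. v $ (?o + k) * ?u $ (?o + k))"
    using regressor_mult_vec[of ?u r n i v] assms by (simp add: scalar_prod_def block_index)
  also have "\<dots> = (\<Sum>k=0..<r i. if ?o + k = j then v $ j else 0)"
    using block_offset_less[OF assms(1), of _ r] assms(2) by (intro sum.cong) auto
  also have "\<dots> = (if ?o \<le> j \<and> j < (\<Sum>l<Suc i. r l) then v $ j else 0)"
  proof (cases "?o \<le> j \<and> j < (\<Sum>l<Suc i. r l)")
    case True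
    then have "(\<Sum>k=0..<r i. if ?o + k = j then v $ j else 0) = (\<Sum>k=0..<r i. if k = j - ?o then v $ j else 0)"
      by (intro sum.cong) auto
    then show ?thesis using True by (simp add: sum.delta) linarith
  next
    case False
    then show ?thesis by (auto intro!: sum.neutral)
  qed
  finally show ?thesis .
qed

lemma regressor_diff:
  assumes "v \<in> carrier_vec (\<Sum>l<n. r l)" "w \<in> carrier_vec (\<Sum>l<n. r l)"
  shows "regressor n r v - regressor n r w = regressor n r (v - w)"
  using carrier_matD[OF regressor_carrier[of n r v]] carrier_matD[OF regressor_carrier[of n r w]]
    carrier_matD[OF regressor_carrier[of n r "v - w"]] assms
  by (intro eq_matI) (simp_all add: regressor_index)

lemma bdd_mat_regressor:
  assumes "\<And>j. j < (\<Sum>l<n. r l) \<Longrightarrow> bdd_fn (\<lambda>t. v t $ j)"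
  shows "bdd_mat n (\<Sum>l<n. r l) (\<lambda>t. regressor n r (v t))"
proof -
  have "bdd_fn (\<lambda>t. regressor n r (v t) $$ (i, j))" if "i < n" "j < (\<Sum>l<n. r l)" for i j
    by (cases "(\<Sum>l<i. r l) \<le> j \<and> j < (\<Sum>l<Suc i. r l)")
      (simp_all only: regressor_index[OF that] simp_thms if_True if_False assms[OF that(2)] bdd_fn_const)
  then show ?thesis unfolding bdd_mat_def using regressor_carrier by blast
qed

lemma exp_decay_mat_regressor:
  assumes "\<And>j. j < (\<Sum>l<n. r l) \<Longrightarrow> exp_decay (\<lambda>t. v t $ j)"
  shows "exp_decay_mat n (\<Sum>l<n. r l) (\<lambda>t. regressor n r (v t))"
proof -
  have "exp_decay (\<lambda>t. regressor n r (v t) $$ (i, j))" if "i < n" "j < (\<Sum>l<n. r l)" for i j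
    by (cases "(\<Sum>l<i. r l) \<le> j \<and> j < (\<Sum>l<Suc i. r l)")
      (simp_all only: regressor_index[OF that] simp_thms if_True if_False assms[OF that(2)] exp_decay_zero)
  then show ?thesis unfolding exp_decay_mat_def using regressor_carrier by blast
qed

lemma has_mat_rate_regressor:
  assumes "has_rate (\<Sum>l<n. r l) v v'"
  shows "has_mat_rate n (\<Sum>l<n. r l) (\<lambda>t. regressor n r (v t)) (\<lambda>t. regressor n r (v' t))"
proof -
  have "((\<lambda>s. regressor n r (v s) $$ (i, j)) has_real_derivative regressor n r (v' t) $$ (i, j))
      (at t within {0..})" if "i < n" "j < (\<Sum>l<n. r l)" "t \<ge> 0" for i j t
    by (cases "(\<Sum>l<i. r l) \<le> j \<and> j < (\<Sum>l<Suc i. r l)")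
      (simp_all only: regressor_index[OF that(1,2)] simp_thms if_True if_False has_rate_index[OF assms that(3,2)] DERIV_const)
  then show ?thesis unfolding has_mat_rate_def using regressor_carrier by blast
qed

lemma stacked_rows_carrier:
  assumes "\<And>i. i < n \<Longrightarrow> \<Psi> i \<in> carrier_mat 1 (r i)"
  shows "stacked_rows n \<Psi> \<in> carrier_vec (\<Sum>i<n. r i)"
  unfolding stacked_rows_def by (rule blkcol_carrier, rule row_carrier_vec[OF _ assms]) auto

lemma block_stacked_rows:
  assumes "\<And>i. i < n \<Longrightarrow> \<Psi> i \<in> carrier_mat 1 (r i)" "i < n"
  shows "block r i (stacked_rows n \<Psi>) = row (\<Psi> i) 0"
  unfolding stacked_rows_def by (rule block_blkcol[OF row_carrier_vec[OF _ assms(1)] assms(2)]) auto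

section \<open>Excitation of single blocks and of the regressor\<close>

lemma persistently_exciting_column:
  assumes pe: "persistently_exciting 0 q 1 (\<lambda>t. mat_of_cols q [w t])"
    and w: "\<And>t. t \<ge> 0 \<Longrightarrow> w t \<in> carrier_vec q"
  obtains \<alpha> T where "\<alpha> > 0" "T > 0"
    "\<And>t v. t \<ge> 0 \<Longrightarrow> v \<in> carrier_vec q \<Longrightarrow> \<alpha> * (v \<bullet> v) \<le> integral {t..t + T} (\<lambda>\<tau>. (w \<tau> \<bullet> v)\<^sup>2)"
proof -
  define W where "W = (\<lambda>t. mat_of_cols q [w t])"
  obtain \<alpha> T where \<alpha>: "\<alpha> > 0" and T: "T > 0" and
    pe': "\<And>t. t \<ge> 0 \<Longrightarrow>
       (\<forall>j<q. \<forall>k<q. (\<lambda>\<tau>. (W \<tau> * (W \<tau>)\<^sup>T) $$ (j, k)) integrable_on {t..t + T}) \<and>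
       pos_semidef q (gram_integral q W t (t + T) - \<alpha> \<cdot>\<^sub>m 1\<^sub>m q)"
    using pe unfolding persistently_exciting_def W_def by blast
  show ?thesis
  proof (rule that[OF \<alpha> T])
    fix t :: real and v :: "real vec" assume t: "t \<ge> 0" and v: "v \<in> carrier_vec q"
    \<comment> \<open>Testing the semidefinite inequality on \<open>v\<close> reduces it to a scalar
      one: the Gram matrix has rank one integrand, so its form at \<open>v\<close> integrates
      \<open>(w \<tau> \<bullet> v)^2\<close>.\<close>
    define G where "G = gram_integral q W t (t + T)"
    have G: "G \<in> carrier_mat q q" by (simp add: G_def gram_integral_def)
    have "0 \<le> v \<bullet> ((G - \<alpha> \<cdot>\<^sub>m 1\<^sub>m q) *\<^sub>v v)"
      using pe'[OF t] v unfolding pos_semidef_def G_def by blast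
    moreover have "(\<alpha> \<cdot>\<^sub>m 1\<^sub>m q) *\<^sub>v v = \<alpha> \<cdot>\<^sub>v v"
      using v by (intro eq_vecI) auto
    then have "(G - \<alpha> \<cdot>\<^sub>m 1\<^sub>m q) *\<^sub>v v = G *\<^sub>v v - \<alpha> \<cdot>\<^sub>v v"
      using minus_mult_distrib_mat_vec[of G q q "\<alpha> \<cdot>\<^sub>m 1\<^sub>m q" v] G v by simp
    moreover have "v \<bullet> (G *\<^sub>v v - \<alpha> \<cdot>\<^sub>v v) = v \<bullet> (G *\<^sub>v v) - \<alpha> * (v \<bullet> v)"
      using G v by (simp add: scalar_prod_minus_distrib[of _ q])
    ultimately have "\<alpha> * (v \<bullet> v) \<le> v \<bullet> (G *\<^sub>v v)" by simp
    also have "\<dots> = (\<Sum>j=0..<q. \<Sum>k=0..<q. v $ j * v $ k * G $$ (j, k))"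
      by (rule quadratic_form_sum[OF G v])
    also have "\<dots> = (\<Sum>j=0..<q. \<Sum>k=0..<q. v $ j * v $ k * integral {t..t + T} (\<lambda>\<tau>. (W \<tau> * (W \<tau>)\<^sup>T) $$ (j, k)))"
      by (simp add: G_def gram_integral_def)
    \<comment> \<open>Sum and integral are exchanged by the integrability clause in the definition
      of excitation.\<close>
    also have "\<dots> = integral {t..t + T} (\<lambda>\<tau>. \<Sum>j=0..<q. \<Sum>k=0..<q. v $ j * v $ k * (W \<tau> * (W \<tau>)\<^sup>T) $$ (j, k))"
    proof (subst integral_sum)
      have int: "(\<lambda>\<tau>. v $ j * v $ k * (W \<tau> * (W \<tau>)\<^sup>T) $$ (j, k)) integrable_on {t..t + T}" if "j < q" "k < q" for j k
        using pe'[OF t] that by (intro integrable_on_mult_right) blast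
      then show "(\<lambda>\<tau>. \<Sum>k=0..<q. v $ j * v $ k * (W \<tau> * (W \<tau>)\<^sup>T) $$ (j, k)) integrable_on {t..t + T}"
        if "j \<in> {0..<q}" for j using that by (intro integrable_sum) auto
      show "(\<Sum>j=0..<q. \<Sum>k=0..<q. v $ j * v $ k * integral {t..t + T} (\<lambda>\<tau>. (W \<tau> * (W \<tau>)\<^sup>T) $$ (j, k))) =
          (\<Sum>j=0..<q. integral {t..t + T} (\<lambda>\<tau>. \<Sum>k=0..<q. v $ j * v $ k * (W \<tau> * (W \<tau>)\<^sup>T) $$ (j, k)))"
      proof (rule sum.cong[OF refl])
        fix j assume j: "j \<in> {0..<q}"
        have "integral {t..t + T} (\<lambda>\<tau>. \<Sum>k=0..<q. v $ j * v $ k * (W \<tau> * (W \<tau>)\<^sup>T) $$ (j, k)) =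
            (\<Sum>k=0..<q. integral {t..t + T} (\<lambda>\<tau>. v $ j * v $ k * (W \<tau> * (W \<tau>)\<^sup>T) $$ (j, k)))"
          by (rule integral_sum) (use int j in auto)
        then show "(\<Sum>k=0..<q. v $ j * v $ k * integral {t..t + T} (\<lambda>\<tau>. (W \<tau> * (W \<tau>)\<^sup>T) $$ (j, k))) =
            integral {t..t + T} (\<lambda>\<tau>. \<Sum>k=0..<q. v $ j * v $ k * (W \<tau> * (W \<tau>)\<^sup>T) $$ (j, k))"
          by simp
      qed
    qed simp
    also have "\<dots> = integral {t..t + T} (\<lambda>\<tau>. (w \<tau> \<bullet> v)\<^sup>2)"
    proof (rule integral_cong)
      fix \<tau> assume "\<tau> \<in> {t..t + T}"
      then have wc: "w \<tau> \<in> carrier_vec q" using t by (intro w) auto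
      have "(W \<tau> * (W \<tau>)\<^sup>T) $$ (j, k) = w \<tau> $ j * w \<tau> $ k" if "j < q" "k < q" for j k
        using that wc by (simp add: W_def scalar_prod_def mat_of_cols_def)
      then have "(\<Sum>j=0..<q. \<Sum>k=0..<q. v $ j * v $ k * (W \<tau> * (W \<tau>)\<^sup>T) $$ (j, k)) =
          (\<Sum>j=0..<q. \<Sum>k=0..<q. (w \<tau> $ j * v $ j) * (w \<tau> $ k * v $ k))"
        by (intro sum.cong refl) simp
      also have "\<dots> = (w \<tau> \<bullet> v)\<^sup>2"
        using v by (simp add: scalar_prod_def power2_eq_square sum_product)
      finally show "(\<Sum>j=0..<q. \<Sum>k=0..<q. v $ j * v $ k * (W \<tau> * (W \<tau>)\<^sup>T) $$ (j, k)) = (w \<tau> \<bullet> v)\<^sup>2" .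
    qed
    finally show "\<alpha> * (v \<bullet> v) \<le> integral {t..t + T} (\<lambda>\<tau>. (w \<tau> \<bullet> v)\<^sup>2)" .
  qed
qed

text \<open>The squared output of the regressor is a sum of one square per block. Constants common
  to all blocks are the smallest level and the longest window: the integrand is nonnegative, so
  lengthening a window cannot lower its integral.\<close>

lemma persistently_exciting_regressor:
  assumes pe: "\<And>i. i < n \<Longrightarrow> persistently_exciting 0 (r i) 1 (\<lambda>t. mat_of_cols (r i) [block r i (w t)])"
    and w: "has_rate (\<Sum>l<n. r l) w w'"
  obtains \<alpha> T where "\<alpha> > 0" "T > 0"
    "\<And>t v. t \<ge> 0 \<Longrightarrow> v \<in> carrier_vec (\<Sum>l<n. r l) \<Longrightarrow>
       \<alpha> * (v \<bullet> v) \<le> integral {t..t + T} (\<lambda>\<tau>. (regressor n r (w \<tau>) *\<^sub>v v) \<bullet> (regressor n r (w \<tau>) *\<^sub>v v))"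
proof -
  have "\<forall>i\<in>{..<n}. \<exists>p. fst p > 0 \<and> snd p > 0 \<and>
    (\<forall>t\<ge>0. \<forall>v\<in>carrier_vec (r i). fst p * (v \<bullet> v) \<le> integral {t..t + snd p} (\<lambda>\<tau>. (block r i (w \<tau>) \<bullet> v)\<^sup>2))"
  proof
    fix i assume "i \<in> {..<n}"
    then have i: "i < n" by simp
    obtain \<alpha> T where "\<alpha> > 0" "T > 0"
      "\<And>t v. t \<ge> 0 \<Longrightarrow> v \<in> carrier_vec (r i) \<Longrightarrow> \<alpha> * (v \<bullet> v) \<le> integral {t..t + T} (\<lambda>\<tau>. (block r i (w \<tau>) \<bullet> v)\<^sup>2)"
      by (rule persistently_exciting_column[OF pe[OF i] block_carrier]) blast
    then show "\<exists>p. fst p > 0 \<and> snd p > 0 \<and>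
      (\<forall>t\<ge>0. \<forall>v\<in>carrier_vec (r i). fst p * (v \<bullet> v) \<le> integral {t..t + snd p} (\<lambda>\<tau>. (block r i (w \<tau>) \<bullet> v)\<^sup>2))"
      by (intro exI[of _ "(\<alpha>, T)"]) auto
  qed
  from bchoice[OF this] obtain p where p: "\<forall>i\<in>{..<n}. fst (p i) > 0 \<and> snd (p i) > 0 \<and>
    (\<forall>t\<ge>0. \<forall>v\<in>carrier_vec (r i). fst (p i) * (v \<bullet> v) \<le>
      integral {t..t + snd (p i)} (\<lambda>\<tau>. (block r i (w \<tau>) \<bullet> v)\<^sup>2))" by blast
  \<comment> \<open>The inserted 1 keeps both sets nonempty when \<open>n = 0\<close>.\<close>
  define \<alpha> where "\<alpha> = Min (insert 1 ((\<lambda>i. fst (p i)) ` {..<n}))"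
  define T where "T = Max (insert 1 ((\<lambda>i. snd (p i)) ` {..<n}))"
  show ?thesis
  proof (rule that[of \<alpha> T])
    show "\<alpha> > 0" unfolding \<alpha>_def using p by (subst Min_gr_iff) auto
    show "T > 0" unfolding T_def by (subst Max_gr_iff) auto
    fix t :: real and v :: "real vec" assume t: "t \<ge> 0" and v: "v \<in> carrier_vec (\<Sum>l<n. r l)"
    let ?f = "\<lambda>i \<tau>. (block r i (w \<tau>) \<bullet> block r i v)\<^sup>2"
    have int: "?f i integrable_on {a..b}" if "0 \<le> a" "i < n" for i a b
    proof (rule integrable_continuous_interval)
      have "continuous_on {0..} (\<lambda>\<tau>. block r i (w \<tau>) $ k)" if "k < r i" for k
        by (rule DERIV_continuous_on[where D = "\<lambda>t. block r i (w' t) $ k"])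
          (use has_rate_index[OF has_rate_block[OF w \<open>i < n\<close>] _ that] in auto)
      then have "continuous_on {0..} (\<lambda>\<tau>. (\<Sum>k=0..<r i. block r i (w \<tau>) $ k * block r i v $ k)\<^sup>2)"
        by (intro continuous_intros) auto
      then have "continuous_on {0..} (?f i)" by (simp add: scalar_prod_def)
      then show "continuous_on {a..b} (?f i)" by (rule continuous_on_subset) (use that in auto)
    qed
    have "\<alpha> * (v \<bullet> v) = (\<Sum>i<n. \<alpha> * (block r i v \<bullet> block r i v))"
      by (simp add: scalar_prod_blocks[OF v] sum_distrib_left)
    also have "\<dots> \<le> (\<Sum>i<n. integral {t..t + T} (?f i))"
    proof (rule sum_mono)
      fix i assume "i \<in> {..<n}"
      then have i: "i < n" by simp
      have le: "\<alpha> \<le> fst (p i)" unfolding \<alpha>_def using i by (intro Min_le) auto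
      have Tle: "snd (p i) \<le> T" unfolding T_def using i by (intro Max_ge) auto
      have "\<alpha> * (block r i v \<bullet> block r i v) \<le> fst (p i) * (block r i v \<bullet> block r i v)"
        using le by (intro mult_right_mono) (auto simp: scalar_prod_self)
      also have "\<dots> \<le> integral {t..t + snd (p i)} (?f i)"
        using p i t by (meson block_carrier lessThan_iff)
      also have "\<dots> \<le> integral {t..t + T} (?f i)"
        using Tle t i by (intro integral_subset_le int) auto
      finally show "\<alpha> * (block r i v \<bullet> block r i v) \<le> integral {t..t + T} (?f i)" .
    qed
    also have "\<dots> = integral {t..t + T} (\<lambda>\<tau>. \<Sum>i<n. ?f i \<tau>)"
      using int[OF t] by (intro integral_sum[symmetric]) auto
    also have "(\<lambda>\<tau>. \<Sum>i<n. ?f i \<tau>) = (\<lambda>\<tau>. (regressor n r (w \<tau>) *\<^sub>v v) \<bullet> (regressor n r (w \<tau>) *\<^sub>v v))"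
    proof
      fix \<tau>
      have "dim_vec (regressor n r (w \<tau>) *\<^sub>v v) = n"
        using carrier_matD(1)[OF regressor_carrier[of n r "w \<tau>"]] by simp
      then show "(\<Sum>i<n. ?f i \<tau>) = (regressor n r (w \<tau>) *\<^sub>v v) \<bullet> (regressor n r (w \<tau>) *\<^sub>v v)"
        by (simp add: scalar_prod_def[of "regressor n r (w \<tau>) *\<^sub>v v"] regressor_mult_vec[OF v]
            power2_eq_square atLeast0LessThan del: index_mult_mat_vec)
    qed
    finally show "\<alpha> * (v \<bullet> v) \<le> integral {t..t + T} (\<lambda>\<tau>. (regressor n r (w \<tau>) *\<^sub>v v) \<bullet> (regressor n r (w \<tau>) *\<^sub>v v))" .
  qed
qed

section \<open>The closed loop\<close>

lemma companion_mult_vec: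
  assumes v: "v \<in> carrier_vec r" and k: "k < r"
  shows "(companion r \<beta> *\<^sub>v v) $ k = (if Suc k = r then \<Sum>l<r. \<beta> l * v $ l else v $ Suc k)"
proof -
  have "(companion r \<beta> *\<^sub>v v) $ k = (\<Sum>l=0..<r. companion r \<beta> $$ (k, l) * v $ l)"
    using v k by (simp add: scalar_prod_def companion_def)
  also have "\<dots> = (\<Sum>l=0..<r. if Suc k = r then \<beta> l * v $ l else if l = Suc k then v $ l else 0)"
    using k by (intro sum.cong) (auto simp: companion_def)
  also have "\<dots> = (if Suc k = r then \<Sum>l<r. \<beta> l * v $ l else v $ Suc k)"
    using k by (cases "Suc k = r") (simp_all add: atLeast0LessThan)
  finally show ?thesis .
qed

lemma companion_has_rate:
  assumes der: "\<And>k t. t \<ge> 0 \<Longrightarrow> (g k has_real_derivative g (Suc k) t) (at t within {0..})"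
    and ode: "\<And>t. t \<ge> 0 \<Longrightarrow> g r t = (\<Sum>k<r. \<beta> k * g k t)"
  shows "has_rate r (\<lambda>t. vec r (\<lambda>k. g k t)) (\<lambda>t. companion r \<beta> *\<^sub>v vec r (\<lambda>k. g k t))"
proof (rule has_rateI)
  fix t :: real and k assume t: "t \<ge> 0" and k: "k < r"
  have "(companion r \<beta> *\<^sub>v vec r (\<lambda>k. g k t)) $ k = g (Suc k) t"
    using k ode[OF t] by (auto simp: companion_mult_vec)
  then show "((\<lambda>s. vec r (\<lambda>k. g k s) $ k) has_real_derivative
      (companion r \<beta> *\<^sub>v vec r (\<lambda>k. g k t)) $ k) (at t within {0..})"
    using der[OF t] k by simp
qed simp

lemma first_unit_row_mult_vec:
  assumes v: "v \<in> carrier_vec r" and r: "r > 0"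
  shows "first_unit_row r *\<^sub>v v = vec 1 (\<lambda>_. v $ 0)"
proof (rule eq_vecI)
  fix i assume "i < dim_vec (vec 1 (\<lambda>_. v $ 0))"
  then have i: "i = 0" by simp
  have "(first_unit_row r *\<^sub>v v) $ 0 = (\<Sum>k=0..<r. first_unit_row r $$ (0, k) * v $ k)"
    using v by (simp add: scalar_prod_def first_unit_row_def)
  also have "\<dots> = (\<Sum>k=0..<r. if k = 0 then v $ k else 0)"
    by (intro sum.cong) (auto simp: first_unit_row_def)
  finally show "(first_unit_row r *\<^sub>v v) $ i = vec 1 (\<lambda>_. v $ 0) $ i" using r i by simp
qed (simp add: first_unit_row_def)

text \<open>\<open>mat_inverse\<close> is a partial function by elimination; invertibility rules out
  \<open>None\<close>, so that \<open>the\<close> yields the genuine inverse.\<close>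

lemma invertible_mat_the_inverse:
  fixes A :: "'a::field mat"
  assumes A: "A \<in> carrier_mat n n" and inv: "invertible_mat A"
  shows "the (mat_inverse A) * A = 1\<^sub>m n" "the (mat_inverse A) \<in> carrier_mat n n"
proof -
  obtain B where B: "A * B = 1\<^sub>m (dim_row A)" "B * A = 1\<^sub>m (dim_row B)"
    using inv unfolding invertible_mat_def inverts_mat_def by blast
  have "dim_col B = n" using arg_cong[OF B(1), of dim_col] A by simp
  moreover have "dim_row B = n" using arg_cong[OF B(2), of dim_col] A by simp
  ultimately have "B \<in> carrier_mat n n" by (intro carrier_matI)
  then have "A \<in> Units (ring_mat TYPE('a) n ())"
    using A B unfolding Units_def by (auto simp: ring_mat_simps)
  then obtain C where "mat_inverse A = Some C" using mat_inverse(1)[OF A, of "()"] by (cases "mat_inverse A") auto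
  then show "the (mat_inverse A) * A = 1\<^sub>m n" "the (mat_inverse A) \<in> carrier_mat n n"
    using mat_inverse(2)[OF A] by auto
qed

lemma mult_mat_vec_uminus:
  fixes A :: "'a::comm_ring_1 mat"
  assumes "A \<in> carrier_mat nr nc" "v \<in> carrier_vec nc"
  shows "A *\<^sub>v (- v) = - (A *\<^sub>v v)"
  using assms by (intro eq_vecI) auto

text \<open>In the coordinates \<open>- T *\<^sub>v v\<close> the Sylvester equation turns the
  exosystem \<open>F\<close> into the Hurwitz system \<open>M\<close> driven by \<open>- N\<close>
  times the disturbance. This is the equation that the measurable signal \<open>vrhohat\<close> also
  satisfies.\<close>

lemma sylvester_coordinates:
  fixes T :: "real mat"
  assumes car: "T \<in> carrier_mat r r" "F \<in> carrier_mat r r" "M \<in> carrier_mat r r" "N \<in> carrier_mat r 1"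
    "G \<in> carrier_mat 1 r" and syl: "T * F - M * T = N * G" and v: "v \<in> carrier_vec r"
  shows "(- T) *\<^sub>v (F *\<^sub>v v) = M *\<^sub>v (- (T *\<^sub>v v)) - N *\<^sub>v (G *\<^sub>v v)"
proof -
  have Tv: "T *\<^sub>v v \<in> carrier_vec r" "F *\<^sub>v v \<in> carrier_vec r" "G *\<^sub>v v \<in> carrier_vec 1"
    using car v by auto
  then have car2: "T *\<^sub>v (F *\<^sub>v v) \<in> carrier_vec r" "M *\<^sub>v (T *\<^sub>v v) \<in> carrier_vec r"
    "N *\<^sub>v (G *\<^sub>v v) \<in> carrier_vec r" using car by auto
  have "T *\<^sub>v (F *\<^sub>v v) - M *\<^sub>v (T *\<^sub>v v) = (T * F - M * T) *\<^sub>v v"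
    using car v by (simp add: minus_mult_distrib_mat_vec[of _ r r] assoc_mult_mat_vec[of _ r r _ r])
  also have "\<dots> = N *\<^sub>v (G *\<^sub>v v)"
    unfolding syl by (rule assoc_mult_mat_vec[OF car(4,5) v])
  finally have eq: "T *\<^sub>v (F *\<^sub>v v) - M *\<^sub>v (T *\<^sub>v v) = N *\<^sub>v (G *\<^sub>v v)" .
  have TF: "(- T) *\<^sub>v (F *\<^sub>v v) = - (T *\<^sub>v (F *\<^sub>v v))"
    using car Tv by (intro uminus_mult_mat_vec) simp
  have MT: "M *\<^sub>v (- (T *\<^sub>v v)) = - (M *\<^sub>v (T *\<^sub>v v))"
    by (rule mult_mat_vec_uminus[OF car(3) Tv(1)])
  show ?thesis
    unfolding TF MT eq[symmetric]
    using carrier_vecD[OF car2(1)] carrier_vecD[OF car2(2)]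
    by (intro eq_vecI) (simp_all del: index_mult_mat_vec dim_mult_mat_vec)
qed

lemma transformed_output:
  fixes T :: "real mat"
  assumes T: "T \<in> carrier_mat r r" "invertible_mat T" and G: "G \<in> carrier_mat 1 r" and v: "v \<in> carrier_vec r"
  shows "(G * the (mat_inverse T)) *\<^sub>v (- (T *\<^sub>v v)) = - (G *\<^sub>v v)"
proof -
  note I = invertible_mat_the_inverse[OF T]
  have Tv: "T *\<^sub>v v \<in> carrier_vec r" using T v by auto
  have "(G * the (mat_inverse T)) *\<^sub>v (- (T *\<^sub>v v)) = - ((G * the (mat_inverse T)) *\<^sub>v (T *\<^sub>v v))"
    by (rule mult_mat_vec_uminus[OF mult_carrier_mat[OF G I(2)] Tv])
  also have "(G * the (mat_inverse T)) *\<^sub>v (T *\<^sub>v v) = G *\<^sub>v (the (mat_inverse T) *\<^sub>v (T *\<^sub>v v))"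
    by (rule assoc_mult_mat_vec[OF G I(2) Tv])
  also have "the (mat_inverse T) *\<^sub>v (T *\<^sub>v v) = (the (mat_inverse T) * T) *\<^sub>v v"
    by (rule assoc_mult_mat_vec[OF I(2) T(1) v, symmetric])
  finally show ?thesis unfolding I(1) using v by simp
qed

lemma block_ones: "block (\<lambda>_. 1) i v = vec 1 (\<lambda>_. v $ i)"
  unfolding block_def by (rule eq_vecI) simp_all

text \<open>\<open>Pr\<close> is a predicate on scalar time functions, so the same passage from
  blocks to flat indices serves boundedness and decay.\<close>

lemma block_index_cases:
  assumes "\<And>i k. i < n \<Longrightarrow> k < r i \<Longrightarrow> Pr (\<lambda>t. block r i (x t) $ k)" and "j < (\<Sum>l<n. r l)"
  shows "Pr (\<lambda>t. x t $ j)"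
proof -
  from assms(2) obtain i k where ik: "i < n" "k < r i" "j = (\<Sum>l<i. r l) + k" by (elim block_index_exists)
  show ?thesis using assms(1)[OF ik(1,2)] by (simp add: block_index[where r = r, OF ik(2)] ik(3))
qed

theorem theorem3p1:
  fixes n1 n2 m rbar :: nat
    and f1 f2 :: "real \<Rightarrow> real vec \<Rightarrow> real vec \<Rightarrow> real vec"
    and u x1 x2 x \<eta> xhat2 \<theta> vrhohat dvec dhat :: "real \<Rightarrow> real vec"
    and \<rho> r :: "nat \<Rightarrow> nat"
    and a0 :: "nat \<Rightarrow> real"
    and a \<omega> \<phi> \<beta> :: "nat \<Rightarrow> nat \<Rightarrow> real"
    and d :: "nat \<Rightarrow> real \<Rightarrow> real"
    and \<upsilon> vrho :: "nat \<Rightarrow> real \<Rightarrow> real vec"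
    and \<Phi> \<Gamma> M N T \<Psi> :: "nat \<Rightarrow> real mat"
    and Mb Nb K P \<Lambda> :: "real mat"
  \<comment> \<open>disturbance\<close>
  assumes "\<And>i. i < n2 \<Longrightarrow> \<rho> i > 0"
    and "\<And>i. i < n2 \<Longrightarrow> inj_on (\<omega> i) {1..\<rho> i}"
    and "\<And>i j. i < n2 \<Longrightarrow> j \<in> {1..\<rho> i} \<Longrightarrow> \<omega> i j > 0"
    and "\<And>i t. i < n2 \<Longrightarrow> d i t = a0 i + (\<Sum>j=1..\<rho> i. a i j * sin (\<omega> i j * t + \<phi> i j))"
    and "\<And>t. dvec t = vec n2 (\<lambda>i. d i t)"
    and "\<And>i. i < n2 \<Longrightarrow> r i > 0"
    and "\<And>i t. i < n2 \<Longrightarrow> t \<ge> 0 \<Longrightarrow>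
           (deriv ^^ r i) (d i) t = (\<Sum>k<r i. \<beta> i k * (deriv ^^ k) (d i) t)"
    and "rbar = (\<Sum>i<n2. r i)"
    and "\<And>i t. \<upsilon> i t = vec (r i) (\<lambda>k. (deriv ^^ k) (d i) t)"
    and "\<And>i. \<Phi> i = companion (r i) (\<beta> i)"
    and "\<And>i. \<Gamma> i = first_unit_row (r i)"
  \<comment> \<open>design matrices\<close>
    and "\<And>i. i < n2 \<Longrightarrow> M i \<in> carrier_mat (r i) (r i)"
    and "\<And>i. i < n2 \<Longrightarrow> hurwitz (M i)"
    and "\<And>i. i < n2 \<Longrightarrow> N i \<in> carrier_mat (r i) 1"
    and "\<And>i. i < n2 \<Longrightarrow> controllable (M i) (N i)"
    and "\<And>i. i < n2 \<Longrightarrow> spectrum (complex_mat (\<Phi> i)) \<inter> spectrum (complex_mat (M i)) = {}"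
    and "\<And>i. i < n2 \<Longrightarrow> T i \<in> carrier_mat (r i) (r i)"
    and "\<And>i. i < n2 \<Longrightarrow> invertible_mat (T i)"
    and "\<And>i. i < n2 \<Longrightarrow> T i * \<Phi> i - M i * T i = N i * \<Gamma> i"
    and "Mb = blkdiag n2 M"
    and "Nb = blkdiag n2 N"
    and "\<And>i t. vrho i t = - (T i *\<^sub>v \<upsilon> i t)"
    and "\<And>i. \<Psi> i = \<Gamma> i * the (mat_inverse (T i))"
  \<comment> \<open>plant\<close>
    and "\<And>t z w. z \<in> carrier_vec (n1 + n2) \<Longrightarrow> w \<in> carrier_vec m \<Longrightarrow> f1 t z w \<in> carrier_vec n1"
    and "\<And>t z w. z \<in> carrier_vec (n1 + n2) \<Longrightarrow> w \<in> carrier_vec m \<Longrightarrow> f2 t z w \<in> carrier_vec n2"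
    and "\<And>t. t \<ge> 0 \<Longrightarrow> u t \<in> carrier_vec m"
    and "\<And>t. x t = x1 t @\<^sub>v x2 t"
    and "has_rate n1 x1 (\<lambda>t. f1 t (x t) (u t))"
    and "has_rate n2 x2 (\<lambda>t. f2 t (x t) (u t) + dvec t)"
  \<comment> \<open>compensators\<close>
    and "K \<in> carrier_mat n2 n2"
    and "hurwitz K"
    and "sym_pos_def n2 P"
    and "K\<^sup>T * P + P * K = - 1\<^sub>m n2"
    and "sym_pos_def rbar \<Lambda>"
    and "\<And>t. vrhohat t = \<eta> t - Nb *\<^sub>v x2 t"
    and "\<And>t. dhat t = - (regressor n2 r (vrhohat t) *\<^sub>v \<theta> t)"
    and "has_rate rbar \<eta>
           (\<lambda>t. Mb *\<^sub>v \<eta> t + Nb *\<^sub>v f2 t (x t) (u t) - (Mb * Nb) *\<^sub>v x2 t)"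
    and "has_rate n2 xhat2
           (\<lambda>t. f2 t (x t) (u t) - regressor n2 r (vrhohat t) *\<^sub>v \<theta> t + K *\<^sub>v (xhat2 t - x2 t))"
    and "has_rate rbar \<theta>
           (\<lambda>t. (\<Lambda> * (regressor n2 r (vrhohat t))\<^sup>T * P) *\<^sub>v (xhat2 t - x2 t))"
  shows "vanishes (\<lambda>t. xhat2 t - x2 t) \<and>
         vanishes (\<lambda>t. dhat t - dvec t) \<and>
         ((\<forall>i<n2. persistently_exciting 0 (r i) 1 (\<lambda>t. mat_of_cols (r i) [vrho i t])) \<longrightarrow>
            vanishes_exponentially (\<lambda>t. xhat2 t - x2 t) \<and>
            vanishes_exponentially (\<lambda>t. dhat t - dvec t) \<and>
            vanishes_exponentially (\<lambda>t. \<theta> t - stacked_rows n2 \<Psi>))"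
proof -
  note d_eq = assms(4) and dvec_eq = assms(5) and r_pos = assms(6) and ode = assms(7) and rbar = assms(8)
    and \<upsilon>_eq = assms(9) and \<Phi>_eq = assms(10) and \<Gamma>_eq = assms(11) and M_car = assms(12)
    and M_hurwitz = assms(13) and N_car = assms(14) and T_car = assms(17) and T_inv = assms(18)
    and sylvester = assms(19) and Mb_eq = assms(20) and Nb_eq = assms(21) and vrho_eq = assms(22)
    and \<Psi>_eq = assms(23) and f2_car = assms(25) and u_car = assms(26) and x_eq = assms(27)
    and x1_rate = assms(28) and x2_rate = assms(29) and vrhohat_eq = assms(35) and dhat_eq = assms(36)
    and \<eta>_rate = assms(37)[unfolded rbar] and xhat2_rate = assms(38) and \<theta>_rate = assms(39)[unfolded rbar]
  let ?s = "\<Sum>l<n2. r l"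
  \<comment> \<open>The formula holds at every real time, so it is an equality of functions and the
    two-sided iterated \<open>deriv\<close> is meaningful at time 0 as well.\<close>
  have d_fun: "d i = (\<lambda>t. a0 i + (\<Sum>j\<in>{1..\<rho> i}. a i j * sin (\<omega> i j * t + \<phi> i j)))" if "i < n2" for i
    using d_eq[OF that] by auto
  have d_der: "((deriv ^^ k) (d i) has_real_derivative (deriv ^^ Suc k) (d i) t) (at t within {0..})"
    and d_bdd: "bdd_fn ((deriv ^^ k) (d i))" if "i < n2" for i k t
    by (rule trig_polynomial_derivatives[OF d_fun[OF that]], simp)+
  have \<Phi>_car: "\<Phi> i \<in> carrier_mat (r i) (r i)" for i by (simp add: \<Phi>_eq companion_def)
  have \<Gamma>_car: "\<Gamma> i \<in> carrier_mat 1 (r i)" for i by (simp add: \<Gamma>_eq first_unit_row_def)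
  have \<upsilon>_car: "\<upsilon> i t \<in> carrier_vec (r i)" for i t by (simp add: \<upsilon>_eq)
  have \<upsilon>_rate: "has_rate (r i) (\<upsilon> i) (\<lambda>t. \<Phi> i *\<^sub>v \<upsilon> i t)" if i: "i < n2" for i
    unfolding \<upsilon>_eq[abs_def] \<Phi>_eq by (rule companion_has_rate[OF d_der[OF i] ode[OF i]])
  have \<Gamma>\<upsilon>: "\<Gamma> i *\<^sub>v \<upsilon> i t = vec 1 (\<lambda>_. d i t)" if i: "i < n2" for i t
    unfolding \<Gamma>_eq first_unit_row_mult_vec[OF \<upsilon>_car r_pos[OF i]] using r_pos[OF i] by (simp add: \<upsilon>_eq)
  have vrho_mult: "vrho i t = (- T i) *\<^sub>v \<upsilon> i t" if i: "i < n2" for i t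
    using T_car[OF i] \<upsilon>_car[of i t] by (simp add: vrho_eq)
  have nT_car: "- T i \<in> carrier_mat (r i) (r i)" if "i < n2" for i using T_car[OF that] by simp
  have vrho_car: "vrho i t \<in> carrier_vec (r i)" if "i < n2" for i t
    unfolding vrho_mult[OF that] by (rule mult_mat_vec_carrier[OF nT_car[OF that] \<upsilon>_car])
  have vrho_rate: "has_rate (r i) (vrho i) (\<lambda>t. M i *\<^sub>v vrho i t - N i *\<^sub>v vec 1 (\<lambda>_. d i t))" if i: "i < n2" for i
  proof (rule has_rate_cong)
    have "has_rate (r i) (\<lambda>t. (- T i) *\<^sub>v \<upsilon> i t) (\<lambda>t. (- T i) *\<^sub>v (\<Phi> i *\<^sub>v \<upsilon> i t))"
      by (rule has_rate_const_mult_mat_vec[OF nT_car[OF i] \<upsilon>_rate[OF i] mult_mat_vec_carrier[OF \<Phi>_car \<upsilon>_car]])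
    then show "has_rate (r i) (vrho i) (\<lambda>t. (- T i) *\<^sub>v (\<Phi> i *\<^sub>v \<upsilon> i t))"
      unfolding vrho_mult[OF i, abs_def] .
    show "(- T i) *\<^sub>v (\<Phi> i *\<^sub>v \<upsilon> i t) = M i *\<^sub>v vrho i t - N i *\<^sub>v vec 1 (\<lambda>_. d i t)" for t
      unfolding vrho_eq \<Gamma>\<upsilon>[OF i, symmetric]
      by (rule sylvester_coordinates[OF T_car[OF i] \<Phi>_car M_car[OF i] N_car[OF i] \<Gamma>_car sylvester[OF i] \<upsilon>_car])
  qed
  have vrho_bdd: "bdd_fn (\<lambda>t. eucl_norm (vrho i t))" if i: "i < n2" for i
    unfolding vrho_mult[OF i]
  proof (rule bdd_fn_mult_mat_vec[OF bdd_mat_const[OF nT_car[OF i]] _ \<upsilon>_car])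
    show "bdd_fn (\<lambda>t. eucl_norm (\<upsilon> i t))"
      by (rule bdd_fn_eucl_normI[OF \<upsilon>_car]) (simp add: \<upsilon>_eq d_bdd[OF i])
  qed

  define rho where "rho = (\<lambda>t. blkcol n2 (\<lambda>i. vrho i t))"
  have rho_car: "rho t \<in> carrier_vec ?s" for t
    unfolding rho_def by (rule blkcol_carrier) (rule vrho_car)
  have block_rho: "block r i (rho t) = vrho i t" if "i < n2" for i t
    unfolding rho_def by (rule block_blkcol[OF vrho_car that])
  have Mb_car: "Mb \<in> carrier_mat ?s ?s" unfolding Mb_eq by (rule blkdiag_carrier) (rule M_car)
  have Nb_car': "Nb \<in> carrier_mat ?s (\<Sum>i<n2. 1)" unfolding Nb_eq by (rule blkdiag_carrier) (rule N_car)
  then have Nb_car: "Nb \<in> carrier_mat ?s n2" by simp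
  have dvec_car: "dvec t \<in> carrier_vec n2" for t by (simp add: dvec_eq)
  have Nd_car: "Nb *\<^sub>v dvec t \<in> carrier_vec ?s" for t by (rule mult_mat_vec_carrier[OF Nb_car dvec_car])
  have Mb_mult_car: "v \<in> carrier_vec ?s \<Longrightarrow> Mb *\<^sub>v v \<in> carrier_vec ?s" for v
    by (rule mult_mat_vec_carrier[OF Mb_car])
  have block_Mb: "block r i (Mb *\<^sub>v v) = M i *\<^sub>v block r i v" if "i < n2" "v \<in> carrier_vec ?s" for i v
    unfolding Mb_eq by (rule block_blkdiag_mult_vec[OF M_car that(2,1)])
  have block_Nd: "block r i (Nb *\<^sub>v dvec t) = N i *\<^sub>v vec 1 (\<lambda>_. d i t)" if "i < n2" for i t
  proof -
    have "block r i (Nb *\<^sub>v dvec t) = N i *\<^sub>v block (\<lambda>_. 1) i (dvec t)"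
      unfolding Nb_eq by (rule block_blkdiag_mult_vec[OF N_car _ that]) (use dvec_car[of t] in simp_all)
    also have "block (\<lambda>_. 1) i (dvec t) = vec 1 (\<lambda>_. d i t)"
      unfolding block_ones dvec_eq using that by simp
    finally show ?thesis .
  qed
  define rho' where "rho' = (\<lambda>t. Mb *\<^sub>v rho t - Nb *\<^sub>v dvec t)"
  have rho'_car: "rho' t \<in> carrier_vec ?s" for t
    unfolding rho'_def by (rule minus_carrier_vec[OF Mb_mult_car[OF rho_car] Nd_car])
  have rho_rate: "has_rate ?s rho rho'"
  proof (rule has_rate_blocksI[OF rho_car])
    fix i assume i: "i < n2"
    have "block r i (rho' t) = M i *\<^sub>v vrho i t - N i *\<^sub>v vec 1 (\<lambda>_. d i t)" for t
      unfolding rho'_def block_diff[OF Nd_car i] block_Mb[OF i rho_car] block_Nd[OF i] block_rho[OF i] ..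
    then show "has_rate (r i) (\<lambda>t. block r i (rho t)) (\<lambda>t. block r i (rho' t))"
      using vrho_rate[OF i] block_rho[OF i] by simp
  qed
  have f2_val: "f2 t (x t) (u t) \<in> carrier_vec n2" if t: "t \<ge> 0" for t
    using has_rate_carrier[OF x1_rate t] has_rate_carrier[OF x2_rate t] u_car[OF t]
    by (intro f2_car) (simp_all add: x_eq)
  \<comment> \<open>\<open>f2\<close> enters both \<open>\<eta>\<close> and
    \<open>Nb *\<^sub>v x2 t\<close> through \<open>Nb\<close> and cancels; the terms with
    \<open>Mb * Nb\<close> recombine into \<open>Mb *\<^sub>v vrhohat t\<close>. What remains is the
    equation of \<open>rho\<close>, with the unmeasured \<open>dvec\<close> as input.\<close>
  have vrhohat_rate: "has_rate ?s vrhohat (\<lambda>t. Mb *\<^sub>v vrhohat t - Nb *\<^sub>v dvec t)"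
  proof -
    have Nx2: "has_rate ?s (\<lambda>t. Nb *\<^sub>v x2 t) (\<lambda>t. Nb *\<^sub>v (f2 t (x t) (u t) + dvec t))"
      by (rule has_rate_const_mult_mat_vec[OF Nb_car x2_rate]) (intro add_carrier_vec f2_val dvec_car)
    have "has_rate ?s (\<lambda>t. \<eta> t - Nb *\<^sub>v x2 t)
        (\<lambda>t. (Mb *\<^sub>v \<eta> t + Nb *\<^sub>v f2 t (x t) (u t) - (Mb * Nb) *\<^sub>v x2 t) - Nb *\<^sub>v (f2 t (x t) (u t) + dvec t))"
      by (rule has_rate_diff[OF \<eta>_rate Nx2])
        (intro mult_mat_vec_carrier[OF Nb_car] add_carrier_vec f2_val dvec_car)
    then have "has_rate ?s vrhohat
        (\<lambda>t. (Mb *\<^sub>v \<eta> t + Nb *\<^sub>v f2 t (x t) (u t) - (Mb * Nb) *\<^sub>v x2 t) - Nb *\<^sub>v (f2 t (x t) (u t) + dvec t))"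
      unfolding vrhohat_eq[abs_def] .
    then show ?thesis
    proof (rule has_rate_cong)
      fix t :: real assume t: "t \<ge> 0"
      note \<eta>c = has_rate_carrier[OF \<eta>_rate t] and x2c = has_rate_carrier[OF x2_rate t]
      have Nx: "Nb *\<^sub>v x2 t \<in> carrier_vec ?s" by (rule mult_mat_vec_carrier[OF Nb_car x2c])
      have Nf: "Nb *\<^sub>v f2 t (x t) (u t) \<in> carrier_vec ?s" by (rule mult_mat_vec_carrier[OF Nb_car f2_val[OF t]])
      have 1: "Nb *\<^sub>v (f2 t (x t) (u t) + dvec t) = Nb *\<^sub>v f2 t (x t) (u t) + Nb *\<^sub>v dvec t"
        by (rule mult_add_distrib_mat_vec[OF Nb_car f2_val[OF t] dvec_car])
      have 2: "Mb *\<^sub>v vrhohat t = Mb *\<^sub>v \<eta> t - Mb *\<^sub>v (Nb *\<^sub>v x2 t)"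
        unfolding vrhohat_eq by (rule mult_minus_distrib_mat_vec[OF Mb_car \<eta>c Nx])
      show "(Mb *\<^sub>v \<eta> t + Nb *\<^sub>v f2 t (x t) (u t) - (Mb * Nb) *\<^sub>v x2 t) - Nb *\<^sub>v (f2 t (x t) (u t) + dvec t) =
          Mb *\<^sub>v vrhohat t - Nb *\<^sub>v dvec t"
        unfolding 1 2 assoc_mult_mat_vec[OF Mb_car Nb_car x2c]
        using carrier_vecD[OF Mb_mult_car[OF \<eta>c]] carrier_vecD[OF Mb_mult_car[OF Nx]]
          carrier_vecD[OF Nf] carrier_vecD[OF Nd_car[of t]]
        by (intro eq_vecI) (simp_all del: index_mult_mat_vec dim_mult_mat_vec)
    qed
  qed
  have vrhohat_car: "vrhohat t \<in> carrier_vec ?s" if "t \<ge> 0" for t by (rule has_rate_carrier[OF vrhohat_rate that])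

  \<comment> \<open>Both signals have the same input, so their difference is autonomous and inherits
    the decay of the Hurwitz blocks.\<close>
  define err where "err = (\<lambda>t. vrhohat t - rho t)"
  have err_car: "err t \<in> carrier_vec ?s" if "t \<ge> 0" for t
    unfolding err_def by (rule minus_carrier_vec[OF vrhohat_car[OF that] rho_car])
  have err_rate: "has_rate ?s err (\<lambda>t. Mb *\<^sub>v err t)"
  proof (rule has_rate_cong)
    show "has_rate ?s err (\<lambda>t. (Mb *\<^sub>v vrhohat t - Nb *\<^sub>v dvec t) - rho' t)"
      unfolding err_def by (rule has_rate_diff[OF vrhohat_rate rho_rate rho'_car])
    fix t :: real assume t: "t \<ge> 0"
    have "Mb *\<^sub>v err t = Mb *\<^sub>v vrhohat t - Mb *\<^sub>v rho t"
      unfolding err_def by (rule mult_minus_distrib_mat_vec[OF Mb_car vrhohat_car[OF t] rho_car])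
    then show "(Mb *\<^sub>v vrhohat t - Nb *\<^sub>v dvec t) - rho' t = Mb *\<^sub>v err t"
      unfolding rho'_def
      using carrier_vecD[OF Mb_mult_car[OF vrhohat_car[OF t]]] carrier_vecD[OF Mb_mult_car[OF rho_car[of t]]]
        carrier_vecD[OF Nd_car[of t]]
      by (intro eq_vecI) (simp_all del: index_mult_mat_vec dim_mult_mat_vec)
  qed
  have err_decay: "exp_decay (\<lambda>t. err t $ j)" if "j < ?s" for j
  proof (rule block_index_cases[OF _ that, where x = err])
    fix i k assume i: "i < n2" and k: "k < r i"
    have "has_rate (r i) (\<lambda>t. block r i (err t)) (\<lambda>t. M i *\<^sub>v block r i (err t))"
      by (rule has_rate_cong[OF has_rate_block[OF err_rate i]]) (rule block_Mb[OF i err_car])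
    then show "exp_decay (\<lambda>t. block r i (err t) $ k)"
      by (rule hurwitz_exp_decay[OF M_car[OF i] M_hurwitz[OF i] _ k])
  qed
  have rho_bdd: "bdd_fn (\<lambda>t. rho t $ j)" if "j < ?s" for j
  proof (rule block_index_cases[OF _ that, where x = rho])
    fix i k assume i: "i < n2" and k: "k < r i"
    show "bdd_fn (\<lambda>t. block r i (rho t) $ k)"
      unfolding block_rho[OF i] by (rule bdd_fn_index[OF vrho_bdd[OF i] vrho_car[OF i] k])
  qed
  \<comment> \<open>Boundedness comes from \<open>rho + err\<close>, not from the plant.\<close>
  have vrhohat_bdd: "bdd_fn (\<lambda>t. vrhohat t $ j)" if "j < ?s" for j
  proof (rule bdd_fn_cong[THEN iffD1])
    show "bdd_fn (\<lambda>t. rho t $ j + err t $ j)"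
      by (intro bdd_fn_add rho_bdd exp_decay_imp_bdd_fn err_decay that)
    show "rho t $ j + err t $ j = vrhohat t $ j" if "t \<ge> 0" for t
      using carrier_vecD[OF rho_car[of t]] carrier_vecD[OF vrhohat_car[OF that]] \<open>j < ?s\<close> by (simp add: err_def)
  qed
  have dvec_bdd: "bdd_fn (\<lambda>t. eucl_norm (dvec t))"
  proof (rule bdd_fn_eucl_normI[OF dvec_car])
    show "bdd_fn (\<lambda>t. dvec t $ i)" if "i < n2" for i using d_bdd[OF that, of 0] that by (simp add: dvec_eq)
  qed
  \<comment> \<open>Stated for a general \<open>v\<close> because the rates of \<open>rho\<close>
    and of \<open>vrhohat\<close> both have this form.\<close>
  have drive_bdd: "bdd_fn (\<lambda>t. eucl_norm (Mb *\<^sub>v v t - Nb *\<^sub>v dvec t))"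
    if "\<And>j. j < ?s \<Longrightarrow> bdd_fn (\<lambda>t. v t $ j)" "\<And>t. t \<ge> 0 \<Longrightarrow> v t \<in> carrier_vec ?s" for v
    by (rule bdd_fn_eucl_norm_diff[OF bdd_fn_mult_mat_vec[OF bdd_mat_const[OF Mb_car] bdd_fn_eucl_normI[OF that(2,1)] that(2)]
          bdd_fn_mult_mat_vec[OF bdd_mat_const[OF Nb_car] dvec_bdd dvec_car] Mb_mult_car[OF that(2)] Nd_car])
  have "bdd_fn (\<lambda>t. eucl_norm (rho' t))" unfolding rho'_def by (rule drive_bdd[OF rho_bdd rho_car])
  then have rho'_bdd: "bdd_fn (\<lambda>t. rho' t $ j)" if "j < ?s" for j
    by (rule bdd_fn_index[OF _ rho'_car that])
  have vrhohat'_bdd: "bdd_fn (\<lambda>t. (Mb *\<^sub>v vrhohat t - Nb *\<^sub>v dvec t) $ j)" if "j < ?s" for j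
    by (rule bdd_fn_index[OF drive_bdd[OF vrhohat_bdd vrhohat_car]
          minus_carrier_vec[OF Mb_mult_car[OF vrhohat_car] Nd_car] that])

  let ?C = "stacked_rows n2 \<Psi>"
  have \<Psi>_car: "\<Psi> i \<in> carrier_mat 1 (r i)" if "i < n2" for i
    unfolding \<Psi>_eq by (rule mult_carrier_mat[OF \<Gamma>_car invertible_mat_the_inverse(2)[OF T_car[OF that] T_inv[OF that]]])
  have C_car: "?C \<in> carrier_vec ?s" by (rule stacked_rows_carrier[OF \<Psi>_car])
  have block_C: "block r i ?C = row (\<Psi> i) 0" if "i < n2" for i
    by (rule block_stacked_rows[OF \<Psi>_car that])
  have reg_mult_car: "v \<in> carrier_vec ?s \<Longrightarrow> regressor n2 r w *\<^sub>v v \<in> carrier_vec n2" for v w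
    by (rule mult_mat_vec_carrier[OF regressor_carrier])
  \<comment> \<open>The roles of signal and parameter are exchanged: \<open>\<Psi> i\<close> applied
    to \<open>vrho i t\<close> is an inner product, which can equally be read as the row of a
    regressor acting on the stacked parameters.\<close>
  have dvec_reg: "dvec t = - (regressor n2 r (rho t) *\<^sub>v ?C)" for t
  proof (rule eq_vecI)
    show "dim_vec (dvec t) = dim_vec (- (regressor n2 r (rho t) *\<^sub>v ?C))"
      using carrier_vecD[OF reg_mult_car[OF C_car]] by (simp add: dvec_eq)
    fix i assume "i < dim_vec (- (regressor n2 r (rho t) *\<^sub>v ?C))"
    then have i: "i < n2" using carrier_vecD[OF reg_mult_car[OF C_car]] by simp
    have "(regressor n2 r (rho t) *\<^sub>v ?C) $ i = vrho i t \<bullet> row (\<Psi> i) 0"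
      unfolding regressor_mult_vec[OF C_car i] block_rho[OF i] block_C[OF i] ..
    also have "\<dots> = row (\<Psi> i) 0 \<bullet> vrho i t"
      by (rule comm_scalar_prod[OF vrho_car[OF i] row_carrier_vec[OF _ \<Psi>_car[OF i]]]) simp
    also have "\<dots> = (\<Psi> i *\<^sub>v vrho i t) $ 0" using carrier_matD(1)[OF \<Psi>_car[OF i]] by simp
    also have "\<Psi> i *\<^sub>v vrho i t = - (\<Gamma> i *\<^sub>v \<upsilon> i t)"
      unfolding \<Psi>_eq vrho_eq by (rule transformed_output[OF T_car[OF i] T_inv[OF i] \<Gamma>_car \<upsilon>_car])
    finally show "dvec t $ i = (- (regressor n2 r (rho t) *\<^sub>v ?C)) $ i"
      using carrier_vecD[OF reg_mult_car[OF C_car, of "rho t"]] i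
      by (simp add: dvec_eq \<Gamma>\<upsilon>[OF i] del: index_mult_mat_vec dim_mult_mat_vec)
  qed

  define W where "W = (\<lambda>t. regressor n2 r (vrhohat t))"
  define R where "R = (\<lambda>t. regressor n2 r (rho t))"
  \<comment> \<open>The effect of regressing on \<open>vrhohat\<close> in place of
    \<open>rho\<close>, evaluated at the true parameter.\<close>
  define b where "b = (\<lambda>t. regressor n2 r (err t) *\<^sub>v ?C)"
  define e where "e = (\<lambda>t. xhat2 t - x2 t)"
  define th where "th = (\<lambda>t. \<theta> t - ?C)"
  have W_car: "W t \<in> carrier_mat n2 ?s" and R_car: "R t \<in> carrier_mat n2 ?s" for t
    unfolding W_def R_def by (rule regressor_carrier)+
  have W_minus_R: "W t - R t = regressor n2 r (err t)" if "t \<ge> 0" for t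
    unfolding W_def R_def err_def by (rule regressor_diff[OF vrhohat_car[OF that] rho_car])
  have b_car: "b t \<in> carrier_vec n2" for t unfolding b_def by (rule reg_mult_car[OF C_car])
  have \<theta>_car: "\<theta> t \<in> carrier_vec ?s" if "t \<ge> 0" for t by (rule has_rate_carrier[OF \<theta>_rate that])
  have th_car: "th t \<in> carrier_vec ?s" if "t \<ge> 0" for t
    unfolding th_def by (rule minus_carrier_vec[OF \<theta>_car[OF that] C_car])
  \<comment> \<open>Adding and subtracting \<open>W t *\<^sub>v ?C\<close> splits the output error
    into parameter error and regressor mismatch; the same identity turns the equation of
    \<open>e\<close> into that of the locale.\<close>
  have out_err: "- (W t *\<^sub>v \<theta> t) - dvec t = - (W t *\<^sub>v th t) - b t" if t: "t \<ge> 0" for t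
  proof -
    have 1: "W t *\<^sub>v th t = W t *\<^sub>v \<theta> t - W t *\<^sub>v ?C"
      unfolding th_def by (rule mult_minus_distrib_mat_vec[OF W_car \<theta>_car[OF t] C_car])
    have 2: "b t = W t *\<^sub>v ?C - R t *\<^sub>v ?C"
      unfolding b_def W_minus_R[OF t, symmetric] by (rule minus_mult_distrib_mat_vec[OF W_car R_car C_car])
    have "dvec t = - (R t *\<^sub>v ?C)" unfolding R_def by (rule dvec_reg)
    then show ?thesis
      unfolding 1 2
      using carrier_vecD[OF mult_mat_vec_carrier[OF W_car \<theta>_car[OF t]]]
        carrier_vecD[OF mult_mat_vec_carrier[OF W_car C_car]] carrier_vecD[OF mult_mat_vec_carrier[OF R_car C_car]]
      by (intro eq_vecI) (simp_all del: index_mult_mat_vec dim_mult_mat_vec)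
  qed
  have K_car: "K \<in> carrier_mat n2 n2" by (rule assms(30))
  have e_rate: "has_rate n2 e (\<lambda>t. K *\<^sub>v e t - W t *\<^sub>v th t - b t)"
  proof (rule has_rate_cong)
    show "has_rate n2 e (\<lambda>t. (f2 t (x t) (u t) - regressor n2 r (vrhohat t) *\<^sub>v \<theta> t + K *\<^sub>v (xhat2 t - x2 t))
        - (f2 t (x t) (u t) + dvec t))"
      unfolding e_def by (rule has_rate_diff[OF xhat2_rate x2_rate]) (intro add_carrier_vec f2_val dvec_car)
    fix t :: real assume t: "t \<ge> 0"
    have ec: "e t \<in> carrier_vec n2"
      unfolding e_def by (rule minus_carrier_vec[OF has_rate_carrier[OF xhat2_rate t] has_rate_carrier[OF x2_rate t]])
    note dims = carrier_vecD[OF mult_mat_vec_carrier[OF W_car \<theta>_car[OF t]]]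
      carrier_vecD[OF mult_mat_vec_carrier[OF W_car th_car[OF t]]] carrier_vecD[OF b_car[of t]]
      carrier_vecD[OF mult_mat_vec_carrier[OF K_car ec]] carrier_vecD[OF f2_val[OF t]] carrier_vecD[OF dvec_car[of t]]
    have "(f2 t (x t) (u t) - W t *\<^sub>v \<theta> t + K *\<^sub>v e t) - (f2 t (x t) (u t) + dvec t) =
        K *\<^sub>v e t + (- (W t *\<^sub>v \<theta> t) - dvec t)"
      using dims by (intro eq_vecI) (simp_all del: index_mult_mat_vec dim_mult_mat_vec)
    also have "\<dots> = K *\<^sub>v e t - W t *\<^sub>v th t - b t"
      unfolding out_err[OF t] using dims by (intro eq_vecI) (simp_all del: index_mult_mat_vec dim_mult_mat_vec)
    finally show "(f2 t (x t) (u t) - regressor n2 r (vrhohat t) *\<^sub>v \<theta> t + K *\<^sub>v (xhat2 t - x2 t))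
        - (f2 t (x t) (u t) + dvec t) = K *\<^sub>v e t - W t *\<^sub>v th t - b t"
      unfolding e_def W_def .
  qed
  have th_rate: "has_rate ?s th (\<lambda>t. (\<Lambda> * (W t)\<^sup>T * P) *\<^sub>v e t)"
    unfolding has_rate_def
  proof (intro allI impI conjI)
    fix t :: real and j assume t: "t \<ge> 0" and j: "j < ?s"
    have "((\<lambda>s. \<theta> s $ j - ?C $ j) has_real_derivative ((\<Lambda> * (W t)\<^sup>T * P) *\<^sub>v e t) $ j - 0) (at t within {0..})"
      using has_rate_index[OF \<theta>_rate t j] unfolding W_def e_def by (intro DERIV_diff DERIV_const)
    then show "((\<lambda>s. th s $ j) has_real_derivative ((\<Lambda> * (W t)\<^sup>T * P) *\<^sub>v e t) $ j) (at t within {0..})"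
      using carrier_vecD[OF C_car] j by (simp add: th_def)
  qed (rule th_car)
  have W_bdd: "bdd_mat n2 ?s W" unfolding W_def by (rule bdd_mat_regressor[OF vrhohat_bdd])
  have err_mat: "exp_decay_mat n2 ?s (\<lambda>t. regressor n2 r (err t))" by (rule exp_decay_mat_regressor[OF err_decay])
  have b_decay: "exp_decay (\<lambda>t. eucl_norm (b t))"
    unfolding b_def by (rule exp_decay_mult_mat_vec[OF err_mat bdd_fn_const C_car])
  interpret adaptive_error n2 ?s K P \<Lambda> e th b W
    by unfold_locales
      (rule b_car | fact K_car assms(32) assms(33) assms(34)[unfolded rbar] W_bdd b_decay e_rate th_rate)+
  have dhat_err: "dhat t - dvec t = - (W t *\<^sub>v th t) - b t" if "t \<ge> 0" for t
    using out_err[OF that] unfolding dhat_eq W_def .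
  have err'_bdd: "bdd_fn (\<lambda>t. (Mb *\<^sub>v err t) $ j)" if "j < ?s" for j
    by (rule bdd_fn_index[OF bdd_fn_mult_mat_vec[OF bdd_mat_const[OF Mb_car]
            bdd_fn_eucl_normI[OF err_car exp_decay_imp_bdd_fn[OF err_decay]] err_car] Mb_mult_car[OF err_car] that])
  have "vanishes (\<lambda>t. - (W t *\<^sub>v th t) - b t)"
  proof (rule vanishes_output)
    show "has_mat_rate n2 ?s W (\<lambda>t. regressor n2 r (Mb *\<^sub>v vrhohat t - Nb *\<^sub>v dvec t))"
      unfolding W_def by (rule has_mat_rate_regressor[OF vrhohat_rate])
    show "bdd_mat n2 ?s (\<lambda>t. regressor n2 r (Mb *\<^sub>v vrhohat t - Nb *\<^sub>v dvec t))"
      by (rule bdd_mat_regressor[OF vrhohat'_bdd])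
    \<comment> \<open>The parameter is treated as a constant signal with zero rate, so that the
      matrix product rule yields the rate of \<open>b\<close>.\<close>
    have "has_rate ?s (\<lambda>t. ?C) (\<lambda>t. 0\<^sub>v ?s)" using C_car by (intro has_rateI) auto
    from has_rate_mult_mat_vec[OF has_mat_rate_regressor[OF err_rate] this]
    show "has_rate n2 b (\<lambda>t. regressor n2 r (Mb *\<^sub>v err t) *\<^sub>v ?C)"
      unfolding b_def
    proof (rule has_rate_cong)
      fix t :: real
      have "regressor n2 r (err t) *\<^sub>v 0\<^sub>v ?s = 0\<^sub>v n2"
        using regressor_carrier[of n2 r "err t"] by (intro eq_vecI) auto
      then show "regressor n2 r (Mb *\<^sub>v err t) *\<^sub>v ?C + regressor n2 r (err t) *\<^sub>v 0\<^sub>v ?s =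
          regressor n2 r (Mb *\<^sub>v err t) *\<^sub>v ?C"
        using reg_mult_car[OF C_car, of "Mb *\<^sub>v err t"] by simp
    qed simp
    show "bdd_fn (\<lambda>t. eucl_norm (regressor n2 r (Mb *\<^sub>v err t) *\<^sub>v ?C))"
      by (rule bdd_fn_mult_mat_vec[OF bdd_mat_regressor[OF err'_bdd] bdd_fn_const C_car])
  qed (rule reg_mult_car[OF C_car])
  then have v2: "vanishes (\<lambda>t. dhat t - dvec t)"
    unfolding vanishes_def
  proof (rule Lim_transform_eventually)
    show "\<forall>\<^sub>F t in at_top. eucl_norm (- (W t *\<^sub>v th t) - b t) = eucl_norm (dhat t - dvec t)"
      using eventually_ge_at_top[of 0] by eventually_elim (simp add: dhat_err)
  qed
  have "vanishes_exponentially e \<and> vanishes_exponentially (\<lambda>t. dhat t - dvec t) \<and> vanishes_exponentially th"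
    if pe: "\<forall>i<n2. persistently_exciting 0 (r i) 1 (\<lambda>t. mat_of_cols (r i) [vrho i t])"
  proof -
    \<comment> \<open>The hypothesis speaks of the separate \<open>vrho i\<close>; here it is read
      as a property of the blocks of one stacked signal.\<close>
    have pe': "persistently_exciting 0 (r i) 1 (\<lambda>t. mat_of_cols (r i) [block r i (rho t)])" if "i < n2" for i
      using pe that by (simp add: block_rho)
    obtain \<alpha> T0 where \<alpha>: "\<alpha> > 0" "T0 > 0"
      "\<And>t v. t \<ge> 0 \<Longrightarrow> v \<in> carrier_vec ?s \<Longrightarrow>
         \<alpha> * (v \<bullet> v) \<le> integral {t..t + T0} (\<lambda>\<tau>. (regressor n2 r (rho \<tau>) *\<^sub>v v) \<bullet> (regressor n2 r (rho \<tau>) *\<^sub>v v))"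
      by (rule persistently_exciting_regressor[OF pe' rho_rate]) (assumption, rule that)
    have excite: "\<alpha> * (v \<bullet> v) \<le> integral {t..t + T0} (\<lambda>\<tau>. (R \<tau> *\<^sub>v v) \<bullet> (R \<tau> *\<^sub>v v))"
      if "t \<ge> 0" "v \<in> carrier_vec ?s" for t v
      unfolding R_def by (rule \<alpha>(3)[OF that])
    have R1: "has_mat_rate n2 ?s R (\<lambda>t. regressor n2 r (rho' t))"
      unfolding R_def by (rule has_mat_rate_regressor[OF rho_rate])
    have R2: "bdd_mat n2 ?s R" unfolding R_def by (rule bdd_mat_regressor[OF rho_bdd])
    have R3: "bdd_mat n2 ?s (\<lambda>t. regressor n2 r (rho' t))" by (rule bdd_mat_regressor[OF rho'_bdd])
    have WR: "exp_decay_mat n2 ?s (\<lambda>t. W t - R t)"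
      unfolding exp_decay_mat_def
    proof (intro conjI allI impI)
      fix i j assume "i < n2" "j < ?s"
      then have "exp_decay (\<lambda>t. regressor n2 r (err t) $$ (i, j))"
        using err_mat unfolding exp_decay_mat_def by blast
      then show "exp_decay (\<lambda>t. (W t - R t) $$ (i, j))"
        by (rule exp_decay_cong[THEN iffD1, rotated]) (simp only: W_minus_R)
    qed (rule minus_carrier_mat[OF R_car])
    have dec: "exp_decay (\<lambda>t. eucl_norm (e t))" "exp_decay (\<lambda>t. eucl_norm (th t))"
      by (rule exponential_decay[OF R1 R2 R3 WR \<alpha>(1,2) excite]; assumption)+
    \<comment> \<open>No further Barbalat argument is required: the output error is bounded
      \<open>W\<close> times decaying \<open>th\<close>, plus decaying \<open>b\<close>, up to
      sign.\<close>
    have "exp_decay (\<lambda>t. eucl_norm (W t *\<^sub>v th t + b t))"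
      by (rule exp_decay_eucl_norm_add[OF exp_decay_bdd_mult_mat_vec[OF W_bdd dec(2) th_car] b_decay
            mult_mat_vec_carrier[OF W_car th_car] b_car])
    then have "exp_decay (\<lambda>t. eucl_norm (dhat t - dvec t))"
    proof (rule exp_decay_mono)
      fix t :: real assume t: "t \<ge> 0"
      have "- (W t *\<^sub>v th t) - b t = - (W t *\<^sub>v th t + b t)"
        using carrier_vecD[OF mult_mat_vec_carrier[OF W_car th_car[OF t]]] carrier_vecD[OF b_car[of t]]
        by (intro eq_vecI) (simp_all del: index_mult_mat_vec dim_mult_mat_vec)
      then show "norm (eucl_norm (dhat t - dvec t)) \<le> norm (eucl_norm (W t *\<^sub>v th t + b t))"
        unfolding dhat_err[OF t] by (simp add: eucl_norm_minus)
    qed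
    with dec show ?thesis unfolding vanishes_exponentially_iff by blast
  qed
  with vanishes_e v2 show ?thesis unfolding e_def th_def by blast
qed

end
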